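(* Let $n\ge11$ with $n\ne12,14$. Then the group $H(n,3)$ is hyperbolic.
   Context: $H(n,3)=H_n(3,1)$ is the group defined by the presentation $\langle x_1,\ldots,x_n\mid x_ix_{i+3}=x_{i+1}\ (1\le i\le n)\rangle$, subscripts mod $n$. *)

theory Defs
  imports Main "HOL-Library.Extended_Real"
begin

text \<open>Group presentations: a letter is a pair (generator, inverted?);
  words are lists of letters.\<close>

type_synonym 'g letter = "'g \<times> bool"
type_synonym 'g word = "'g letter list"

definition inv_letter :: "'g letter \<Rightarrow> 'g letter" where
  "inv_letter a = (fst a, \<not> snd a)"

inductive pres_eq :: "'g word list \<Rightarrow> 'g word \<Rightarrow> 'g word \<Rightarrow> bool" for R where
  pres_refl: "pres_eq R u u"
| pres_sym: "pres_eq R u v \<Longrightarrow> pres_eq R v u"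
| pres_trans: "pres_eq R u v \<Longrightarrow> pres_eq R v w \<Longrightarrow> pres_eq R u w"
| pres_cancel: "pres_eq R (u @ [a, inv_letter a] @ v) (u @ v)"
| pres_rel: "r \<in> set R \<Longrightarrow> pres_eq R (u @ r @ v) (u @ v)"

definition words_over :: "'g set \<Rightarrow> 'g word set" where
  "words_over S = {w. \<forall>a\<in>set w. fst a \<in> S}"

definition word_dist :: "'g set \<Rightarrow> 'g word list \<Rightarrow> 'g word \<Rightarrow> 'g word \<Rightarrow> nat" where
  "word_dist S R u v = (LEAST k. \<exists>w \<in> words_over S. length w = k \<and> pres_eq R (u @ w) v)"

definition gromov_product :: "'g set \<Rightarrow> 'g word list \<Rightarrow> 'g word \<Rightarrow> 'g word \<Rightarrow> 'g word \<Rightarrow> real" where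
  "gromov_product S R w x y =
     (real (word_dist S R w x) + real (word_dist S R w y) - real (word_dist S R x y)) / 2"

definition hyperbolic_presentation :: "'g set \<Rightarrow> 'g word list \<Rightarrow> bool" where
  "hyperbolic_presentation S R \<longleftrightarrow> finite S \<and> (\<forall>r\<in>set R. r \<in> words_over S) \<and>
     (\<exists>\<delta>::real. \<forall>w\<in>words_over S. \<forall>x\<in>words_over S. \<forall>y\<in>words_over S. \<forall>z\<in>words_over S.
        gromov_product S R w x z \<ge> min (gromov_product S R w x y) (gromov_product S R w y z) - \<delta>)"

text \<open>H(n,3): generators x_1..x_n (here indexed 0..n-1), relators
  x_i x_{i+3} x_{i+1}^{-1}, subscripts mod n.\<close>
definition H3_relators :: "nat \<Rightarrow> nat word list" where
  "H3_relators n = map (\<lambda>i. [(i, False), ((i + 3) mod n, False), ((i + 1) mod n, True)]) [0..<n]"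

definition H3_hyperbolic :: "nat \<Rightarrow> bool" where
  "H3_hyperbolic n \<longleftrightarrow> hyperbolic_presentation {0..<n} (H3_relators n)"

end

theory Submission
  imports Defs
begin

text \<open>
  A word representing the identity bounds a reduced planar diagram whose faces are triangles. The links of
  its vertices are closed reduced walks in the generalised Petersen graph \<open>GP(n, 2)\<close>; for the given \<open>n\<close> these have
  length \<open>5\<close> or at least \<open>8\<close>. Vertices of degree five carry positive curvature, which they pass on to their
  neighbours of higher degree; every interior vertex of degree at least eight stays negatively curved, so the number of
  triangles is bounded linearly in the length of the boundary.

  In place of Dehn functions, the linear bound is used for the signed area \<open>\<integral> f dg\<close> of a loop with respect to
  1-Lipschitz functions \<open>f\<close>, \<open>g\<close>: it is additive over the triangles of a filling, and each triangle
  contributes a bounded amount. Choosing for \<open>f\<close> a truncated distance to two sides of a geodesic triangle and for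
  \<open>g\<close> the length along the third side makes this area large if the triangle is fat; hence triangles are
  slim, and the four-point inequality follows.
\<close>

section \<open>Combinatorial maps\<close>

text \<open>The cases \<open>n = 12\<close> and \<open>n = 14\<close> drop out because there the
  link edges \<open>I_j I_(j+2)\<close> close up to cycles of length 6 and 7. The obstacle to
  discharging is degree eight: such a vertex can give away at most 39 of its 40 units, far less than
  the largest payment 9 from all its neighbours. What saves it is that certain pairs of consecutive
  neighbours cannot both have degree five (\<open>excl\<close>). From degree eleven on the crude
  rate 9 per neighbour is affordable, so only link words of length at most 10 have to be enumerated.
  Their displacement is at most 20, and \<open>n\<close> enters only through its multiples in that
  range.

  Maps are given by permutations of darts, so that cutting and joining faces is an exchange of two
  values and planarity is a statement about numbers of cycles. This lets a derivation of
  \<open>pres_eq\<close> be followed step by step without any topology. Signed area suits such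
  diagrams: it is a sum over darts, and a loop is tested against functions chosen for it, so no
  filling ever has to be cut or compared with another.\<close>

definition conn :: "('a \<times> 'a) set \<Rightarrow> ('a \<times> 'a) set" where
  "conn r = (r \<union> r\<inverse>)\<^sup>*"

definition ncc :: "'a set \<Rightarrow> ('a \<times> 'a) set \<Rightarrow> nat" where
  "ncc D r = card ((\<lambda>x. conn r `` {x}) ` D)"

lemma conn_refl [simp]: "(x, x) \<in> conn r"
  by (simp add: conn_def)

lemma conn_sym: "(x, y) \<in> conn r \<Longrightarrow> (y, x) \<in> conn r"
  unfolding conn_def by (metis converse_Un converse_converse converseI rtrancl_converse sup_commute)

lemma conn_trans: "(x, y) \<in> conn r \<Longrightarrow> (y, z) \<in> conn r \<Longrightarrow> (x, z) \<in> conn r"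
  unfolding conn_def by simp

lemma conn_base: "(x, y) \<in> r \<Longrightarrow> (x, y) \<in> conn r"
  unfolding conn_def by auto

lemma conn_class_eq: "conn r `` {x} = conn r `` {y} \<longleftrightarrow> (x, y) \<in> conn r"
proof
  assume "conn r `` {x} = conn r `` {y}"
  then show "(x, y) \<in> conn r" by (metis Image_singleton_iff conn_refl)
next
  assume "(x, y) \<in> conn r"
  then show "conn r `` {x} = conn r `` {y}"
    unfolding set_eq_iff Image_singleton_iff by (metis conn_sym conn_trans)
qed

lemma conn_hom:
  assumes "\<And>x y. (x, y) \<in> r \<Longrightarrow> (f x, f y) \<in> conn r'" and "(x, y) \<in> conn r"
  shows "(f x, f y) \<in> conn r'"
  using assms(2) unfolding conn_def[of r]
proof (induction rule: rtrancl_induct)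
  case (step y z)
  from step(2) have "(f y, f z) \<in> conn r'" using assms(1)[of y z] assms(1)[of z y, THEN conn_sym] by auto
  with step(3) show ?case by (rule conn_trans)
qed simp

lemma conn_mono: "(\<And>x y. (x, y) \<in> r \<Longrightarrow> (x, y) \<in> conn r') \<Longrightarrow> (x, y) \<in> conn r \<Longrightarrow> (x, y) \<in> conn r'"
  using conn_hom[of r "\<lambda>x. x" r'] by blast

lemma conn_eqI:
  assumes "\<And>x y. (x, y) \<in> r \<Longrightarrow> (x, y) \<in> conn r'" "\<And>x y. (x, y) \<in> r' \<Longrightarrow> (x, y) \<in> conn r"
  shows "conn r = conn r'"
  using conn_mono[OF assms(1)] conn_mono[OF assms(2)] by auto

lemma ncc_cong: "conn r = conn r' \<Longrightarrow> ncc D r = ncc D r'"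
  by (simp add: ncc_def)

text \<open>Compatibility makes \<open>f\<close> act on classes, and every class that meets
  \<open>D'\<close> is hit by one that meets \<open>D\<close>.\<close>

lemma ncc_hom_le:
  assumes "finite D" and hom: "\<And>x y. (x, y) \<in> r \<Longrightarrow> (f x, f y) \<in> conn r'"
    and surj: "\<And>y. y \<in> D' \<Longrightarrow> \<exists>x\<in>D. (f x, y) \<in> conn r'"
  shows "ncc D' r' \<le> ncc D r"
proof -
  let ?g = "\<lambda>C. conn r' `` (f ` C)"
  have "(\<lambda>y. conn r' `` {y}) ` D' \<subseteq> ?g ` (\<lambda>x. conn r `` {x}) ` D"
  proof
    fix C assume "C \<in> (\<lambda>y. conn r' `` {y}) ` D'"
    then obtain y where y: "y \<in> D'" "C = conn r' `` {y}" by auto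
    obtain x where x: "x \<in> D" "(f x, y) \<in> conn r'" using surj[OF y(1)] by auto
    have "?g (conn r `` {x}) = C"
    proof (intro set_eqI iffI)
      fix z assume "z \<in> ?g (conn r `` {x})"
      then obtain w where w: "(x, w) \<in> conn r" "(f w, z) \<in> conn r'" by auto
      show "z \<in> C" using conn_hom[of r f r', OF hom w(1)] w(2) x(2) y(2) by (blast intro: conn_trans conn_sym)
    next
      fix z assume "z \<in> C"
      then have "(f x, z) \<in> conn r'" using x(2) y(2) by (blast intro: conn_trans)
      then show "z \<in> ?g (conn r `` {x})" using conn_refl[of x r] by blast
    qed
    then show "C \<in> ?g ` (\<lambda>x. conn r `` {x}) ` D" using x(1) by blast
  qed
  then show ?thesis unfolding ncc_def using assms(1) by (meson card_image_le card_mono finite_imageI le_trans)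
qed

lemma conn_insert:
  "(u, v) \<in> conn (insert (x, y) r) \<longleftrightarrow>
    (u, v) \<in> conn r \<or> (u, x) \<in> conn r \<and> (y, v) \<in> conn r \<or> (u, y) \<in> conn r \<and> (x, v) \<in> conn r"
  (is "?L \<longleftrightarrow> ?R u v")
proof
  assume "?L"
  then show "?R u v"
    unfolding conn_def[of "insert _ _"]
  proof (induction rule: rtrancl_induct)
    case (step a b)
    have "(a, b) \<in> conn r \<or> (a = x \<and> b = y) \<or> (a = y \<and> b = x)"
      using step(2) conn_base[of a b r] conn_base[of b a r] conn_sym[of b a r] by auto
    then show ?case using step(3) by (metis conn_refl conn_sym conn_trans)
  qed simp
next
  have m: "conn r \<subseteq> conn (insert (x, y) r)"
    using conn_mono[of r "insert (x, y) r"] conn_base by (metis insertI2 subrelI)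
  have "(x, y) \<in> conn (insert (x, y) r)" by (simp add: conn_base)
  then show "?R u v \<Longrightarrow> ?L" using m by (meson conn_sym conn_trans subsetD)
qed

lemma conn_insert_same: "(x, y) \<in> conn r \<Longrightarrow> conn (insert (x, y) r) = conn r"
  by (rule conn_eqI) (auto intro: conn_base)

lemma ncc_insert:
  assumes "finite D" "x \<in> D" "y \<in> D" "(x, y) \<notin> conn r"
  shows "ncc D r = Suc (ncc D (insert (x, y) r))"
proof -
  let ?c = "\<lambda>z. conn r `` {z}" and ?c' = "\<lambda>z. conn (insert (x, y) r) `` {z}"
  have cl: "?c' z = (if (x, z) \<in> conn r \<or> (y, z) \<in> conn r then ?c x \<union> ?c y else ?c z)" for z
  proof (rule set_eqI)
    fix w
    have "(z, w) \<in> conn (insert (x, y) r) \<longleftrightarrow>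
      (if (x, z) \<in> conn r \<or> (y, z) \<in> conn r then (x, w) \<in> conn r \<or> (y, w) \<in> conn r else (z, w) \<in> conn r)"
      unfolding conn_insert by (metis conn_sym conn_trans)
    then show "w \<in> ?c' z \<longleftrightarrow> w \<in> (if (x, z) \<in> conn r \<or> (y, z) \<in> conn r then ?c x \<union> ?c y else ?c z)" by simp
  qed
  have ne: "?c x \<noteq> ?c y" using assms(4) conn_class_eq by metis
  let ?A = "?c ` D"
  have img: "?c' ` D = insert (?c x \<union> ?c y) (?A - {?c x, ?c y})"
  proof
    show "?c' ` D \<subseteq> insert (?c x \<union> ?c y) (?A - {?c x, ?c y})"
    proof
      fix C assume "C \<in> ?c' ` D"
      then obtain z where z: "z \<in> D" "C = ?c' z" by auto
      show "C \<in> insert (?c x \<union> ?c y) (?A - {?c x, ?c y})"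
      proof (cases "(x, z) \<in> conn r \<or> (y, z) \<in> conn r")
        case True
        then have "C = ?c x \<union> ?c y" unfolding z(2) cl by (rule if_P)
        then show ?thesis by blast
      next
        case False
        then have "C = ?c z" unfolding z(2) cl by (rule if_not_P)
        moreover have "?c z \<noteq> ?c x" "?c z \<noteq> ?c y"
          unfolding conn_class_eq using False conn_sym[of z x r] conn_sym[of z y r] by auto
        ultimately show ?thesis using z(1) by blast
      qed
    qed
    show "insert (?c x \<union> ?c y) (?A - {?c x, ?c y}) \<subseteq> ?c' ` D"
    proof
      fix C assume "C \<in> insert (?c x \<union> ?c y) (?A - {?c x, ?c y})"
      then consider "C = ?c x \<union> ?c y" | z where "z \<in> D" "C = ?c z" "?c z \<noteq> ?c x" "?c z \<noteq> ?c y" by auto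
      then show "C \<in> ?c' ` D"
      proof cases
        case 1
        then have "C = ?c' x" unfolding cl[of x] by (simp only: conn_refl simp_thms if_True)
        then show ?thesis using assms(2) by blast
      next
        case 2
        have "\<not> ((x, z) \<in> conn r \<or> (y, z) \<in> conn r)"
          using 2(3,4) conn_sym[of x z r] conn_sym[of y z r] unfolding conn_class_eq by auto
        then have "C = ?c' z" unfolding cl[of z] 2(2) by (simp only: if_False)
        then show ?thesis using 2 by blast
      qed
    qed
  qed
  have notin: "?c x \<union> ?c y \<notin> ?A - {?c x, ?c y}"
  proof
    assume "?c x \<union> ?c y \<in> ?A - {?c x, ?c y}"
    then obtain z where z: "?c x \<union> ?c y = ?c z" "?c z \<noteq> ?c x" by auto
    then have "(z, x) \<in> conn r" by (metis Image_singleton_iff UnI1 conn_refl)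
    then show False using z(2) conn_class_eq by metis
  qed
  have "card (?A - {?c x, ?c y}) = card ?A - 2"
    using ne assms(1,2,3) by (subst card_Diff_subset) auto
  moreover have "card ?A \<ge> 2"
    using ne assms(1,2,3) card_mono[of ?A "{?c x, ?c y}"] by simp
  moreover have "card (insert (?c x \<union> ?c y) (?A - {?c x, ?c y})) = Suc (card (?A - {?c x, ?c y}))"
    by (rule card_insert_disjoint[OF _ notin]) (simp add: assms(1))
  ultimately show ?thesis unfolding ncc_def img by linarith
qed

lemma ncc_insert_eq:
  assumes "finite D" "x \<in> D" "y \<in> D"
  shows "ncc D r = ncc D (insert (x, y) r) + of_bool ((x, y) \<notin> conn r)"
proof (cases "(x, y) \<in> conn r")
  case True
  then show ?thesis using ncc_cong[OF conn_insert_same[OF True], of D] by simp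
qed (use ncc_insert[OF assms, of r] in simp)

lemma conn_Un_disjoint:
  assumes "r \<subseteq> D \<times> D" "s \<subseteq> E \<times> E" "D \<inter> E = {}" "x \<in> D" "(x, y) \<in> conn (r \<union> s)"
  shows "y \<in> D \<and> (x, y) \<in> conn r"
  using assms(5) unfolding conn_def[of "r \<union> s"]
proof (induction rule: rtrancl_induct)
  case base then show ?case using assms(4) by simp
next
  case (step y z)
  then have "(y, z) \<in> r \<or> (z, y) \<in> r" using assms(1,2,3) by blast
  then have "z \<in> D \<and> (y, z) \<in> conn r"
    using assms(1) conn_base[of y z r] conn_base[of z y r] conn_sym[of z y r] by auto
  then show ?case using conn_trans[of x y r z] step(3) by simp
qed

lemma conn_le_Un: "(x, y) \<in> conn r \<Longrightarrow> (x, y) \<in> conn (r \<union> s)"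
  by (rule conn_mono[of r]) (auto intro: conn_base)

lemma ncc_Un_disjoint:
  assumes "r \<subseteq> D \<times> D" "s \<subseteq> E \<times> E" "D \<inter> E = {}" "finite D" "finite E"
  shows "ncc (D \<union> E) (r \<union> s) = ncc D r + ncc E s"
proof -
  have 1: "conn (r \<union> s) `` {x} = conn r `` {x}" if "x \<in> D" for x
    using conn_Un_disjoint[OF assms(1-3) that] conn_le_Un[of x _ r s] by auto
  have 2: "conn (r \<union> s) `` {x} = conn s `` {x}" if "x \<in> E" for x
    using conn_Un_disjoint[OF assms(2,1) _ that] assms(3) conn_le_Un[of x _ s r] by (auto simp: Un_commute)
  have "(\<lambda>x. conn (r \<union> s) `` {x}) ` (D \<union> E) = (\<lambda>x. conn r `` {x}) ` D \<union> (\<lambda>x. conn s `` {x}) ` E"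
    using 1 2 by (simp add: image_Un)
  moreover have "(\<lambda>x. conn r `` {x}) ` D \<inter> (\<lambda>x. conn s `` {x}) ` E = {}"
  proof -
    have "conn r `` {x} \<noteq> conn s `` {y}" if "x \<in> D" "y \<in> E" for x y
    proof
      assume "conn r `` {x} = conn s `` {y}"
      then have "(x, y) \<in> conn r" by (metis Image_singleton_iff conn_refl)
      then have "y \<in> D" using conn_Un_disjoint[of r D "{}" "{}" x y] that assms(1) by auto
      then show False using that assms(3) by auto
    qed
    then show ?thesis by blast
  qed
  ultimately show ?thesis unfolding ncc_def using assms(4,5) by (simp add: card_Un_disjoint)
qed

section \<open>Permutations: cycles and exchanges of two values\<close>

definition gr :: "'a set \<Rightarrow> ('a \<Rightarrow> 'a) \<Rightarrow> ('a \<times> 'a) set" where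
  "gr D p = (\<lambda>x. (x, p x)) ` D"

lemma gr_iff: "(x, y) \<in> gr D p \<longleftrightarrow> x \<in> D \<and> y = p x"
  by (auto simp: gr_def)

lemma gr_sub: "bij_betw p D D \<Longrightarrow> gr D p \<subseteq> D \<times> D"
  by (auto simp: gr_def bij_betw_def)

lemma gr_cong: "(\<And>x. x \<in> D \<Longrightarrow> p x = q x) \<Longrightarrow> gr D p = gr D q"
  by (auto simp: gr_def)

lemma gr_Un: "gr (D \<union> E) p = gr D p \<union> gr E p"
  by (auto simp: gr_def)

lemma bij_funpow_in: "bij_betw p D D \<Longrightarrow> x \<in> D \<Longrightarrow> (p ^^ k) x \<in> D"
  by (induction k) (auto simp: bij_betw_def)

lemma funpow_conn: "bij_betw p D D \<Longrightarrow> x \<in> D \<Longrightarrow> (x, (p ^^ k) x) \<in> conn (gr D p)"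
proof (induction k)
  case (Suc k)
  then show ?case using bij_funpow_in[of p D x k] conn_base[of "(p ^^ k) x" "p ((p ^^ k) x)" "gr D p"] conn_trans
    by (fastforce simp: gr_iff)
qed simp

lemma bij_funpow_cancel:
  assumes "bij_betw p D D" "x \<in> D" "(p ^^ (i + k)) x = (p ^^ i) x"
  shows "(p ^^ k) x = x"
  using assms(3)
proof (induction i)
  case (Suc i)
  then show ?case using bij_funpow_in[OF assms(1,2)] assms(1) by (auto simp: bij_betw_def inj_on_def)
qed simp

lemma funpow_period:
  assumes "finite D" "bij_betw p D D" "x \<in> D"
  shows "\<exists>k>0. (p ^^ k) x = x"
proof -
  have "\<not> inj_on (\<lambda>k. (p ^^ k) x) UNIV"
    using bij_funpow_in[OF assms(2,3)] finite_subset[OF _ assms(1), of "range (\<lambda>k. (p ^^ k) x)"] finite_imageD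
    by (metis image_subsetI infinite_UNIV_nat)
  then obtain i j where "i < j" "(p ^^ i) x = (p ^^ j) x"
    unfolding inj_on_def by (metis linorder_neqE_nat)
  then show ?thesis using bij_funpow_cancel[OF assms(2,3), of i "j - i"]
    by (intro exI[of _ "j - i"]) auto
qed

lemma conn_gr_funpow:
  assumes "finite D" "bij_betw p D D" "x \<in> D" "(x, y) \<in> conn (gr D p)"
  shows "\<exists>k. y = (p ^^ k) x"
  using assms(4) unfolding conn_def
proof (induction rule: rtrancl_induct)
  case base then show ?case by (metis funpow_0)
next
  case (step y z)
  then obtain k where k: "y = (p ^^ k) x" by auto
  have yD: "y \<in> D" using k bij_funpow_in[OF assms(2,3)] by simp
  from step(2) consider "z = p y" | "z \<in> D" "y = p z" by (auto simp: gr_iff)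
  then show ?case
  proof cases
    case 1 then show ?thesis using k by (intro exI[of _ "Suc k"]) simp
  next
    case 2
    obtain m where m: "m > 0" "(p ^^ m) z = z" using funpow_period[OF assms(1,2) 2(1)] by auto
    then have "z = (p ^^ (m - 1)) y" using 2(2) by (metis Suc_diff_1 comp_apply funpow_Suc_right)
    then show ?thesis using k by (metis comp_apply funpow_add)
  qed
qed

text \<open>Precomposition with the transposition of \<open>x\<close> and \<open>y\<close>. It cuts
  a cycle through both points in two and fuses different cycles; applied to the face permutation it
  cuts and joins faces.\<close>

definition swp :: "('a \<Rightarrow> 'a) \<Rightarrow> 'a \<Rightarrow> 'a \<Rightarrow> 'a \<Rightarrow> 'a" where
  "swp p x y = p(x := p y, y := p x)"

lemma swp_swp [simp]: "swp (swp p x y) x y = p"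
  by (auto simp: swp_def)

lemma bij_swp:
  assumes "bij_betw p D D" "x \<in> D" "y \<in> D"
  shows "bij_betw (swp p x y) D D"
proof -
  have "bij_betw (id(x := y, y := x)) D D" using assms(2,3)
    by (intro bij_betw_byWitness[where f' = "id(x := y, y := x)"]) auto
  then have "bij_betw (p \<circ> id(x := y, y := x)) D D" using assms(1) bij_betw_trans by blast
  moreover have "p \<circ> id(x := y, y := x) = swp p x y" by (auto simp: swp_def)
  ultimately show ?thesis by simp
qed

text \<open>Once \<open>x\<close> and \<open>y\<close> are identified, it does not matter which of
  them is sent where. This provides a common reference for the counts before and after an
  exchange.\<close>

lemma conn_swp: "x \<in> D \<Longrightarrow> y \<in> D \<Longrightarrow> conn (insert (x, y) (gr D (swp p x y) \<union> s)) = conn (insert (x, y) (gr D p \<union> s))"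
proof -
  have *: "(u, v) \<in> conn (insert (x, y) (gr D q \<union> s))" if "(u, v) \<in> insert (x, y) (gr D (swp q x y) \<union> s)" "x \<in> D" "y \<in> D"
    for q u v
  proof -
    let ?C = "conn (insert (x, y) (gr D q \<union> s))"
    have a: "(x, y) \<in> ?C" "(x, q x) \<in> ?C" "(y, q y) \<in> ?C" 
      using that by (auto intro: conn_base simp: gr_iff)
    have b: "(u, v) \<in> s \<Longrightarrow> (u, v) \<in> ?C" "u \<in> D \<Longrightarrow> (u, q u) \<in> ?C" by (auto intro: conn_base simp: gr_iff)
    have "(x, q y) \<in> ?C" "(y, q x) \<in> ?C" using a conn_sym conn_trans by metis+
    then show ?thesis using that(1) a b by (auto simp: gr_iff swp_def split: if_splits)
  qed
  assume "x \<in> D" "y \<in> D"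
  then show ?thesis using *[of _ _ p] *[of _ _ "swp p x y"] by (intro conn_eqI) auto
qed

text \<open>The arc from \<open>p x\<close> to \<open>y\<close> does not contain \<open>x\<close>
  and is closed under the new permutation, which sends \<open>y\<close> back to
  \<open>p x\<close>.\<close>

lemma swp_split:
  assumes "finite D" "bij_betw p D D" "x \<in> D" "y \<in> D" "x \<noteq> y" "(x, y) \<in> conn (gr D p)"
  shows "(x, y) \<notin> conn (gr D (swp p x y))"
proof -
  let ?p = "swp p x y"
  have ex: "\<exists>k. (p ^^ k) x = y" using conn_gr_funpow[OF assms(1,2,3,6)] by auto
  define k where "k = (LEAST k. (p ^^ k) x = y)"
  have k: "(p ^^ k) x = y" unfolding k_def by (rule LeastI_ex[OF ex])
  have min: "(p ^^ j) x \<noteq> y" if "j < k" for j using not_less_Least[OF that[unfolded k_def]] .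
  have k0: "k > 0" using k assms(5) by (cases k) auto
  have nx: "(p ^^ j) x \<noteq> x" if "0 < j" "j \<le> k" for j
  proof
    assume "(p ^^ j) x = x"
    moreover have "(p ^^ k) x = (p ^^ (k - j)) ((p ^^ j) x)"
      using funpow_add[of "k - j" j p] that by simp
    ultimately show False using min[of "k - j"] that k by simp
  qed
  let ?A = "(\<lambda>j. (p ^^ j) x) ` {1..k}"
  have closed: "?p z \<in> ?A" if z: "z \<in> ?A" for z
  proof -
    obtain j where j: "1 \<le> j" "j \<le> k" "z = (p ^^ j) x" using z by auto
    show ?thesis
    proof (cases "j = k")
      case True
      then have "?p z = (p ^^ 1) x" using j k assms(5) by (simp add: swp_def)
      then show ?thesis using k0 by (intro image_eqI[of _ _ 1]) auto
    next
      case False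
      then have "?p z = (p ^^ Suc j) x" using j nx[of j] min[of j] by (simp add: swp_def)
      then show ?thesis using j False by (intro image_eqI[of _ _ "Suc j"]) auto
    qed
  qed
  have inA: "(?p ^^ m) y \<in> ?A" for m
  proof (induction m)
    case 0 show ?case using k k0 by (intro image_eqI[of _ _ k]) auto
  next
    case (Suc m)
    show ?case unfolding funpow.simps comp_apply by (rule closed[OF Suc])
  qed
  have xA: "x \<notin> ?A"
  proof
    assume "x \<in> ?A"
    then obtain j where j: "x = (p ^^ j) x" "j \<in> {1..k}" by (rule imageE)
    have "0 < j" "j \<le> k" using j(2) by auto
    then show False using nx j(1)[symmetric] by blast
  qed
  have ne: "(?p ^^ m) y \<noteq> x" for m
  proof
    assume e: "(?p ^^ m) y = x"
    show False using inA[of m] xA unfolding e by contradiction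
  qed
  show ?thesis
  proof
    assume "(x, y) \<in> conn (gr D ?p)"
    from conn_gr_funpow[OF assms(1) bij_swp[OF assms(2,3,4)] assms(4) conn_sym[OF this]]
    obtain m where "x = (?p ^^ m) y" by blast
    then show False using ne[of m] by simp
  qed
qed

text \<open>Starting at \<open>y\<close>, the new permutation runs through the old cycle of
  \<open>x\<close> until it arrives at \<open>x\<close>; it cannot meet \<open>y\<close> on the
  way.\<close>

lemma swp_merge:
  assumes "finite D" "bij_betw p D D" "x \<in> D" "y \<in> D" "(x, y) \<notin> conn (gr D p)"
  shows "(x, y) \<in> conn (gr D (swp p x y))"
proof -
  let ?p = "swp p x y"
  define k where "k = (LEAST k. k > 0 \<and> (p ^^ k) x = x)"
  have "k > 0 \<and> (p ^^ k) x = x" unfolding k_def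
    by (rule LeastI_ex) (rule funpow_period[OF assms(1,2,3)])
  then have k: "k > 0" "(p ^^ k) x = x" by auto
  have min: "(p ^^ j) x \<noteq> x" if "0 < j" "j < k" for j using not_less_Least[OF that(2)[unfolded k_def]] that(1) by simp
  have ny: "(p ^^ j) x \<noteq> y" for j using funpow_conn[OF assms(2,3)] assms(5) by metis
  have "(?p ^^ j) y = (p ^^ j) x" if "0 < j" "j \<le> k" for j
    using that
  proof (induction j)
    case (Suc j)
    show ?case
    proof (cases "j = 0")
      case True then show ?thesis using ny[of 0] by (simp add: swp_def)
    next
      case False
      then show ?thesis using Suc min[of j] ny[of j] by (simp add: swp_def)
    qed
  qed simp
  then have "(?p ^^ k) y = x" using k by simp
  then show ?thesis using funpow_conn[OF bij_swp[OF assms(2,3,4)] assms(4), of k] conn_sym[of y x] by simp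
qed

text \<open>The set \<open>D\<close> consists of darts (oriented edges): \<open>al\<close> reverses a dart and \<open>p\<close> maps it to the next dart
  along its face, so that the cycles of \<open>p \<circ> al\<close> are the vertices. The inequality is \<open>\<chi> \<ge> 2c\<close> for \<open>c\<close>
  components, doubled.\<close>

definition planar_map :: "'a set \<Rightarrow> ('a \<Rightarrow> 'a) \<Rightarrow> ('a \<Rightarrow> 'a) \<Rightarrow> bool" where
  "planar_map D p al \<longleftrightarrow> finite D \<and> bij_betw p D D \<and> (\<forall>x\<in>D. al x \<in> D \<and> al (al x) = x \<and> al x \<noteq> x) \<and>
    card D + 4 * ncc D (gr D p \<union> gr D al) \<le> 2 * (ncc D (gr D (p \<circ> al)) + ncc D (gr D p))"

lemma planar_mapD:
  assumes "planar_map D p al"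
  shows "finite D" "bij_betw p D D" "x \<in> D \<Longrightarrow> al x \<in> D" "x \<in> D \<Longrightarrow> al (al x) = x" "x \<in> D \<Longrightarrow> al x \<noteq> x"
    "x \<in> D \<Longrightarrow> p x \<in> D" "bij_betw al D D" "bij_betw (p \<circ> al) D D"
proof -
  show a: "finite D" "bij_betw p D D" "x \<in> D \<Longrightarrow> al x \<in> D" "x \<in> D \<Longrightarrow> al (al x) = x" "x \<in> D \<Longrightarrow> al x \<noteq> x"
    "x \<in> D \<Longrightarrow> p x \<in> D" using assms by (auto simp: planar_map_def bij_betw_def)
  show b: "bij_betw al D D" using assms by (intro bij_betw_byWitness[where f' = al]) (auto simp: planar_map_def)
  show "bij_betw (p \<circ> al) D D" using bij_betw_trans[OF b a(2)] .
qed

text \<open>An exchange in \<open>p\<close> at \<open>x\<close>, \<open>y\<close> is an exchange in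
  \<open>p \<circ> al\<close> at \<open>al x\<close>, \<open>al y\<close>, so the numbers of faces
  and of vertices each change by one. A handle arises only if both drop while the number of
  components stays. The condition excludes this: if both drop, two components are joined, and the
  loss of two in the characteristic is made up by the component term.\<close>

lemma planar_map_swp:
  assumes pm: "planar_map D p al" and xy: "x \<in> D" "y \<in> D"
    and cond: "(x, y) \<in> conn (gr D p) \<or> (al x, al y) \<in> conn (gr D (p \<circ> al)) \<or> (x, y) \<notin> conn (gr D p \<union> gr D al)"
  shows "planar_map D (swp p x y) al"
proof (cases "x = y")
  case True
  then show ?thesis using pm by (simp add: swp_def)
next
  case False
  note P = planar_mapD[OF pm]
  let ?p = "swp p x y" and ?s = "p \<circ> al"
  let ?s' = "?p \<circ> al"
  have bp: "bij_betw ?p D D" using bij_swp P(2) xy by metis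
  have axy: "al x \<in> D" "al y \<in> D" "al x \<noteq> al y" using P(3,4) xy False by metis+
  have s': "gr D ?s' = gr D (swp ?s (al x) (al y))"
  proof (rule gr_cong)
    fix z assume z: "z \<in> D"
    have "al z = x \<longleftrightarrow> z = al x" "al z = y \<longleftrightarrow> z = al y" using P(4) z xy by metis+
    then show "?s' z = swp ?s (al x) (al y) z" using P(4) xy by (auto simp: swp_def)
  qed
  \<comment> \<open>The counts with the two darts identified; they are the same before and after,
    and each actual count exceeds its reference by zero or one.\<close>
  define ZF where "ZF = ncc D (insert (x, y) (gr D p))"
  define ZV where "ZV = ncc D (insert (al x, al y) (gr D ?s))"
  define ZC where "ZC = ncc D (insert (x, y) (gr D p \<union> gr D al))"
  have ZF': "ZF = ncc D (insert (x, y) (gr D ?p))"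
    unfolding ZF_def by (rule ncc_cong) (use conn_swp[OF xy, of p "{}"] in simp)
  have ZV': "ZV = ncc D (insert (al x, al y) (gr D ?s'))"
    unfolding ZV_def s' by (rule ncc_cong) (use conn_swp[OF axy(1,2), of ?s "{}"] in simp)
  have ZC': "ZC = ncc D (insert (x, y) (gr D ?p \<union> gr D al))"
    unfolding ZC_def by (rule ncc_cong) (use conn_swp[OF xy, of p "gr D al"] in simp)
  have fin: "finite D" by (rule P(1))
  note F = ncc_insert_eq[OF fin xy, of "gr D p", folded ZF_def]
    and F' = ncc_insert_eq[OF fin xy, of "gr D ?p", folded ZF']
    and V = ncc_insert_eq[OF fin axy(1,2), of "gr D ?s", folded ZV_def]
    and V' = ncc_insert_eq[OF fin axy(1,2), of "gr D ?s'", folded ZV']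
    and C = ncc_insert_eq[OF fin xy, of "gr D p \<union> gr D al", folded ZC_def]
    and C' = ncc_insert_eq[OF fin xy, of "gr D ?p \<union> gr D al", folded ZC']
  have tF: "(x, y) \<in> conn (gr D p) \<longleftrightarrow> (x, y) \<notin> conn (gr D ?p)"
    using swp_split[OF fin P(2) xy False] swp_merge[OF fin P(2) xy] by blast
  have tV: "(al x, al y) \<in> conn (gr D ?s) \<longleftrightarrow> (al x, al y) \<notin> conn (gr D ?s')"
    unfolding s' using swp_split[OF fin P(8) axy] swp_merge[OF fin P(8) axy(1,2)] by blast
  have sub: "(x, y) \<in> conn (gr D q \<union> gr D al)" if "(al x, al y) \<in> conn (gr D (q \<circ> al)) \<or> (x, y) \<in> conn (gr D q)" 
    "bij_betw q D D" for q
    using that(1)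
  proof
    let ?C = "conn (gr D q \<union> gr D al)"
    assume "(al x, al y) \<in> conn (gr D (q \<circ> al))"
    then have "(al x, al y) \<in> ?C"
    proof (rule conn_mono[rotated])
      fix u v assume "(u, v) \<in> gr D (q \<circ> al)"
      then have u: "u \<in> D" "v = q (al u)" by (auto simp: gr_iff)
      have "(u, al u) \<in> ?C" "(al u, v) \<in> ?C" using u P(3) by (auto intro!: conn_base simp: gr_iff)
      then show "(u, v) \<in> ?C" by (rule conn_trans)
    qed
    moreover have "(x, al x) \<in> ?C" "(y, al y) \<in> ?C" using xy by (auto intro!: conn_base simp: gr_iff)
    ultimately show ?thesis using conn_trans conn_trans conn_sym by metis
  qed (rule conn_le_Un)
  have main: "ncc D (gr D ?s) + ncc D (gr D p) + 2 * ncc D (gr D ?p \<union> gr D al)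
     \<le> ncc D (gr D ?s') + ncc D (gr D ?p) + 2 * ncc D (gr D p \<union> gr D al)"
  proof -
    \<comment> \<open>\<open>F\<close>, \<open>V\<close> and \<open>C\<close> stand for a common
      face, vertex and component before the exchange. Afterwards the first two are negated, and
      \<open>C'\<close> stands for the third.\<close>
    have ar: "v + f + 2 * c' \<le> v' + f' + 2 * c"
      if "f = z1 + of_bool (\<not> F)" "f' = z1 + of_bool F" "v = z2 + of_bool (\<not> V)" "v' = z2 + of_bool V"
        "c = z3 + of_bool (\<not> C)" "c' = z3 + of_bool (\<not> C')" "F \<or> V \<longrightarrow> C" "\<not> F \<or> \<not> V \<longrightarrow> C'" "F \<or> V \<or> \<not> C"
      for f f' v v' c c' z1 z2 z3 :: nat and F V C C' :: bool
      using that by (cases F; cases V; cases C; cases C'; simp)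
    show ?thesis
      by (rule ar[OF F _ V _ C C'])
        (use F' V' tF tV cond sub[OF _ P(2)] sub[OF _ bp] in \<open>simp_all only: not_not\<close>; blast)+
  qed
  show ?thesis unfolding planar_map_def
    using main pm bp unfolding planar_map_def by auto
qed

lemma ncc_pair_joined: "ncc {a, b} {(a, b), (b, a)} = 1"
proof -
  have "conn {(a, b), (b, a)} `` {a} = conn {(a, b), (b, a)} `` {b}"
    unfolding conn_class_eq by (rule conn_base) simp
  then show ?thesis by (simp add: ncc_def)
qed

lemma ncc_pair_loops: "a \<noteq> b \<Longrightarrow> ncc {a, b} {(a, a), (b, b)} = 2"
proof -
  assume "a \<noteq> b"
  moreover have "conn {(a, a), (b, b)} = conn {}" by (rule conn_eqI) auto
  then have "conn {(a, a), (b, b)} = Id" by (simp add: conn_def)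
  ultimately show ?thesis by (simp add: ncc_def)
qed

text \<open>A single edge on a sphere of its own: two darts, two vertices, one face and one
  component, which contribute 6 to either side.\<close>

lemma planar_map_add:
  assumes pm: "planar_map D p al" and ab: "a \<notin> D" "b \<notin> D" "a \<noteq> b"
  shows "planar_map (D \<union> {a, b}) (p(a := b, b := a)) (al(a := b, b := a))"
proof -
  note P = planar_mapD[OF pm]
  let ?p = "p(a := b, b := a)" and ?al = "al(a := b, b := a)" and ?E = "{a, b}"
  have disj: "D \<inter> ?E = {}" using ab by auto
  have bij: "bij_betw ?p D D" using P(2) ab by (subst bij_betw_cong[of D ?p p]) auto
  have g: "gr (D \<union> ?E) ?p = gr D p \<union> {(a, b), (b, a)}" "gr (D \<union> ?E) ?al = gr D al \<union> {(a, b), (b, a)}"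
    "gr (D \<union> ?E) (?p \<circ> ?al) = gr D (p \<circ> al) \<union> {(a, a), (b, b)}"
  proof -
    have ne: "x \<noteq> a" "x \<noteq> b" if "x \<in> D" for x using that ab by auto
    have "gr D ?p = gr D p" "gr D ?al = gr D al" "gr D (?p \<circ> ?al) = gr D (p \<circ> al)"
      by (rule gr_cong; simp add: ne P(3))+
    moreover have "gr ?E ?p = {(a, b), (b, a)}" "gr ?E ?al = {(a, b), (b, a)}" "gr ?E (?p \<circ> ?al) = {(a, a), (b, b)}"
      using ab(3) by (auto simp: gr_def)
    ultimately show "gr (D \<union> ?E) ?p = gr D p \<union> {(a, b), (b, a)}" "gr (D \<union> ?E) ?al = gr D al \<union> {(a, b), (b, a)}"
    "gr (D \<union> ?E) (?p \<circ> ?al) = gr D (p \<circ> al) \<union> {(a, a), (b, b)}" unfolding gr_Un by simp_all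
  qed
  note c1 = ncc_pair_joined[of a b] and c2 = ncc_pair_loops[OF ab(3)]
  have s: "gr D p \<subseteq> D \<times> D" "gr D al \<subseteq> D \<times> D" "gr D (p \<circ> al) \<subseteq> D \<times> D" 
    using gr_sub P(2,7,8) by blast+
  have n1: "ncc (D \<union> ?E) (gr (D \<union> ?E) ?p) = ncc D (gr D p) + 1"
    unfolding g by (subst ncc_Un_disjoint) (use s disj P(1) c1 in auto)
  have n2: "ncc (D \<union> ?E) (gr (D \<union> ?E) (?p \<circ> ?al)) = ncc D (gr D (p \<circ> al)) + 2"
    unfolding g by (subst ncc_Un_disjoint) (use s disj P(1) c2 in auto)
  have "gr (D \<union> ?E) ?p \<union> gr (D \<union> ?E) ?al = (gr D p \<union> gr D al) \<union> {(a, b), (b, a)}" unfolding g by auto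
  then have n3: "ncc (D \<union> ?E) (gr (D \<union> ?E) ?p \<union> gr (D \<union> ?E) ?al) = ncc D (gr D p \<union> gr D al) + 1"
    by (simp only:) (subst ncc_Un_disjoint, use s disj P(1) c1 in auto)
  have "card (D \<union> ?E) = card D + 2" using ab P(1) by simp
  moreover have "bij_betw ?p (D \<union> ?E) (D \<union> ?E)"
    by (rule bij_betw_combine[OF bij _ disj]) (auto simp: bij_betw_def)
  ultimately show ?thesis using pm P ab unfolding planar_map_def n1 n2 n3 by auto
qed

text \<open>Zipping up a bigon: its two outer neighbours become each other's reverse. One face and
  two darts disappear, so it suffices that vertices do not become fewer and components not more
  numerous.\<close>

lemma planar_map_bigon:
  assumes pm: "planar_map D p al" and ab: "a \<in> D" "b \<in> D" "a \<noteq> b" "p a = b" "p b = a"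
  shows "planar_map (D - {a, b}) p (al(al a := al b, al b := al a))"
proof -
  note P = planar_mapD[OF pm]
  let ?A = "al a" and ?B = "al b" and ?E = "{a, b}"
  let ?D = "D - {a, b}" and ?al = "al(al a := al b, al b := al a)"
  have DE: "D = ?D \<union> ?E" "?D \<inter> ?E = {}" using ab by auto
  have fin: "finite ?D" using P(1) by simp
  have bij: "bij_betw p ?D ?D"
  proof -
    have "bij_betw p ?E ?E" using ab by (auto simp: bij_betw_def)
    then show ?thesis using bij_betw_DiffI[OF P(2)] ab by (metis DE(1) Un_upper2)
  qed
  have card: "card D = card ?D + 2" using ab P(1) by (subst DE(1), subst card_Un_disjoint) auto
  have gp: "gr D p = gr ?D p \<union> {(a, b), (b, a)}" using ab by (auto simp: gr_iff)
  have F: "ncc D (gr D p) = ncc ?D (gr ?D p) + 1"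
    by (subst DE(1), subst gp, subst ncc_Un_disjoint) (use gr_sub[OF bij] fin ncc_pair_joined[of a b] in auto)
  show ?thesis
  proof (cases "?A = b")
    \<comment> \<open>Both sides of the bigon belong to one edge, which is a component of its own
      and vanishes together with its two vertices.\<close>
    case True
    then have B: "?B = a" using P(4)[OF ab(1)] by simp
    have al': "?al = al" using True B by auto
    have al_in: "al x \<in> ?D" if "x \<in> ?D" for x
    proof -
      have "al x \<noteq> a" "al x \<noteq> b" using P(4)[of x] that True B by auto
      then show ?thesis using P(3) that by simp
    qed
    have bal: "bij_betw al ?D ?D" using P(4) al_in by (intro bij_betw_byWitness[where f' = al]) auto
    have g2: "gr D al = gr ?D al \<union> {(a, b), (b, a)}" using ab True B by (auto simp: gr_iff)
    have g3: "gr D (p \<circ> al) = gr ?D (p \<circ> al) \<union> {(a, a), (b, b)}" using ab True B by (auto simp: gr_iff)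
    have V: "ncc D (gr D (p \<circ> al)) = ncc ?D (gr ?D (p \<circ> al)) + 2"
      by (subst DE(1), subst g3, subst ncc_Un_disjoint)
        (use gr_sub[OF bij_betw_trans[OF bal bij]] fin ncc_pair_loops[OF ab(3)] in auto)
    have g4: "gr D p \<union> gr D al = (gr ?D p \<union> gr ?D al) \<union> {(a, b), (b, a)}" unfolding gp g2 by auto
    have C: "ncc D (gr D p \<union> gr D al) = ncc ?D (gr ?D p \<union> gr ?D al) + 1"
      by (subst DE(1), subst g4, subst ncc_Un_disjoint)
        (use gr_sub[OF bij] gr_sub[OF bal] fin ncc_pair_joined[of a b] in auto)
    show ?thesis using pm fin bij al_in P(4,5) unfolding al' planar_map_def F V C card by auto
  next
    case False
    have AB: "?A \<in> D" "?B \<in> D" "al ?A = a" "al ?B = b" "?A \<noteq> a" "?B \<noteq> b"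
      using P(3,4,5) ab by auto
    have AB2: "?A \<noteq> ?B" "?B \<noteq> a" using AB(3,4) ab(3) False by auto
    have inv: "?al x \<in> ?D \<and> ?al (?al x) = x \<and> ?al x \<noteq> x" if x: "x \<in> ?D" for x
    proof (cases "x = ?A \<or> x = ?B")
      case True
      then show ?thesis using AB AB2 False by auto
    next
      case F: False
      then have "al x \<noteq> a" "al x \<noteq> b" "al x \<noteq> ?A" "al x \<noteq> ?B"
        using P(4)[of x] AB x by auto
      then show ?thesis using F P(3,4,5)[of x] x by auto
    qed
    have V: "ncc D (gr D (p \<circ> al)) \<le> ncc ?D (gr ?D (p \<circ> ?al))"
    proof (rule ncc_hom_le[where f = "\<lambda>x. x", OF fin])
      let ?C = "conn (gr D (p \<circ> al))"
      have c: "(?A, b) \<in> ?C" "(b, p ?B) \<in> ?C" "(?B, a) \<in> ?C" "(a, p ?A) \<in> ?C"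
        using AB ab by (auto intro!: conn_base simp: gr_iff)
      fix x y assume "(x, y) \<in> gr ?D (p \<circ> ?al)"
      then have x: "x \<in> ?D" "y = p (?al x)" by (auto simp: gr_iff)
      consider "x = ?A" | "x = ?B" | "x \<noteq> ?A" "x \<noteq> ?B" by auto
      then show "(x, y) \<in> ?C"
      proof cases
        case 1 then show ?thesis using conn_trans[OF c(1,2)] x AB2 by simp
      next
        case 2 then show ?thesis using conn_trans[OF c(3,4)] x AB2 by simp
      next
        case 3 then show ?thesis using x by (intro conn_base) (auto simp: gr_iff)
      qed
    next
      let ?C = "conn (gr D (p \<circ> al))"
      fix y assume y: "y \<in> D"
      have "(?A, b) \<in> ?C" "(?B, a) \<in> ?C" using AB ab by (auto intro!: conn_base simp: gr_iff)
      moreover have "?A \<in> ?D" "?B \<in> ?D" using AB AB2 False by auto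
      moreover have "(y, y) \<in> ?C" by (rule conn_refl)
      ultimately show "\<exists>x\<in>?D. (x, y) \<in> ?C" using y by blast
    qed
    \<comment> \<open>A removed dart is represented by its reverse; the two reverses are joined by
      the new \<open>?al\<close>.\<close>
    have C: "ncc ?D (gr ?D p \<union> gr ?D ?al) \<le> ncc D (gr D p \<union> gr D al)"
    proof (rule ncc_hom_le[where f = "\<lambda>x. if x = a then ?A else if x = b then ?B else x", OF P(1)])
      let ?f = "\<lambda>x. if x = a then ?A else if x = b then ?B else x"
      let ?C = "conn (gr ?D p \<union> gr ?D ?al)"
      have c: "(?A, ?B) \<in> ?C" using AB AB2 False by (intro conn_base) (auto simp: gr_iff)
      have c': "(?B, ?A) \<in> ?C" by (rule conn_sym[OF c])
      fix x y assume "(x, y) \<in> gr D p \<union> gr D al"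
      then have "x \<in> D" "y = p x \<or> y = al x" by (auto simp: gr_iff)
      then consider "y = p x" "x = a" | "y = p x" "x = b" | "y = p x" "x \<in> ?D" | "y = al x" "x \<in> ?E"
        | "y = al x" "x \<in> {?A, ?B}" | "y = al x" "x \<in> ?D" "x \<notin> {?A, ?B}" by blast
      then show "(?f x, ?f y) \<in> ?C"
      proof cases
        case 1 then show ?thesis using c ab by simp
      next
        case 2 then show ?thesis using c' ab by simp
      next
        case 3
        then have "p x \<in> ?D" using bij by (auto simp: bij_betw_def)
        then show ?thesis using 3 by (intro conn_base) (auto simp: gr_iff)
      next
        case 4 then show ?thesis using AB AB2 False ab by auto
      next
        case 5 then show ?thesis using AB AB2 False ab by auto
      next
        case 6
        then have "al x \<noteq> a" "al x \<noteq> b" using P(4)[of x] by auto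
        then show ?thesis using 6 by (intro conn_base) (auto simp: gr_iff)
      qed
    next
      fix y assume "y \<in> ?D"
      then show "\<exists>x\<in>D. (if x = a then ?A else if x = b then ?B else x, y) \<in> conn (gr ?D p \<union> gr ?D ?al)"
        by (intro bexI[of _ y]) auto
    qed
    show ?thesis using pm fin bij inv V C unfolding planar_map_def F card by (auto simp del: fun_upd_apply)
  qed
qed

section \<open>Labelled maps and diagrams\<close>

definition inv_word :: "'g word \<Rightarrow> 'g word" where
  "inv_word w = rev (map inv_letter w)"

lemma inv_letter_inv_letter [simp]: "inv_letter (inv_letter a) = a"
  by (simp add: inv_letter_def)

lemma fst_inv_letter [simp]: "fst (inv_letter a) = fst a"
  by (simp add: inv_letter_def)

lemma pres_eq_context: "pres_eq R u v \<Longrightarrow> pres_eq R (s @ u @ t) (s @ v @ t)"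
proof (induction rule: pres_eq.induct)
  case (pres_refl u) show ?case by (rule pres_eq.pres_refl)
next
  case (pres_sym u v) then show ?case by (blast intro: pres_eq.pres_sym)
next
  case (pres_trans u v w) then show ?case by (blast intro: pres_eq.pres_trans)
next
  case (pres_cancel u a v)
  then show ?case using pres_eq.pres_cancel[of R "s @ u" a "v @ t"] by simp
next
  case (pres_rel r u v)
  then show ?case using pres_eq.pres_rel[of r R "s @ u" "v @ t"] by simp
qed

lemma pres_eq_append: "pres_eq R u u' \<Longrightarrow> pres_eq R v v' \<Longrightarrow> pres_eq R (u @ v) (u' @ v')"
  using pres_eq_context[of R u u' "[]" v] pres_eq_context[of R v v' u' "[]"] pres_trans by fastforce

lemma pres_eq_appendR: "pres_eq R u v \<Longrightarrow> pres_eq R (u @ w) (v @ w)"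
  by (rule pres_eq_append[OF _ pres_refl])

lemma pres_eq_inv_right: "pres_eq R (w @ inv_word w) []"
proof (induction w)
  case Nil then show ?case by (simp add: inv_word_def pres_refl)
next
  case (Cons a w)
  have "pres_eq R ([a] @ (w @ inv_word w) @ [inv_letter a]) ([a] @ [] @ [inv_letter a])"
    using Cons by (rule pres_eq_context)
  moreover have "pres_eq R ([a] @ [] @ [inv_letter a]) []" using pres_cancel[of R "[]" a "[]"] by simp
  ultimately show ?case using pres_trans by (fastforce simp: inv_word_def)
qed

lemma inv_word_inv_word [simp]: "inv_word (inv_word w) = w"
  by (simp add: inv_word_def rev_map comp_def)

lemma pres_eq_inv_left: "pres_eq R (inv_word w @ w) []"
  using pres_eq_inv_right[of R "inv_word w"] by simp

definition cyc :: "('a \<Rightarrow> 'a) \<Rightarrow> 'a list \<Rightarrow> bool" where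
  "cyc p xs \<longleftrightarrow> map p xs = rotate1 xs"

lemma cyc_Nil [simp]: "cyc p []"
  by (simp add: cyc_def)

lemma cyc_iff: "xs \<noteq> [] \<Longrightarrow> cyc p xs \<longleftrightarrow> map p (butlast xs) = tl xs \<and> p (last xs) = hd xs"
proof -
  assume "xs \<noteq> []"
  then have "map p xs = map p (butlast xs) @ [p (last xs)]" "rotate1 xs = tl xs @ [hd xs]"
    by (metis append_butlast_last_id map_append list.simps(8,9)) (simp add: \<open>xs \<noteq> []\<close> rotate1_hd_tl)
  then show ?thesis unfolding cyc_def by simp
qed

lemma cyc_append:
  assumes "xs \<noteq> []" "ys \<noteq> []"
  shows "cyc p (xs @ ys) \<longleftrightarrow> map p (butlast xs) = tl xs \<and> p (last xs) = hd ys \<and> map p (butlast ys) = tl ys \<and> p (last ys) = hd xs"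
proof -
  have x: "map p xs = map p (butlast xs) @ [p (last xs)]"
    using assms(1) by (metis append_butlast_last_id map_append list.simps(8,9))
  have y: "ys = hd ys # tl ys" using assms(2) by simp
  have "map p (butlast (xs @ ys)) = map p (butlast xs) @ [p (last xs)] @ map p (butlast ys)"
    using assms(2) x by (simp add: butlast_append)
  moreover have "tl (xs @ ys) = tl xs @ [hd ys] @ tl ys" using assms y by (metis append_Cons append_Nil tl_append2)
  ultimately have "map p (butlast (xs @ ys)) = tl (xs @ ys) \<longleftrightarrow> map p (butlast xs) = tl xs \<and> p (last xs) = hd ys \<and> map p (butlast ys) = tl ys"
    by simp
  then show ?thesis using assms by (simp add: cyc_iff)
qed

lemma cyc_commute: "cyc p (xs @ ys) \<longleftrightarrow> cyc p (ys @ xs)"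
  by (cases "xs = [] \<or> ys = []") (auto simp: cyc_append)

lemma cyc_in: "cyc p xs \<Longrightarrow> x \<in> set xs \<Longrightarrow> p x \<in> set xs"
  unfolding cyc_def by (metis image_eqI list.set_map set_rotate1)

lemma cyc_cong: "(\<And>x. x \<in> set xs \<Longrightarrow> p x = q x) \<Longrightarrow> cyc p xs \<Longrightarrow> cyc q xs"
  unfolding cyc_def by (metis (mono_tags, lifting) map_eq_conv)

lemma cyc_conn_hd:
  assumes "cyc p xs" "set xs \<subseteq> D" "i < length xs"
  shows "(hd xs, xs ! i) \<in> conn (gr D p)"
  using assms(3)
proof (induction i)
  case 0 then show ?case by (simp add: hd_conv_nth)
next
  case (Suc i)
  have "map p xs ! i = rotate1 xs ! i" using assms(1) by (simp add: cyc_def)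
  then have "p (xs ! i) = xs ! Suc i" using Suc(2) by (simp add: nth_rotate1)
  moreover have "xs ! i \<in> D" using Suc(2) assms(2) by auto
  ultimately have "(xs ! i, xs ! Suc i) \<in> conn (gr D p)" by (intro conn_base) (simp add: gr_iff)
  then show ?case using Suc by (auto intro: conn_trans)
qed

lemma cyc_conn:
  assumes "cyc p xs" "set xs \<subseteq> D" "x \<in> set xs" "y \<in> set xs"
  shows "(x, y) \<in> conn (gr D p)"
proof -
  have "(hd xs, x) \<in> conn (gr D p)" "(hd xs, y) \<in> conn (gr D p)"
    using cyc_conn_hd[OF assms(1,2)] assms(3,4) by (auto simp: in_set_conv_nth)
  then show ?thesis by (blast intro: conn_sym conn_trans)
qed

lemma swp_other: "z \<noteq> x \<Longrightarrow> z \<noteq> y \<Longrightarrow> swp p x y z = p z"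
  by (simp add: swp_def)

lemma in_butlast_not_last: "distinct xs \<Longrightarrow> x \<in> set (butlast xs) \<Longrightarrow> x \<noteq> last xs"
  by (metis append_butlast_last_id butlast.simps(1) distinct_append empty_iff insertI1 IntI list.set(1,2))

text \<open>The list form of cutting and fusing cycles. As \<open>swp\<close> is an involution, it
  can be read in both directions.\<close>

lemma cyc_swp:
  assumes "xs \<noteq> []" "ys \<noteq> []" "distinct (xs @ ys)"
  shows "cyc p (xs @ ys) \<longleftrightarrow> cyc (swp p (last xs) (last ys)) xs \<and> cyc (swp p (last xs) (last ys)) ys"
proof -
  let ?q = "swp p (last xs) (last ys)"
  have n: "last xs \<noteq> last ys" using assms by (metis disjoint_iff distinct_append last_in_set)
  have o: "x \<noteq> last xs \<and> x \<noteq> last ys" if "x \<in> set (butlast xs) \<or> x \<in> set (butlast ys)" for x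
    using that assms in_butlast_not_last[of xs x] in_butlast_not_last[of ys x] in_set_butlastD[of x xs] in_set_butlastD[of x ys]
      last_in_set[of xs] last_in_set[of ys] unfolding distinct_append disjoint_iff by metis
  have "map ?q (butlast xs) = map p (butlast xs)" "map ?q (butlast ys) = map p (butlast ys)"
    by (rule map_cong[OF refl], rule swp_other; use o in blast)+
  moreover have "?q (last xs) = p (last ys)" "?q (last ys) = p (last xs)" by (auto simp: swp_def)
  ultimately show ?thesis
    unfolding cyc_append[OF assms(1,2)] cyc_iff[OF assms(1)] cyc_iff[OF assms(2)] by metis
qed

text \<open>\<open>src d\<close> is a word for the vertex of the Cayley graph at which the edge \<open>d\<close> with label \<open>lab d\<close> starts.\<close>

definition lmap :: "'g set \<Rightarrow> 'g word list \<Rightarrow> 'a set \<Rightarrow> ('a \<Rightarrow> 'a) \<Rightarrow> ('a \<Rightarrow> 'a) \<Rightarrow> ('a \<Rightarrow> 'g letter) \<Rightarrow> ('a \<Rightarrow> 'g word) \<Rightarrow> bool" where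
  "lmap S R D p al lab src \<longleftrightarrow> planar_map D p al \<and>
    (\<forall>d\<in>D. fst (lab d) \<in> S \<and> src d \<in> words_over S \<and> lab (al d) = inv_letter (lab d) \<and>
      pres_eq R (src (al d)) (src d @ [lab d]) \<and> pres_eq R (src (p d)) (src d @ [lab d]))"

lemma lmapD:
  assumes "lmap S R D p al lab src"
  shows "planar_map D p al" and "d \<in> D \<Longrightarrow> fst (lab d) \<in> S" and "d \<in> D \<Longrightarrow> src d \<in> words_over S"
    and "d \<in> D \<Longrightarrow> lab (al d) = inv_letter (lab d)"
    and "d \<in> D \<Longrightarrow> pres_eq R (src (al d)) (src d @ [lab d])"
    and "d \<in> D \<Longrightarrow> pres_eq R (src (p d)) (src d @ [lab d])"
  using assms by (auto simp: lmap_def)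

lemma lmap_swp:
  assumes L: "lmap S R D p al lab src" and xy: "x \<in> D" "y \<in> D"
    and cond: "(x, y) \<in> conn (gr D p) \<or> (al x, al y) \<in> conn (gr D (p \<circ> al)) \<or> (x, y) \<notin> conn (gr D p \<union> gr D al)"
    and tgt: "pres_eq R (src x @ [lab x]) (src y @ [lab y])"
  shows "lmap S R D (swp p x y) al lab src"
proof -
  have "pres_eq R (src (swp p x y d)) (src d @ [lab d])" if "d \<in> D" for d
    using lmapD(6)[OF L that] lmapD(6)[OF L xy(1)] lmapD(6)[OF L xy(2)] tgt
    by (auto simp: swp_def intro: pres_trans pres_sym)
  then show ?thesis using planar_map_swp[OF lmapD(1)[OF L] xy cond] L unfolding lmap_def by blast
qed

lemma lmap_add:
  assumes L: "lmap S R D p al lab src" and xy: "x \<notin> D" "y \<notin> D" "x \<noteq> y" and "fst a \<in> S" "u \<in> words_over S"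
  shows "lmap S R (D \<union> {x, y}) (p(x := y, y := x)) (al(x := y, y := x)) (lab(x := a, y := inv_letter a)) (src(x := u, y := u @ [a]))"
proof -
  have c: "pres_eq R u ((u @ [a]) @ [inv_letter a])" using pres_sym[OF pres_cancel[of R u a "[]"]] by simp
  have ne: "d \<noteq> x" "d \<noteq> y" "al d \<noteq> x" "al d \<noteq> y" "p d \<noteq> x" "p d \<noteq> y" if "d \<in> D" for d
    using planar_mapD(3,6)[OF lmapD(1)[OF L]] that xy by auto
  have ua: "u @ [a] \<in> words_over S" using assms(5,6) by (auto simp: words_over_def)
  show ?thesis unfolding lmap_def
  proof (intro conjI ballI)
    show "planar_map (D \<union> {x, y}) (p(x := y, y := x)) (al(x := y, y := x))"
      by (rule planar_map_add[OF lmapD(1)[OF L] xy])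
  next
    fix d assume "d \<in> D \<union> {x, y}"
    then consider "d \<in> D" | "d = x" | "d = y" by auto
    note cs = this
    show "fst ((lab(x := a, y := inv_letter a)) d) \<in> S"
      using cs by cases (use lmapD(2)[OF L] ne assms(5) in auto)
    show "(src(x := u, y := u @ [a])) d \<in> words_over S"
      using cs by cases (use lmapD(3)[OF L] ne assms(6) ua in auto)
    show "(lab(x := a, y := inv_letter a)) ((al(x := y, y := x)) d) = inv_letter ((lab(x := a, y := inv_letter a)) d)"
      using cs by cases (use lmapD(4)[OF L] ne xy(3) in auto)
    show "pres_eq R ((src(x := u, y := u @ [a])) ((al(x := y, y := x)) d)) ((src(x := u, y := u @ [a])) d @ [(lab(x := a, y := inv_letter a)) d])"
      using cs by cases (use lmapD(5)[OF L] ne xy(3) c pres_refl in auto)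
    show "pres_eq R ((src(x := u, y := u @ [a])) ((p(x := y, y := x)) d)) ((src(x := u, y := u @ [a])) d @ [(lab(x := a, y := inv_letter a)) d])"
      using cs by cases (use lmapD(6)[OF L] ne xy(3) c pres_refl in auto)
  qed
qed

lemma lmap_bigon:
  assumes L: "lmap S R D p al lab src" and ab: "a \<in> D" "b \<in> D" "a \<noteq> b" "p a = b" "p b = a"
    and lb: "lab b = inv_letter (lab a)"
  shows "\<exists>al'. lmap S R (D - {a, b}) p al' lab src"
proof -
  note M = lmapD(1)[OF L] and P = planar_mapD[OF lmapD(1)[OF L]]
  let ?A = "al a" and ?B = "al b"
  let ?al = "al(al a := al b, al b := al a)"
  have AB: "?A \<in> D" "?B \<in> D" "al ?A = a" "al ?B = b" using P(3,4) ab by auto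
  have l: "lab ?B = inv_letter (lab ?A)" "lab ?A = inv_letter (lab ?B)"
    using lmapD(4)[OF L ab(1)] lmapD(4)[OF L ab(2)] lb by simp_all
  have a1: "pres_eq R (src ?A) (src b)"
    using lmapD(5)[OF L ab(1)] lmapD(6)[OF L ab(1)] ab(4) pres_trans pres_sym by metis
  have b1: "pres_eq R (src ?B) (src a)"
    using lmapD(5)[OF L ab(2)] lmapD(6)[OF L ab(2)] ab(5) pres_trans pres_sym by metis
  have a2: "pres_eq R (src a) (src ?A @ [lab ?A])" using lmapD(5)[OF L AB(1)] AB(3) by simp
  have b2: "pres_eq R (src b) (src ?B @ [lab ?B])" using lmapD(5)[OF L AB(2)] AB(4) by simp
  have e1: "pres_eq R (src ?B) (src ?A @ [lab ?A])" using b1 a2 by (rule pres_trans)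
  have e2: "pres_eq R (src ?A) (src ?B @ [lab ?B])" using a1 b2 by (rule pres_trans)
  have "lmap S R (D - {a, b}) p ?al lab src"
    unfolding lmap_def
  proof (intro conjI ballI)
    show "planar_map (D - {a, b}) p ?al" by (rule planar_map_bigon[OF M ab])
  next
    fix d assume d: "d \<in> D - {a, b}"
    then have dD: "d \<in> D" by simp
    show "fst (lab d) \<in> S" "src d \<in> words_over S" "pres_eq R (src (p d)) (src d @ [lab d])"
      using lmapD(2,3,6)[OF L dD] by auto
    show "lab (?al d) = inv_letter (lab d)" using l lmapD(4)[OF L dD] by auto
    show "pres_eq R (src (?al d)) (src d @ [lab d])" using e1 e2 lmapD(5)[OF L dD] by auto
  qed
  then show ?thesis by blast
qed

text \<open>Assumption \<open>hd\<close> says that \<open>cs\<close> closes up in the Cayley graph.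
  Hence the last darts of both parts end at the same Cayley vertex, and as they lie on one face, the
  exchange there is permitted.\<close>

lemma lmap_split:
  assumes L: "lmap S R D p al lab src" and cy: "cyc p (cs @ ws)" "distinct (cs @ ws)" "set (cs @ ws) \<subseteq> D" "cs \<noteq> []" "ws \<noteq> []"
    and hd: "pres_eq R (src (hd cs)) (src (last cs) @ [lab (last cs)])"
  defines "p' \<equiv> swp p (last cs) (last ws)"
  shows "lmap S R D p' al lab src" "cyc p' cs" "cyc p' ws" "\<And>d. d \<notin> set (cs @ ws) \<Longrightarrow> p' d = p d"
proof -
  have l: "last cs \<in> set cs" "last ws \<in> set ws" using cy(4,5) by auto
  have lD: "last cs \<in> D" "last ws \<in> D" using l cy(3) by auto
  have "(last cs, last ws) \<in> conn (gr D p)" using cyc_conn[OF cy(1,3)] l by simp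
  moreover have "p (last ws) = hd cs" using cy(1,4,5) by (simp add: cyc_append)
  then have "pres_eq R (src (hd cs)) (src (last ws) @ [lab (last ws)])" using lmapD(6)[OF L lD(2)] by simp
  then have "pres_eq R (src (last cs) @ [lab (last cs)]) (src (last ws) @ [lab (last ws)])"
    using hd by (blast intro: pres_trans pres_sym)
  ultimately show "lmap S R D p' al lab src" unfolding p'_def by (intro lmap_swp[OF L lD]) auto
  show "cyc p' cs" "cyc p' ws" using cyc_swp[OF cy(4,5,2), of p] cy(1) unfolding p'_def by auto
  show "\<And>d. d \<notin> set (cs @ ws) \<Longrightarrow> p' d = p d" unfolding p'_def using l by (intro swp_other) auto
qed

lemma conn_subset: "r \<subseteq> r' \<Longrightarrow> (x, y) \<in> conn r \<Longrightarrow> (x, y) \<in> conn r'"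
  by (rule conn_mono[of r]) (auto intro: conn_base)

text \<open>The boundary face is the list \<open>bs\<close>, spelling \<open>w\<close>; all other faces are triangles spelling words in \<open>T\<close>.
  Neither connectedness nor the absence of closed components is required.\<close>

definition diagram :: "'g set \<Rightarrow> 'g word list \<Rightarrow> 'g word set \<Rightarrow> 'a set \<Rightarrow> ('a \<Rightarrow> 'a) \<Rightarrow> ('a \<Rightarrow> 'a) \<Rightarrow>
    ('a \<Rightarrow> 'g letter) \<Rightarrow> ('a \<Rightarrow> 'g word) \<Rightarrow> 'a list \<Rightarrow> 'g word \<Rightarrow> bool" where
  "diagram S R T D p al lab src bs w \<longleftrightarrow> lmap S R D p al lab src \<and> distinct bs \<and> set bs \<subseteq> D \<and> cyc p bs \<and>
    map lab bs = w \<and> (bs \<noteq> [] \<longrightarrow> pres_eq R (src (hd bs)) []) \<and>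
    (\<forall>d\<in>D - set bs. p (p (p d)) = d \<and> [lab d, lab (p d), lab (p (p d))] \<in> T)"

text \<open>Darts are natural numbers, so that fresh ones are always available.\<close>

definition bounds :: "'g set \<Rightarrow> 'g word list \<Rightarrow> 'g word set \<Rightarrow> 'g word \<Rightarrow> bool" where
  "bounds S R T w \<longleftrightarrow> (\<exists>(D :: nat set) p al lab src bs. diagram S R T D p al lab src bs w)"

lemma diagramD:
  assumes "diagram S R T D p al lab src bs w"
  shows "lmap S R D p al lab src" "distinct bs" "set bs \<subseteq> D" "cyc p bs" "map lab bs = w"
    "bs \<noteq> [] \<Longrightarrow> pres_eq R (src (hd bs)) []"
    "d \<in> D \<Longrightarrow> d \<notin> set bs \<Longrightarrow> p (p (p d)) = d"
    "d \<in> D \<Longrightarrow> d \<notin> set bs \<Longrightarrow> [lab d, lab (p d), lab (p (p d))] \<in> T"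
  using assms by (auto simp: diagram_def)

lemma diagram_face:
  assumes "diagram S R T D p al lab src bs w" "d \<in> D" "d \<notin> set bs"
  shows "p d \<in> D" "p d \<notin> set bs"
proof -
  note P = planar_mapD[OF lmapD(1)[OF diagramD(1)[OF assms(1)]]]
  show "p d \<in> D" using P(6) assms(2) .
  have "p ` set bs = set bs" using diagramD(4)[OF assms(1)] unfolding cyc_def by (metis list.set_map set_rotate1)
  then show "p d \<notin> set bs"
  proof -
    { assume "p d \<in> set bs"
      then obtain e where e: "e \<in> set bs" "p e = p d" using \<open>p ` set bs = set bs\<close> by (metis imageE)
      then have "e = d" using P(2) assms(2) diagramD(3)[OF assms(1)] by (auto simp: bij_betw_def inj_on_def)
      then have False using e assms(3) by simp }
    then show ?thesis by blast
  qed
qed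

lemma diagram_pos:
  assumes L: "lmap S R D p al lab src" and "set bs \<subseteq> D" "cyc p bs" "pres_eq R (src (hd bs)) []"
  shows "bs = us @ vs \<Longrightarrow> us \<noteq> [] \<Longrightarrow> pres_eq R (src (last us) @ [lab (last us)]) (map lab us)"
proof (induction us arbitrary: vs rule: rev_induct)
  case (snoc d us)
  have "pres_eq R (src d) (map lab us)"
  proof (cases "us = []")
    case True then show ?thesis using snoc assms(4) by simp
  next
    case False
    have "cyc p (us @ (d # vs))" using assms(3) snoc(2) by simp
    then have "p (last us) = d" using False cyc_append[of us "d # vs" p] by simp
    moreover have "last us \<in> D" using False snoc(2) assms(2) last_in_set[of us] by auto
    ultimately have "pres_eq R (src d) (src (last us) @ [lab (last us)])" using lmapD(6)[OF L] by metis
    moreover have "pres_eq R (src (last us) @ [lab (last us)]) (map lab us)" using snoc(1)[of "d # vs"] snoc(2) False by simp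
    ultimately show ?thesis by (rule pres_trans)
  qed
  then show ?case using pres_eq_appendR[of R "src d" "map lab us" "[lab d]"] by simp
qed simp

lemma map_append_splitE:
  assumes "map f xs = u @ v"
  obtains us vs where "xs = us @ vs" "map f us = u" "map f vs = v"
  using assms by (auto simp: map_eq_append_conv)

text \<open>A new edge is first added as a separate component with the bigon \<open>[x, y]\<close>
  as its only face. Exchanging at \<open>y\<close> and at the boundary dart that ends where
  \<open>u\<close> has been read turns it into a hair on the boundary; joining two components is
  harmless for planarity.\<close>

lemma bounds_insert:
  assumes "bounds S R T (u @ v)" and a: "fst a \<in> S"
  shows "bounds S R T (u @ [a, inv_letter a] @ v)"
proof -
  obtain D :: "nat set" and p al lab src bs where dg: "diagram S R T D p al lab src bs (u @ v)"
    using assms(1) unfolding bounds_def by blast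
  note d = diagramD[OF dg] note L = d(1) note P = planar_mapD[OF lmapD(1)[OF L]]
  obtain us vs where bs: "bs = us @ vs" "map lab us = u" "map lab vs = v" using map_append_splitE[OF d(5)] .
  obtain x where x: "x \<notin> D" using ex_new_if_finite[OF infinite_UNIV_nat P(1)] by blast
  have "finite (insert x D)" using P(1) by simp
  then obtain y where y': "y \<notin> insert x D" using ex_new_if_finite[OF infinite_UNIV_nat] by blast
  then have y: "y \<notin> D" "x \<noteq> y" by auto
  have uS: "u \<in> words_over S"
    unfolding words_over_def bs(2)[symmetric] using d(3) lmapD(2)[OF L] bs(1) by auto
  let ?D = "D \<union> {x, y}" and ?p = "p(x := y, y := x)" and ?al = "al(x := y, y := x)"
    and ?lab = "lab(x := a, y := inv_letter a)" and ?src = "src(x := u, y := u @ [a])"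
  have L1: "lmap S R ?D ?p ?al ?lab ?src" by (rule lmap_add[OF L x y a uS])
  have ne: "e \<noteq> x" "e \<noteq> y" if "e \<in> D" for e using that x y by auto
  have bne: "e \<noteq> x" "e \<noteq> y" if "e \<in> set bs" for e using that ne d(3) by auto
  have cbs: "cyc ?p bs" using cyc_cong[OF _ d(4), of ?p] bne by simp
  have cxy: "cyc ?p [x, y]" using y(2) by (simp add: cyc_def)
  have lb: "map ?lab us = u" "map ?lab vs = v" using bne bs by (auto intro: map_cong)
  show ?thesis
  proof (cases "bs = []")
    case True
    then have uv: "u = []" "v = []" using bs by auto
    have "diagram S R T ?D ?p ?al ?lab ?src [x, y] (u @ [a, inv_letter a] @ v)"
      unfolding diagram_def using L1 cxy y(2) uv d(7,8) True P(6) ne by (auto simp: pres_refl)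
    then show ?thesis unfolding bounds_def by blast
  next
    case False
    \<comment> \<open>The boundary read from the place of insertion, so that its last dart ends at
      the vertex reached by \<open>u\<close>.\<close>
    let ?ws = "vs @ us" and ?bs = "us @ [x, y] @ vs"
    have wne: "?ws \<noteq> []" and dist: "distinct ([x, y] @ ?ws)" using False bs d(2) bne y(2) by auto
    let ?z = "last ?ws"
    let ?q = "swp ?p (last [x, y]) ?z"
    have zb: "?z \<in> set bs" using wne last_in_set[of ?ws] bs(1) by auto
    then have zD: "?z \<in> D" using d(3) by auto
    have yz: "last [x, y] \<in> ?D" "?z \<in> ?D" using zD by auto
    have cq: "cyc ?q ?bs"
    proof -
      have "cyc ?p (vs @ us)" using cbs bs(1) cyc_commute by metis
      then have "cyc (swp ?q (last [x, y]) ?z) ?ws" "cyc (swp ?q (last [x, y]) ?z) [x, y]" using cxy by simp_all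
      then have "cyc ?q ([x, y] @ ?ws)" using cyc_swp[OF _ wne dist, of ?q] by simp
      then show ?thesis using cyc_commute[of ?q "[x, y] @ vs" us] by simp
    qed
    have sep: "(last [x, y], ?z) \<notin> conn (gr ?D ?p \<union> gr ?D ?al)"
    proof
      assume c: "(last [x, y], ?z) \<in> conn (gr ?D ?p \<union> gr ?D ?al)"
      have "gr D ?p = gr D p" "gr D ?al = gr D al" by (rule gr_cong; simp add: ne)+
      moreover have "gr {x, y} ?p = {(x, y), (y, x)}" "gr {x, y} ?al = {(x, y), (y, x)}" using y(2) by (auto simp: gr_def)
      ultimately have "gr ?D ?p \<union> gr ?D ?al \<subseteq> {(x, y), (y, x)} \<union> (gr D p \<union> gr D al)"
        unfolding gr_Un by auto
      from conn_subset[OF this] have "(y, ?z) \<in> conn ({(x, y), (y, x)} \<union> (gr D p \<union> gr D al))"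
        using c by simp
      then have "?z \<in> {x, y}"
        using conn_Un_disjoint[of "{(x, y), (y, x)}" "{x, y}" "gr D p \<union> gr D al" D y ?z] gr_sub[OF P(2)] gr_sub[OF P(7)] x y
        by auto
      then show False using zD x y by auto
    qed
    have tz: "pres_eq R (?src ?z @ [?lab ?z]) u"
    proof -
      have e: "?src ?z = src ?z" "?lab ?z = lab ?z" using ne zD by auto
      show ?thesis
      proof (cases "us = []")
        case True
        then have "p ?z = hd bs" using cyc_iff[OF False, of p] d(4) bs(1) by simp
        then have "pres_eq R (src (hd bs)) (src ?z @ [lab ?z])" using lmapD(6)[OF L zD] by simp
        moreover have "u = []" using True bs(2) by simp
        ultimately show ?thesis unfolding e using d(6)[OF False] by (blast intro: pres_trans pres_sym)
      next
        case us: False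
        then show ?thesis using diagram_pos[OF L d(3,4) d(6)[OF False] bs(1) us] e bs(2) by simp
      qed
    qed
    have ty: "pres_eq R (?src (last [x, y]) @ [?lab (last [x, y])]) u"
      using pres_cancel[of R u a "[]"] by simp
    have L2: "lmap S R ?D ?q ?al ?lab ?src"
      by (rule lmap_swp[OF L1 yz]) (use sep tz ty in \<open>blast intro: pres_trans pres_sym\<close>)+
    have qd: "?q e = p e" "?lab e = lab e" if "e \<in> D" "e \<notin> set bs" for e
    proof -
      have "e \<noteq> y" "e \<noteq> x" "e \<noteq> ?z" using ne that zb by auto
      then show "?q e = p e" "?lab e = lab e" by (simp_all add: swp_def)
    qed
    have tri: "?q (?q (?q e)) = e \<and> [?lab e, ?lab (?q e), ?lab (?q (?q e))] \<in> T" if e: "e \<in> D" "e \<notin> set bs" for e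
    proof -
      note f1 = diagram_face[OF dg e]
      note f2 = diagram_face[OF dg f1]
      show ?thesis unfolding qd[OF e] qd[OF f1] qd[OF f2] using d(7,8)[OF e] by simp
    qed
    have base: "pres_eq R (?src (hd ?bs)) []"
    proof (cases "us = []")
      case True then show ?thesis using bs(2) y(2) by (simp add: pres_refl)
    next
      case us: False
      then have "hd us \<noteq> x" "hd us \<noteq> y" "hd bs = hd us" using bne bs(1) by auto
      then show ?thesis using d(6)[OF False] us by simp
    qed
    have "diagram S R T ?D ?q ?al ?lab ?src ?bs (u @ [a, inv_letter a] @ v)"
      unfolding diagram_def
    proof (intro conjI impI ballI)
      show "lmap S R ?D ?q ?al ?lab ?src" by (rule L2)
      show "distinct ?bs" using dist by auto
      show "set ?bs \<subseteq> ?D" using d(3) bs(1) by auto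
      show "cyc ?q ?bs" by (rule cq)
      show "map ?lab ?bs = u @ [a, inv_letter a] @ v" using lb y(2) by simp
      show "pres_eq R (?src (hd ?bs)) []" by (rule base)
      fix e assume "e \<in> ?D - set ?bs"
      then have e: "e \<in> D" "e \<notin> set bs" using bs(1) by auto
      show "?q (?q (?q e)) = e" "[?lab e, ?lab (?q e), ?lab (?q (?q e))] \<in> T" using tri[OF e] by auto
    qed
    then show ?thesis unfolding bounds_def by blast
  qed
qed

text \<open>The two cancelling darts form a closed path in the Cayley graph. They are cut off the
  boundary as a bigon, which is then zipped up.\<close>

lemma bounds_cancel:
  assumes "bounds S R T (u @ [a, inv_letter a] @ v)"
  shows "bounds S R T (u @ v)"
proof -
  obtain D :: "nat set" and p al lab src bs where dg: "diagram S R T D p al lab src bs (u @ [a, inv_letter a] @ v)"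
    using assms(1) unfolding bounds_def by blast
  note d = diagramD[OF dg] note L = d(1)
  obtain us ts where 1: "bs = us @ ts" "map lab us = u" "map lab ts = [a, inv_letter a] @ v" using map_append_splitE[OF d(5)] .
  obtain xy vs where 2: "ts = xy @ vs" "map lab xy = [a, inv_letter a]" "map lab vs = v" using map_append_splitE[OF 1(3)] .
  obtain x y where xy: "xy = [x, y]" "lab x = a" "lab y = inv_letter a" using 2(2) by auto
  have bs: "bs = us @ [x, y] @ vs" using 1(1) 2(1) xy(1) by simp
  let ?bs = "us @ vs" and ?ws = "vs @ us"
  have xyD: "x \<in> D" "y \<in> D" "x \<noteq> y" "x \<notin> set ?bs" "y \<notin> set ?bs" using d(2,3) bs by auto
  have cp: "cyc p ([x, y] @ ?ws)" using d(4) bs cyc_commute[of p us "[x, y] @ vs"] by simp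
  have pxy: "p x = y" using cp by (cases ?ws) (auto simp: cyc_def)
  have tr: "pres_eq R (src x) (src y @ [lab y])"
  proof -
    have "pres_eq R (src y @ [lab y]) ((src x @ [lab x]) @ [lab y])"
      using lmapD(6)[OF L xyD(1)] pxy by (intro pres_eq_appendR) simp
    moreover have "pres_eq R ((src x @ [lab x]) @ [lab y]) (src x)"
      using pres_cancel[of R "src x" a "[]"] xy by simp
    ultimately show ?thesis by (blast intro: pres_trans pres_sym)
  qed
  have "\<exists>q. lmap S R D q al lab src \<and> cyc q [x, y] \<and> cyc q ?bs \<and> (\<forall>e. e \<notin> set bs \<longrightarrow> q e = p e)"
  proof (cases "?bs = []")
    case True
    then show ?thesis using L cp by (intro exI[of _ p]) auto
  next
    case False
    then have "?ws \<noteq> []" by auto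
    have "distinct ([x, y] @ ?ws)" "set ([x, y] @ ?ws) \<subseteq> D" using d(2,3) bs by auto
    from lmap_split[OF L cp this _ \<open>?ws \<noteq> []\<close>] tr
    show ?thesis using cyc_commute[of _ vs us] bs by (intro exI[of _ "swp p (last [x, y]) (last ?ws)"]) auto
  qed
  then obtain q where q: "lmap S R D q al lab src" "cyc q [x, y]" "cyc q ?bs" "\<And>e. e \<notin> set bs \<Longrightarrow> q e = p e" by blast
  have "q x = y" "q y = x" using q(2) by (auto simp: cyc_def)
  moreover have "lab y = inv_letter (lab x)" using xy by simp
  ultimately obtain al' where L': "lmap S R (D - {x, y}) q al' lab src"
    using lmap_bigon[OF q(1) xyD(1-3)] by blast
  have "diagram S R T (D - {x, y}) q al' lab src ?bs (u @ v)"
    unfolding diagram_def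
  proof (intro conjI impI ballI)
    show "lmap S R (D - {x, y}) q al' lab src" by (rule L')
    show "distinct ?bs" "set ?bs \<subseteq> D - {x, y}" using d(2,3) bs xyD by auto
    show "cyc q ?bs" by (rule q(3))
    show "map lab ?bs = u @ v" using 1 2 by simp
    show "pres_eq R (src (hd ?bs)) []" if "?bs \<noteq> []"
    proof (cases "us = []")
      case True
      then have vs: "vs \<noteq> []" using that by simp
      have "p y = hd vs" using cp True vs cyc_append[of "[x, y]" vs p] by simp
      then have "pres_eq R (src (hd vs)) (src y @ [lab y])" using lmapD(6)[OF L xyD(2)] by simp
      moreover have "pres_eq R (src x) []" using d(6) bs True by simp
      ultimately have "pres_eq R (src (hd vs)) []" using tr pres_trans pres_sym by metis
      then show ?thesis using True by simp
    next
      case False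
      then show ?thesis using d(6) bs by simp
    qed
    fix e assume "e \<in> D - {x, y} - set ?bs"
    then have e: "e \<in> D" "e \<notin> set bs" using bs by auto
    note f1 = diagram_face[OF dg e]
    note f2 = diagram_face[OF dg f1]
    show "q (q (q e)) = e" "[lab e, lab (q e), lab (q (q e))] \<in> T"
      using q(4)[OF e(2)] q(4)[OF f1(2)] q(4)[OF f2(2)] d(7,8)[OF e] by auto
  qed
  then show ?thesis unfolding bounds_def by blast
qed

text \<open>Insert \<open>a b c\<close> followed by its formal inverse and cut off \<open>a b c\<close> as a new triangular face.\<close>

lemma bounds_triangle:
  assumes b: "bounds S R T (u @ v)" and S: "fst a \<in> S" "fst b \<in> S" "fst c \<in> S"
    and T: "[a, b, c] \<in> T" "[b, c, a] \<in> T" "[c, a, b] \<in> T" and rel: "pres_eq R [a, b, c] []"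
  shows "bounds S R T (u @ [inv_letter c, inv_letter b, inv_letter a] @ v)"
proof -
  have "bounds S R T (u @ [a, inv_letter a] @ v)" by (rule bounds_insert[OF b S(1)])
  then have "bounds S R T ((u @ [a]) @ ([inv_letter a] @ v))" by simp
  from bounds_insert[OF this S(2)] have "bounds S R T ((u @ [a, b]) @ ([inv_letter b, inv_letter a] @ v))" by simp
  from bounds_insert[OF this S(3)]
  have "bounds S R T (u @ [a, b, c] @ [inv_letter c, inv_letter b, inv_letter a] @ v)" by simp
  then obtain D :: "nat set" and p al lab src bs
    where dg: "diagram S R T D p al lab src bs (u @ [a, b, c] @ [inv_letter c, inv_letter b, inv_letter a] @ v)"
    unfolding bounds_def by blast
  note d = diagramD[OF dg] note L = d(1)
  obtain us ts where 1: "bs = us @ ts" "map lab us = u" "map lab ts = [a, b, c] @ [inv_letter c, inv_letter b, inv_letter a] @ v"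
    using map_append_splitE[OF d(5)] .
  obtain cs vs where 2: "ts = cs @ vs" "map lab cs = [a, b, c]" "map lab vs = [inv_letter c, inv_letter b, inv_letter a] @ v"
    using map_append_splitE[OF 1(3)] .
  obtain x y z where xyz: "cs = [x, y, z]" "lab x = a" "lab y = b" "lab z = c" using 2(2) by auto
  have bs: "bs = us @ [x, y, z] @ vs" using 1(1) 2(1) xyz(1) by simp
  have vs: "vs \<noteq> []" using 2(3) by auto
  let ?bs = "us @ vs" and ?ws = "vs @ us"
  have D: "x \<in> D" "y \<in> D" "z \<in> D" using d(3) bs by auto
  have cp: "cyc p ([x, y, z] @ ?ws)" using d(4) bs cyc_commute[of p us "[x, y, z] @ vs"] by simp
  have pxyz: "p x = y" "p y = z" "p z = hd vs" using cp vs cyc_append[of "[x, y, z]" ?ws p] by auto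
  have tr: "pres_eq R (src z @ [lab z]) (src x)"
  proof -
    have "pres_eq R (src y @ [b, c]) ((src x @ [a]) @ [b, c])"
      using lmapD(6)[OF L D(1)] pxyz xyz by (intro pres_eq_appendR) simp
    moreover have "pres_eq R (src z @ [c]) ((src y @ [b]) @ [c])"
      using lmapD(6)[OF L D(2)] pxyz xyz by (intro pres_eq_appendR) simp
    moreover have "pres_eq R (src x @ [a, b, c]) (src x @ [])" by (rule pres_eq_append[OF pres_refl rel])
    ultimately show ?thesis using xyz by (auto intro: pres_trans)
  qed
  let ?q = "swp p (last [x, y, z]) (last ?ws)"
  have sp: "lmap S R D ?q al lab src" "cyc ?q [x, y, z]" "cyc ?q ?ws" "\<And>e. e \<notin> set ([x, y, z] @ ?ws) \<Longrightarrow> ?q e = p e"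
  proof -
    have "distinct ([x, y, z] @ ?ws)" "set ([x, y, z] @ ?ws) \<subseteq> D" "[x, y, z] \<noteq> []" "?ws \<noteq> []"
      using d(2,3) bs vs by auto
    note sp = lmap_split[OF L cp this]
    have h: "pres_eq R (src (hd [x, y, z])) (src (last [x, y, z]) @ [lab (last [x, y, z])])"
      using tr by (simp add: pres_sym)
    show "lmap S R D ?q al lab src" "cyc ?q [x, y, z]" "cyc ?q ?ws" "\<And>e. e \<notin> set ([x, y, z] @ ?ws) \<Longrightarrow> ?q e = p e"
      using sp[OF h] by blast+
  qed
  have q3: "?q x = y" "?q y = z" "?q z = x" using sp(2) by (auto simp: cyc_def)
  have "diagram S R T D ?q al lab src ?bs (u @ [inv_letter c, inv_letter b, inv_letter a] @ v)"
    unfolding diagram_def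
  proof (intro conjI impI ballI)
    show "lmap S R D ?q al lab src" by (rule sp(1))
    show "distinct ?bs" "set ?bs \<subseteq> D" using d(2,3) bs by auto
    show "cyc ?q ?bs" using sp(3) cyc_commute by blast
    show "map lab ?bs = u @ [inv_letter c, inv_letter b, inv_letter a] @ v" using 1 2 by simp
    show "pres_eq R (src (hd ?bs)) []"
    proof (cases "us = []")
      case True
      have "pres_eq R (src (hd vs)) (src z @ [lab z])" using lmapD(6)[OF L D(3)] pxyz by simp
      moreover have "pres_eq R (src x) []" using d(6) bs True by simp
      ultimately show ?thesis using tr True by (auto intro: pres_trans)
    next
      case False
      then show ?thesis using d(6) bs by simp
    qed
    fix e assume e: "e \<in> D - set ?bs"
    show "?q (?q (?q e)) = e" "[lab e, lab (?q e), lab (?q (?q e))] \<in> T"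
    proof -
      consider "e = x" | "e = y" | "e = z" | "e \<in> D" "e \<notin> set bs" using e bs by auto
      then have "?q (?q (?q e)) = e \<and> [lab e, lab (?q e), lab (?q (?q e))] \<in> T"
      proof cases
        case 1
        show ?thesis unfolding 1 q3 xyz using T by simp
      next
        case 2
        show ?thesis unfolding 2 q3 xyz using T by simp
      next
        case 3
        show ?thesis unfolding 3 q3 xyz using T by simp
      next
        case 4
        note e = 4
        note f1 = diagram_face[OF dg e]
        note f2 = diagram_face[OF dg f1]
        have "?q f = p f" if "f \<notin> set bs" for f using sp(4)[of f] that bs by auto
        then show ?thesis using e f1 f2 d(7,8)[OF e] by simp
      qed
      then show "?q (?q (?q e)) = e" "[lab e, lab (?q e), lab (?q (?q e))] \<in> T" by auto
    qed
  qed
  then show ?thesis unfolding bounds_def by blast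
qed

definition triangular :: "'g set \<Rightarrow> 'g word list \<Rightarrow> 'g word set \<Rightarrow> bool" where
  "triangular S R T \<longleftrightarrow> set R \<subseteq> T \<and>
    (\<forall>t\<in>T. length t = 3 \<and> t \<in> words_over S \<and> pres_eq R t [] \<and> rotate1 t \<in> T \<and> inv_word t \<in> T)"

text \<open>Cutting off a triangle leaves its formal inverse on the boundary, so
  \<open>bounds_triangle\<close> is applied to the inverse of \<open>t\<close>.\<close>

lemma bounds_face:
  assumes T: "triangular S R T" "t \<in> T" and b: "bounds S R T (u @ v)"
  shows "bounds S R T (u @ t @ v)"
proof -
  have it: "inv_word t \<in> T" using T by (auto simp: triangular_def)
  then have "length (inv_word t) = 3" using T by (auto simp: triangular_def)
  then obtain a b c where abc: "inv_word t = [a, b, c]" by (auto simp: numeral_3_eq_3 length_Suc_conv)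
  have T3: "[a, b, c] \<in> T" using it abc by simp
  have rot: "\<And>s. s \<in> T \<Longrightarrow> rotate1 s \<in> T" using T(1) by (auto simp: triangular_def)
  have T4: "[b, c, a] \<in> T" using rot[OF T3] by simp
  have T5: "[c, a, b] \<in> T" using rot[OF T4] by simp
  have "fst a \<in> S" "fst b \<in> S" "fst c \<in> S" "pres_eq R [a, b, c] []"
    using T(1) T3 by (auto simp: triangular_def words_over_def)
  from bounds_triangle[OF b this(1-3) T3 T4 T5 this(4)]
  have "bounds S R T (u @ inv_word [a, b, c] @ v)" by (simp add: inv_word_def)
  then show ?thesis using abc by (metis inv_word_inv_word)
qed

text \<open>A derivation may pass through generators outside \<open>S\<close>, which no diagram can
  carry. Deleting them turns a cancellation outside \<open>S\<close> into nothing and leaves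
  relators untouched.\<close>

lemma bounds_pres_eq:
  assumes T: "triangular S R T" and "pres_eq R u v"
  shows "bounds S R T (filter (\<lambda>a. fst a \<in> S) u) \<longleftrightarrow> bounds S R T (filter (\<lambda>a. fst a \<in> S) v)"
  using assms(2)
proof (induction rule: pres_eq.induct)
  case (pres_cancel u a v)
  let ?f = "filter (\<lambda>a. fst a \<in> S)"
  show ?case
  proof (cases "fst a \<in> S")
    case True
    have "?f (u @ [a, inv_letter a] @ v) = ?f u @ [a, inv_letter a] @ ?f v" using True by simp
    then show ?thesis using bounds_insert[of S R T "?f u" "?f v" a] bounds_cancel[of S R T "?f u" a "?f v"] True by auto
  qed simp
next
  case (pres_rel r u v)
  let ?f = "filter (\<lambda>a. fst a \<in> S)"
  have r: "r \<in> T" "inv_word r \<in> T" "length r = 3" "r \<in> words_over S" using pres_rel T by (auto simp: triangular_def)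
  have e: "?f (u @ r @ v) = ?f u @ r @ ?f v" using r(4) by (auto simp: words_over_def)
  obtain a b c where abc: "r = [a, b, c]" using r(3) by (auto simp: numeral_3_eq_3 length_Suc_conv)
  show ?case
  proof
    assume "bounds S R T (?f (u @ r @ v))"
    then have "bounds S R T ((?f u @ r) @ ?f v)" using e by simp
    \<comment> \<open>A relator is removed by inserting its inverse behind it and cancelling letter
      by letter.\<close>
    from bounds_face[OF T r(2) this]
    have "bounds S R T ((?f u @ [a, b]) @ [c, inv_letter c] @ ([inv_letter b, inv_letter a] @ ?f v))" using abc by (simp add: inv_word_def)
    from bounds_cancel[OF this]
    have "bounds S R T ((?f u @ [a]) @ [b, inv_letter b] @ ([inv_letter a] @ ?f v))" by simp
    from bounds_cancel[OF this]
    have "bounds S R T (?f u @ [a, inv_letter a] @ ?f v)" by simp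
    from bounds_cancel[OF this]
    show "bounds S R T (?f (u @ v))" by simp
  next
    assume "bounds S R T (?f (u @ v))"
    then show "bounds S R T (?f (u @ r @ v))" using bounds_face[OF T r(1), of "?f u" "?f v"] e by simp
  qed
qed auto

lemma bounds_Nil: "bounds S R T []"
proof -
  have "planar_map ({} :: nat set) id id" by (simp add: planar_map_def ncc_def)
  then have "diagram S R T ({} :: nat set) id id (\<lambda>_. undefined) (\<lambda>_. []) [] []" by (simp add: diagram_def lmap_def)
  then show ?thesis unfolding bounds_def by blast
qed

theorem bounds_trivial_word:
  assumes "triangular S R T" "w \<in> words_over S" "pres_eq R w []"
  shows "bounds S R T w"
proof -
  have "filter (\<lambda>a. fst a \<in> S) w = w" using assms(2) by (auto simp: words_over_def)
  then show ?thesis using bounds_pres_eq[OF assms(1,3)] bounds_Nil by simp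
qed

text \<open>The triangles on the two sides of \<open>d\<close> are mirror images in their common
  edge, whose own two darts carry inverse labels anyway.\<close>

definition mirrored :: "('a \<Rightarrow> 'a) \<Rightarrow> ('a \<Rightarrow> 'a) \<Rightarrow> ('a \<Rightarrow> 'g letter) \<Rightarrow> 'a \<Rightarrow> bool" where
  "mirrored p al lab d \<longleftrightarrow> lab (p (al d)) = inv_letter (lab (p (p d))) \<and> lab (p (p (al d))) = inv_letter (lab (p d))"

text \<open>Two mirror-image triangles sharing an edge are first rearranged into three bigons, which are then removed.\<close>

lemma diagram_reduce:
  assumes dg: "diagram S R T D p al lab src bs w" and dd: "d \<in> D" "d \<notin> set bs" "al d \<notin> set bs"
    and mir: "mirrored p al lab d"
    and T: "\<And>x y z. [x, y, z] \<in> T \<Longrightarrow> y \<noteq> x \<and> y \<noteq> inv_letter x"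
  shows "\<exists>D' p' al'. diagram S R T D' p' al' lab src bs w \<and> D' \<subset> D"
proof -
  note dgD = diagramD[OF dg] note L = dgD(1) note M = lmapD(1)[OF L] note P = planar_mapD[OF M]
  define a b c a' c' b' where names: "a = d" "b = p d" "c = p (p d)" "a' = al d" "c' = p (al d)" "b' = p (p (al d))"
  have a: "a \<in> D" "a \<notin> set bs" using dd names by auto
  have b: "b \<in> D" "b \<notin> set bs" using diagram_face[OF dg dd(1,2)] names by auto
  have c: "c \<in> D" "c \<notin> set bs" using diagram_face[OF dg b] names by auto
  have a': "a' \<in> D" "a' \<notin> set bs" using dd P(3) names by auto
  have c': "c' \<in> D" "c' \<notin> set bs" using diagram_face[OF dg a'] names by auto
  have b': "b' \<in> D" "b' \<notin> set bs" using diagram_face[OF dg c'] names by auto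
  have pp: "p a = b" "p b = c" "p c = a" "p a' = c'" "p c' = b'" "p b' = a'"
    using dgD(7)[OF a] dgD(7)[OF a'] names by auto
  have al: "al a = a'" "al a' = a" using names P(4)[OF dd(1)] by auto
  have lb: "lab a' = inv_letter (lab a)" "lab c' = inv_letter (lab c)" "lab b' = inv_letter (lab b)"
    using lmapD(4)[OF L dd(1)] mir names by (auto simp: mirrored_def)
  have t: "[lab a, lab b, lab c] \<in> T" "[lab b, lab c, lab a] \<in> T" "[lab c, lab a, lab b] \<in> T"
    using dgD(8)[OF a] dgD(8)[OF b] dgD(8)[OF c] pp by simp_all
  have n: "a \<noteq> b" "b \<noteq> c" "a \<noteq> c" using T[OF t(1)] T[OF t(2)] T[OF t(3)] by auto
  have n': "a' \<noteq> a" "a' \<noteq> b" "a' \<noteq> c"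
  proof -
    show "a' \<noteq> a" using P(5)[OF dd(1)] names by simp
    show "a' \<noteq> b" using T[OF t(1)] lb(1) by auto
    show "a' \<noteq> c" using T[OF t(3)] lb(1) by (metis inv_letter_inv_letter)
  qed
  have n2: "c' \<notin> {a, b, c}" "b' \<notin> {a, b, c}" using n' pp by auto
  have n3: "a' \<noteq> c'" "c' \<noteq> b'" "a' \<noteq> b'" using n pp lb by (metis inv_letter_inv_letter T t)+
  have tgt: "pres_eq R (src (p e)) (src e @ [lab e])" if "e \<in> D" for e using lmapD(6)[OF L that] .
  have taa: "pres_eq R (src a') (src a @ [lab a])" "pres_eq R (src a) (src a' @ [lab a'])"
    using lmapD(5)[OF L a(1)] lmapD(5)[OF L a'(1)] al by simp_all
  \<comment> \<open>Fuses the triangles to the hexagon \<open>a a' c' b' b c\<close>; permitted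
    because \<open>a\<close> and \<open>b'\<close> end at the same vertex.\<close>
  let ?p1 = "swp p a b'"
  have L1: "lmap S R D ?p1 al lab src"
  proof (rule lmap_swp[OF L a(1) b'(1)])
    have "(al b', a') \<in> conn (gr D (p \<circ> al))" using P(3,4) b'(1) pp by (intro conn_base) (simp add: gr_iff)
    then show "(a, b') \<in> conn (gr D p) \<or> (al a, al b') \<in> conn (gr D (p \<circ> al)) \<or> (a, b') \<notin> conn (gr D p \<union> gr D al)"
      using al conn_sym by metis
    show "pres_eq R (src a @ [lab a]) (src b' @ [lab b'])"
      using pres_trans[OF pres_sym[OF taa(1)]] tgt[OF b'(1)] pp by simp
  qed
  have q1: "?p1 a = a'" "?p1 b' = b" "?p1 b = c" "?p1 c = a" "?p1 a' = c'" "?p1 c' = b'"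
    using n n' n2 n3 pp by (auto simp: swp_def)
  \<comment> \<open>Cuts off the bigon \<open>a a'\<close> and leaves \<open>c c' b' b\<close>,
    which the third exchange divides into the bigons \<open>c c'\<close> and
    \<open>b b'\<close>.\<close>
  let ?p2 = "swp ?p1 c a'"
  have L2: "lmap S R D ?p2 al lab src"
  proof (rule lmap_swp[OF L1 c(1) a'(1)])
    have "(c, a) \<in> conn (gr D ?p1)" "(a, a') \<in> conn (gr D ?p1)"
      using q1 a(1) c(1) by (auto intro!: conn_base simp: gr_iff)
    then show "(c, a') \<in> conn (gr D ?p1) \<or> (al c, al a') \<in> conn (gr D (?p1 \<circ> al)) \<or> (c, a') \<notin> conn (gr D ?p1 \<union> gr D al)"
      using conn_trans by metis
    show "pres_eq R (src c @ [lab c]) (src a' @ [lab a'])"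
      using pres_trans[OF pres_sym[OF tgt[OF c(1)]]] taa(2) pp by simp
  qed
  have q2: "?p2 a = a'" "?p2 a' = a" "?p2 c = c'" "?p2 c' = b'" "?p2 b' = b" "?p2 b = c"
    using n n' n2 n3 q1 unfolding swp_def[of ?p1] by auto
  let ?p3 = "swp ?p2 c' b"
  have L3: "lmap S R D ?p3 al lab src"
  proof (rule lmap_swp[OF L2 c'(1) b(1)])
    have "(c', b') \<in> conn (gr D ?p2)" "(b', b) \<in> conn (gr D ?p2)"
      using q2 c'(1) b'(1) by (auto intro!: conn_base simp: gr_iff)
    then show "(c', b) \<in> conn (gr D ?p2) \<or> (al c', al b) \<in> conn (gr D (?p2 \<circ> al)) \<or> (c', b) \<notin> conn (gr D ?p2 \<union> gr D al)"
      using conn_trans by metis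
    have "pres_eq R (src c') (src a' @ [lab a'])" using tgt[OF a'(1)] pp by simp
    then have "pres_eq R (src c') (src a)" using taa(2) pres_trans pres_sym by metis
    then have "pres_eq R (src c') (src c @ [lab c])" using tgt[OF c(1)] pp pres_trans by metis
    then have "pres_eq R (src c' @ [lab c']) ((src c @ [lab c]) @ [lab c'])" by (rule pres_eq_appendR)
    moreover have "pres_eq R ((src c @ [lab c]) @ [lab c']) (src c)" using pres_cancel[of R "src c" "lab c" "[]"] lb by simp
    moreover have "pres_eq R (src c) (src b @ [lab b])" using tgt[OF b(1)] pp by simp
    ultimately show "pres_eq R (src c' @ [lab c']) (src b @ [lab b])" by (blast intro: pres_trans)
  qed
  have q3: "?p3 a = a'" "?p3 a' = a" "?p3 c = c'" "?p3 c' = c" "?p3 b = b'" "?p3 b' = b"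
    using n n' n2 n3 q2 unfolding swp_def[of ?p2] by auto
  have q3o: "?p3 e = p e" if "e \<notin> {a, b, c, a', b', c'}" for e using that by (auto simp: swp_def)
  let ?p = ?p3
  obtain al1 where L4: "lmap S R (D - {a, a'}) ?p al1 lab src"
    using lmap_bigon[OF L3 a(1) a'(1)] n' q3 lb by metis
  have "c \<in> D - {a, a'}" "c' \<in> D - {a, a'}" "c \<noteq> c'" using c c' n n' n2 n3 by auto
  from lmap_bigon[OF L4 this q3(3,4) lb(2)]
  obtain al2 where L5: "lmap S R (D - {a, a'} - {c, c'}) ?p al2 lab src" by blast
  have "b \<in> D - {a, a'} - {c, c'}" "b' \<in> D - {a, a'} - {c, c'}" "b \<noteq> b'" using b b' n n' n2 n3 by auto
  from lmap_bigon[OF L5 this q3(5,6) lb(3)]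
  obtain al3 where L6: "lmap S R (D - {a, a'} - {c, c'} - {b, b'}) ?p al3 lab src" by blast
  let ?D = "D - {a, a'} - {c, c'} - {b, b'}" and ?X = "{a, b, c, a', b', c'}"
  have pX: "p e \<notin> ?X" if "e \<in> D" "e \<notin> set bs" "e \<notin> ?X" for e
  proof
    assume "p e \<in> ?X"
    then have "p (p (p e)) \<in> ?X" using pp by auto
    then show False using dgD(7)[OF that(1,2)] that(3) by simp
  qed
  have "diagram S R T ?D ?p al3 lab src bs w"
    unfolding diagram_def
  proof (intro conjI impI ballI)
    show "lmap S R ?D ?p al3 lab src" by (rule L6)
    show "distinct bs" "map lab bs = w" using dgD by auto
    show "set bs \<subseteq> ?D" using dgD(3) a b c a' b' c' by auto
    have "e \<notin> ?X" if "e \<in> set bs" for e using that a b c a' b' c' by auto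
    then show "cyc ?p bs" using cyc_cong[OF _ dgD(4), of ?p] q3o by simp
    show "pres_eq R (src (hd bs)) []" if "bs \<noteq> []" using dgD(6)[OF that] .
    fix e assume "e \<in> ?D - set bs"
    then have e: "e \<in> D" "e \<notin> set bs" "e \<notin> ?X" by auto
    note f1 = diagram_face[OF dg e(1,2)] and x1 = pX[OF e]
    note f2 = diagram_face[OF dg f1] and x2 = pX[OF f1 x1]
    show "?p (?p (?p e)) = e" "[lab e, lab (?p e), lab (?p (?p e))] \<in> T"
      unfolding q3o[OF e(3)] q3o[OF x1] q3o[OF x2] using dgD(7,8)[OF e(1,2)] by auto
  qed
  moreover have "?D \<subset> D" using a(1) by auto
  ultimately show ?thesis by blast
qed

text \<open>A diagram with the fewest darts admits no reduction.\<close>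

lemma bounds_reduced:
  assumes "bounds S R T w" and T: "\<And>x y z. [x, y, z] \<in> T \<Longrightarrow> y \<noteq> x \<and> y \<noteq> inv_letter x"
  shows "\<exists>(D :: nat set) p al lab src bs. diagram S R T D p al lab src bs w \<and>
    (\<forall>d\<in>D - set bs. al d \<notin> set bs \<longrightarrow> \<not> mirrored p al lab d)"
proof -
  let ?P = "\<lambda>D :: nat set. \<exists>p al lab src bs. diagram S R T D p al lab src bs w"
  have "\<exists>D. ?P D" using assms(1) unfolding bounds_def .
  then obtain D where D: "?P D" and min: "\<And>D'. ?P D' \<Longrightarrow> card D \<le> card D'"
    using ex_has_least_nat[of ?P _ card] by metis
  then obtain p al lab src bs where dg: "diagram S R T D p al lab src bs w" by blast
  have fin: "finite D" using planar_mapD(1)[OF lmapD(1)[OF diagramD(1)[OF dg]]] .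
  have "\<not> mirrored p al lab d" if dd: "d \<in> D" "d \<notin> set bs" "al d \<notin> set bs" for d
  proof
    assume mir: "mirrored p al lab d"
    have "\<exists>D' p' al'. diagram S R T D' p' al' lab src bs w \<and> D' \<subset> D"
      by (rule diagram_reduce[OF dg dd mir]) (rule T)
    then obtain D' p' al' where "diagram S R T D' p' al' lab src bs w" and sub: "D' \<subset> D" by blast
    then have "?P D'" by blast
    then show False using min[of D'] psubset_card_mono[OF fin sub] by simp
  qed
  then show ?thesis using dg by blast
qed

section \<open>Cycles of permutations and the discharging count\<close>

lemma orbit_enum:
  assumes "finite D" "bij_betw p D D" "x \<in> D"
  defines "N \<equiv> card (conn (gr D p) `` {x})"
  shows "bij_betw (\<lambda>k. (p ^^ k) x) {..<N} (conn (gr D p) `` {x})" "(p ^^ N) x = x" "N > 0"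
proof -
  define m where "m = (LEAST k. k > 0 \<and> (p ^^ k) x = x)"
  have "m > 0 \<and> (p ^^ m) x = x" unfolding m_def
    by (rule LeastI_ex) (rule funpow_period[OF assms(1,2,3)])
  then have m: "m > 0" "(p ^^ m) x = x" by auto
  have min: "(p ^^ j) x \<noteq> x" if "0 < j" "j < m" for j using not_less_Least[OF that(2)[unfolded m_def]] that(1) by simp
  have inj: "inj_on (\<lambda>k. (p ^^ k) x) {..<m}"
  proof (rule linorder_inj_onI)
    fix i j assume ij: "i < j" "i \<in> {..<m}" "j \<in> {..<m}"
    show "(p ^^ i) x \<noteq> (p ^^ j) x"
    proof
      assume "(p ^^ i) x = (p ^^ j) x"
      then have "(p ^^ (i + (j - i))) x = (p ^^ i) x" using ij(1) by simp
      from bij_funpow_cancel[OF assms(2,3) this] have "(p ^^ (j - i)) x = x" .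
      moreover have "0 < j - i" "j - i < m" using ij by (auto simp: less_imp_diff_less)
      ultimately show False using min by blast
    qed
  qed auto
  have per: "(p ^^ k) x = (p ^^ (k mod m)) x" for k
  proof -
    have "(p ^^ (m * q)) x = x" for q
      by (induction q) (simp_all add: funpow_add m(2))
    then have "(p ^^ (k mod m + m * (k div m))) x = (p ^^ (k mod m)) x" by (simp only: funpow_add comp_apply)
    then show ?thesis by simp
  qed
  have img: "(\<lambda>k. (p ^^ k) x) ` {..<m} = conn (gr D p) `` {x}"
  proof
    show "(\<lambda>k. (p ^^ k) x) ` {..<m} \<subseteq> conn (gr D p) `` {x}" using funpow_conn[OF assms(2,3)] by auto
    show "conn (gr D p) `` {x} \<subseteq> (\<lambda>k. (p ^^ k) x) ` {..<m}"
    proof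
      fix y assume "y \<in> conn (gr D p) `` {x}"
      then have "(x, y) \<in> conn (gr D p)" by simp
      from conn_gr_funpow[OF assms(1-3) this] obtain k where "y = (p ^^ k) x" by blast
      then have "y = (p ^^ (k mod m)) x" using per by simp
      moreover have "k mod m < m" using m(1) by simp
      ultimately show "y \<in> (\<lambda>k. (p ^^ k) x) ` {..<m}" by blast
    qed
  qed
  have "N = m" unfolding N_def img[symmetric] by (simp add: card_image[OF inj])
  then show "bij_betw (\<lambda>k. (p ^^ k) x) {..<N} (conn (gr D p) `` {x})" "(p ^^ N) x = x" "N > 0"
    using inj img m by (auto simp: bij_betw_def)
qed

lemma class_subset: "bij_betw p D D \<Longrightarrow> x \<in> D \<Longrightarrow> conn (gr D p) `` {x} \<subseteq> D"
  using conn_Un_disjoint[of "gr D p" D "{}" "{}" x] gr_sub[of p D] by auto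

lemma sum_classes:
  assumes "finite D" "bij_betw p D D"
  shows "sum h D = (\<Sum>C\<in>(\<lambda>x. conn (gr D p) `` {x}) ` D. sum h C)"
proof -
  let ?K = "(\<lambda>x. conn (gr D p) `` {x}) ` D"
  have "\<Union>?K = D" using class_subset[OF assms(2)] by auto
  moreover have "sum h (\<Union>?K) = sum (sum h) ?K"
  proof (rule sum.Union_disjoint[unfolded comp_def])
    show "\<forall>A\<in>?K. finite A" using class_subset[OF assms(2)] finite_subset[OF _ assms(1)] by blast
    show "\<forall>A\<in>?K. \<forall>B\<in>?K. A \<noteq> B \<longrightarrow> A \<inter> B = {}"
    proof (intro ballI impI)
      fix A B assume "A \<in> ?K" "B \<in> ?K" and ne: "A \<noteq> B"
      then obtain x y where xy: "A = conn (gr D p) `` {x}" "B = conn (gr D p) `` {y}" by auto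
      show "A \<inter> B = {}"
      proof (rule ccontr)
        assume "A \<inter> B \<noteq> {}"
        then obtain z where "(x, z) \<in> conn (gr D p)" "(y, z) \<in> conn (gr D p)" using xy by auto
        then have "(x, y) \<in> conn (gr D p)" using conn_trans conn_sym by metis
        then show False using ne conn_class_eq[of "gr D p" x y] xy by simp
      qed
    qed
  qed
  ultimately show ?thesis by simp
qed

text \<open>Charges are counted in units of one twentieth: a vertex of degree \<open>k\<close> has curvature \<open>20 * (6 - k)\<close>, and
  \<open>received x\<close> is what the vertex of \<open>x\<close> receives along \<open>x\<close>. The set \<open>B\<close> consists of the boundary darts.\<close>

lemma discharge:
  fixes D :: "'a set" and rot al :: "'a \<Rightarrow> 'a" and received :: "'a \<Rightarrow> nat"
  defines "orb \<equiv> \<lambda>x. conn (gr D rot) `` {x}"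
  assumes fin: "finite D" and rot: "bij_betw rot D D" and al: "bij_betw al D D" and B: "B \<subseteq> D"
    and euler: "card (D - B) + 3 * card B \<le> 6 * ncc D (gr D rot) + 6"
    and received_five: "\<And>x. x \<in> D \<Longrightarrow> received x \<noteq> 0 \<Longrightarrow> card (orb (al x)) = 5 \<and> orb (al x) \<inter> B = {} \<and> \<not> (card (orb x) = 5 \<and> orb x \<inter> B = {}) \<and> x \<notin> B"
    and received_le: "\<And>x. x \<in> D \<Longrightarrow> received x \<le> 9"
    and neg: "\<And>x. x \<in> D \<Longrightarrow> orb x \<inter> B = {} \<Longrightarrow> card (orb x) \<noteq> 5 \<Longrightarrow>
      card (orb x) + 11 * sum received (orb x) + 1320 \<le> 220 * card (orb x)"
    and pos: "\<And>x. x \<in> D \<Longrightarrow> orb x \<inter> B = {} \<Longrightarrow> card (orb x) = 5 \<Longrightarrow> 20 \<le> (\<Sum>y\<in>orb x. received (al y))"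
  shows "card (D - B) \<le> 3960 * card B + 7920"
proof -
  define K where "K = orb ` D"
  define K5 where "K5 = {C\<in>K. C \<inter> B = {} \<and> card C = 5}"
  define Ko where "Ko = {C\<in>K. C \<inter> B = {} \<and> card C \<noteq> 5}"
  define Kb where "Kb = {C\<in>K. C \<inter> B \<noteq> {}}"
  have finK: "finite K" unfolding K_def using fin by simp
  have fins: "finite K5" "finite Ko" "finite Kb" unfolding K5_def Ko_def Kb_def using finK by auto
  have part: "K = K5 \<union> (Ko \<union> Kb)" "K5 \<inter> (Ko \<union> Kb) = {}" "Ko \<inter> Kb = {}"
    unfolding K5_def Ko_def Kb_def by auto
  have sumK: "sum f K = sum f K5 + (sum f Ko + sum f Kb)" for f :: "'a set \<Rightarrow> nat"
    unfolding part(1) using fins part(2,3) by (simp add: sum.union_disjoint)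
  have finC: "finite C" if "C \<in> K" for C
    using that class_subset[OF rot] finite_subset[OF _ fin] unfolding K_def orb_def by blast
  have sumD: "sum h D = (\<Sum>C\<in>K. sum h C)" for h :: "'a \<Rightarrow> nat"
    unfolding K_def orb_def by (rule sum_classes[OF fin rot])
  define h :: "'a \<Rightarrow> nat" where "h = (\<lambda>x. of_bool (x \<notin> B))"
  have sumh: "sum h C = card (C - B)" if "finite C" for C
  proof -
    have "sum h C = card (C \<inter> {x. x \<notin> B})" unfolding h_def using that by (subst sum_of_bool_eq) auto
    also have "C \<inter> {x. x \<notin> B} = C - B" by auto
    finally show ?thesis .
  qed
  define No where "No = (\<Sum>C\<in>Ko. card C)"
  define Nb where "Nb = (\<Sum>C\<in>Kb. card (C - B))"
  define Ro where "Ro = (\<Sum>C\<in>Ko. sum received C)"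
  define Rb where "Rb = (\<Sum>C\<in>Kb. sum received C)"
  have t: "card (D - B) = 5 * card K5 + No + Nb"
  proof -
    have "card (D - B) = (\<Sum>C\<in>K. card (C - B))"
      unfolding sumh[OF fin, symmetric] sumD using sumh finC by (intro sum.cong) auto
    also have "\<dots> = (\<Sum>C\<in>K5. card (C - B)) + ((\<Sum>C\<in>Ko. card (C - B)) + Nb)" unfolding sumK Nb_def ..
    also have "(\<Sum>C\<in>K5. card (C - B)) = (\<Sum>C\<in>K5. 5)"
      by (rule sum.cong) (auto simp: K5_def Diff_triv)
    also have "(\<Sum>C\<in>Ko. card (C - B)) = No" unfolding No_def
      by (rule sum.cong) (auto simp: Ko_def Diff_triv)
    finally show ?thesis by simp
  qed
  have V: "ncc D (gr D rot) = card K5 + card Ko + card Kb"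
  proof -
    have "ncc D (gr D rot) = card K" unfolding ncc_def K_def orb_def ..
    then show ?thesis using sumK[of "\<lambda>_. 1"] by simp
  qed
  have Kb: "card Kb \<le> card B"
  proof -
    have "Kb \<subseteq> orb ` B"
    proof
      fix C assume "C \<in> Kb"
      then obtain x y where x: "C = orb x" "y \<in> C" "y \<in> B" unfolding Kb_def K_def by auto
      then have "(x, y) \<in> conn (gr D rot)" unfolding orb_def by simp
      then have "orb x = orb y" unfolding orb_def using conn_class_eq by metis
      then show "C \<in> orb ` B" using x by blast
    qed
    then show ?thesis using surj_card_le[OF finite_subset[OF B fin]] by blast
  qed
  have rcK5: "sum received C = 0" if "C \<in> K5" for C
  proof (rule sum.neutral, rule ballI)
    fix y assume y: "y \<in> C"
    obtain x where x: "x \<in> D" "C = orb x" using \<open>C \<in> K5\<close> unfolding K5_def K_def by auto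
    then have "(x, y) \<in> conn (gr D rot)" using y unfolding orb_def by simp
    then have o: "orb y = C" using x(2) conn_class_eq[of "gr D rot" x y] unfolding orb_def by simp
    have "y \<in> D" using class_subset[OF rot x(1)] y x(2) unfolding orb_def by auto
    then show "received y = 0" using received_five[of y] o that unfolding K5_def by auto
  qed
  \<comment> \<open>Charge is paid along \<open>y\<close> by the vertex of \<open>y\<close> and
    arrives along \<open>al y\<close>, so a sum over all darts may be taken from either end.
    Vertices of degree five receive nothing.\<close>
  have R: "20 * card K5 \<le> Ro + Rb"
  proof -
    have "20 * card K5 = (\<Sum>C\<in>K5. 20)" by simp
    also have "\<dots> \<le> (\<Sum>C\<in>K5. \<Sum>y\<in>C. received (al y))"
      by (rule sum_mono) (auto simp: K5_def K_def intro: pos)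
    also have "\<dots> \<le> (\<Sum>C\<in>K. \<Sum>y\<in>C. received (al y))" unfolding sumK by simp
    also have "\<dots> = (\<Sum>y\<in>D. received (al y))" unfolding sumD ..
    also have "\<dots> = (\<Sum>y\<in>D. received y)" using sum.reindex_bij_betw[OF al] .
    also have "\<dots> = (\<Sum>C\<in>K5. sum received C) + (Ro + Rb)" unfolding sumD sumK Ro_def Rb_def ..
    also have "(\<Sum>C\<in>K5. sum received C) = 0" using rcK5 by simp
    finally show ?thesis by simp
  qed
  have Rb: "Rb \<le> 9 * Nb"
  proof -
    have "sum received C \<le> 9 * card (C - B)" if C: "C \<in> Kb" for C
    proof -
      have CD: "C \<subseteq> D" "finite C" using C class_subset[OF rot] finC unfolding Kb_def K_def orb_def by auto
      have "sum received C = sum received (C - B)"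
        by (rule sum.mono_neutral_right) (use CD received_five in auto)
      also have "\<dots> \<le> (\<Sum>x\<in>C - B. 9)" by (rule sum_mono) (use CD received_le in auto)
      finally show ?thesis by simp
    qed
    then show ?thesis unfolding Rb_def Nb_def sum_distrib_left by (rule sum_mono)
  qed
  \<comment> \<open>Divided by 11: the final charge of these vertices is at most minus one eleventh
    per dart.\<close>
  have Ro: "No + 11 * Ro + 1320 * card Ko \<le> 220 * No"
  proof -
    have "No + 11 * Ro + 1320 * card Ko = (\<Sum>C\<in>Ko. card C + 11 * sum received C + 1320)"
      unfolding No_def Ro_def by (simp add: sum.distrib sum_distrib_left)
    also have "\<dots> \<le> (\<Sum>C\<in>Ko. 220 * card C)"
      by (rule sum_mono) (use neg in \<open>auto simp: Ko_def K_def\<close>)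
    finally show ?thesis unfolding No_def by (simp add: sum_distrib_left)
  qed
  \<comment> \<open>The total charge yields \<open>No + 121 * Nb \<le> 660 * card B + 1320\<close>.
    Moreover \<open>5 * card K5\<close> is at most a quarter of \<open>Ro + Rb\<close>, hence at
    most \<open>5 * No\<close> plus \<open>9 / 4\<close> times \<open>Nb\<close>. Thus the darts off
    \<open>B\<close> number at most six times the first bound, whence 3960 and 7920.\<close>
  show ?thesis using t V Kb R Rb Ro euler by linarith
qed

section \<open>Closed walks in the link\<close>

text \<open>The link has a vertex \<open>O_j\<close> (outgoing \<open>x_j\<close>) and \<open>I_j\<close> (incoming \<open>x_j\<close>) for every generator, and
  the edges \<open>O_j O_(j+1)\<close>, \<open>I_j I_(j+2)\<close> and \<open>I_j O_(j+3)\<close>. A kind is a directed edge up to translation: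
  \<open>Op\<close>, \<open>Om\<close>, \<open>Ip\<close>, \<open>Im\<close> increase or decrease the index within the \<open>O\<close> or \<open>I\<close> vertices, and
  \<open>IO\<close>, \<open>OI\<close> change sides. The kind of a dart of a triangle is the link edge at its corner, ending in the dart;
  \<open>nk\<close> is the kind of the following dart in the triangle, and \<open>mir\<close> that of the reversed dart in the
  mirror image. Giving \<open>O_j\<close> the coordinate \<open>j\<close> and \<open>I_j\<close> the coordinate \<open>j + 3\<close>, \<open>disp\<close> is
  the change of the coordinate.\<close>

datatype kind = Om | Op | IO | OI | Ip | Im

fun nk :: "kind \<Rightarrow> kind" where
  "nk Om = IO" | "nk IO = Im" | "nk Im = Om" | "nk Op = Ip" | "nk Ip = OI" | "nk OI = Op"

fun outward :: "kind \<Rightarrow> bool" where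
  "outward Om = True" | "outward Op = True" | "outward IO = True" |
  "outward OI = False" | "outward Ip = False" | "outward Im = False"

fun mir :: "kind \<Rightarrow> kind" where
  "mir Om = OI" | "mir OI = Om" | "mir IO = Ip" | "mir Ip = IO" | "mir Im = Op" | "mir Op = Im"

fun disp :: "kind \<Rightarrow> int" where
  "disp Om = -1" | "disp Op = 1" | "disp Ip = 2" | "disp Im = -2" | "disp IO = 0" | "disp OI = 0"

fun succs :: "kind \<Rightarrow> kind list" where
  "succs Om = [Om, OI]" | "succs Op = [Op, OI]" | "succs IO = [Op, Om]" |
  "succs OI = [Im, Ip]" | "succs Ip = [Ip, IO]" | "succs Im = [Im, IO]"

fun chain :: "kind \<Rightarrow> kind list \<Rightarrow> bool" where
  "chain k [] \<longleftrightarrow> True" |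
  "chain k (k' # ks) \<longleftrightarrow> k' \<in> set (succs k) \<and> chain k' ks"

text \<open>\<open>share k l\<close> is the charge sent along a link vertex entered by \<open>k\<close> and left by \<open>l\<close>, if the vertex at the other
  end has degree five; \<open>excl\<close> lists consecutive positions that cannot both be of this form. The values solve the
  resulting linear inequalities, which are tight up to one unit at some vertices of degree eight.\<close>

fun share :: "kind \<Rightarrow> kind \<Rightarrow> nat" where
  "share Op k = (case k of Op \<Rightarrow> 8 | _ \<Rightarrow> 0)" |
  "share Om k = (case k of Om \<Rightarrow> 8 | OI \<Rightarrow> 8 | _ \<Rightarrow> 0)" |
  "share IO k = (case k of Op \<Rightarrow> 8 | _ \<Rightarrow> 0)" |
  "share OI k = (case k of Im \<Rightarrow> 3 | Ip \<Rightarrow> 3 | _ \<Rightarrow> 0)" |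
  "share Ip k = (case k of IO \<Rightarrow> 3 | Ip \<Rightarrow> 9 | _ \<Rightarrow> 0)" |
  "share Im k = (case k of IO \<Rightarrow> 3 | Im \<Rightarrow> 9 | _ \<Rightarrow> 0)"

fun excl :: "kind \<Rightarrow> kind \<Rightarrow> kind \<Rightarrow> bool" where
  "excl Ip k l = (case k of Ip \<Rightarrow> l = Ip | _ \<Rightarrow> False)" |
  "excl Im k l = (case k of Im \<Rightarrow> l = Im | _ \<Rightarrow> False)" |
  "excl Om k l = (case k of Om \<Rightarrow> l = OI | _ \<Rightarrow> False)" |
  "excl IO k l = (case k of Op \<Rightarrow> l = Op | _ \<Rightarrow> False)" |
  "excl Op k l = False" |
  "excl OI k l = False"

text \<open>An upper bound for the charge along the first \<open>m\<close> transitions of a walk: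
  where two successive transitions exclude each other, only the larger share counts, and the count
  resumes behind both.\<close>

fun greedy :: "nat \<Rightarrow> kind list \<Rightarrow> nat" where
  "greedy (Suc (Suc m)) (x # y # z # zs) =
     (if excl x y z then max (share x y) (share y z) + greedy m (z # zs) else share x y + greedy (Suc m) (y # z # zs))" |
  "greedy (Suc 0) (x # y # zs) = share x y" |
  "greedy _ _ = 0"

text \<open>The 5-cycles of the link, read from every starting point and in both directions.\<close>

definition five_words :: "kind list list" where
  "five_words = [[Op, Op, OI, Im, IO], [Op, OI, Im, IO, Op], [OI, Im, IO, Op, Op], [Im, IO, Op, Op, OI], [IO, Op, Op, OI, Im],
    [Om, Om, OI, Ip, IO], [Om, OI, Ip, IO, Om], [OI, Ip, IO, Om, Om], [Ip, IO, Om, Om, OI], [IO, Om, Om, OI, Ip]]"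

text \<open>The multiples of \<open>n\<close> of absolute value at most \<open>20\<close>, for all admissible \<open>n\<close> together.\<close>

definition good_disp :: "int \<Rightarrow> bool" where
  "good_disp s \<longleftrightarrow> s = 0 \<or> \<bar>s\<bar> = 11 \<or> \<bar>s\<bar> = 13 \<or> \<bar>s\<bar> \<ge> 15"

text \<open>The greedy estimate depends on the starting point of a cyclic word; the better of two starting points suffices.\<close>

definition good_word :: "kind list \<Rightarrow> bool" where
  "good_word ks \<longleftrightarrow> (let N = length ks in
     if N < 8 then ks \<in> set five_words
     else min (greedy N (ks @ [hd ks])) (greedy N (tl ks @ [hd ks, hd (tl ks)])) + 121 \<le> 20 * N)"

text \<open>Enumerates the reduced walks with a given number of steps. \<open>k0\<close> is the
  required last kind, equal to the kind before the first step when the walk is to close up;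
  \<open>acc\<close> holds the kinds so far in reverse.\<close>

fun search :: "kind \<Rightarrow> nat \<Rightarrow> kind \<Rightarrow> int \<Rightarrow> kind list \<Rightarrow> bool" where
  "search k0 0 k s acc = (if k = k0 then if good_disp s then good_word (rev acc) else True else True)" |
  "search k0 (Suc m) k s acc = list_all (\<lambda>k'. search k0 m k' (s + disp k') (k' # acc)) (succs k)"

lemma search_sound:
  "search k0 (length ks) k s acc \<Longrightarrow> chain k ks \<Longrightarrow> last (k # ks) = k0 \<Longrightarrow> good_disp (s + sum_list (map disp ks)) \<Longrightarrow>
    good_word (rev acc @ ks)"
proof (induction ks arbitrary: k s acc)
  case (Cons k' ks)
  have "search k0 (length ks) k' (s + disp k') (k' # acc)" using Cons.prems(1,2) by (simp add: list_all_iff)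
  from Cons.IH[OF this] Cons.prems show ?case by (simp add: add.assoc)
qed (simp split: if_splits)

definition words_ok :: "nat \<Rightarrow> bool" where
  "words_ok m \<longleftrightarrow> list_all (\<lambda>k. search k m k 0 []) [Om, Op, IO, OI, Ip, Im]"

text \<open>Since \<open>five_words\<close> contains only words of length five, this rules out
  closed reduced walks of lengths 1 to 4, 6 and 7.\<close>

lemma words_ok_le7: "words_ok 1" "words_ok 2" "words_ok 3" "words_ok 4" "words_ok 5" "words_ok 6" "words_ok 7"
  by code_simp+

lemma words_ok_8: "words_ok 8"
  by code_simp

lemma words_ok_9: "words_ok 9"
  by code_simp

lemma words_ok_10: "words_ok 10"
  by code_simp

lemma good_word_closed:
  assumes "ks \<noteq> []" "length ks \<le> 10" "chain (last ks) ks" "good_disp (sum_list (map disp ks))"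
  shows "good_word ks"
proof -
  have "1 \<le> length ks" using assms(1) by (cases ks) auto
  moreover have "N = 1 \<or> N = 2 \<or> N = 3 \<or> N = 4 \<or> N = 5 \<or> N = 6 \<or> N = 7 \<or> N = 8 \<or> N = 9 \<or> N = 10"
    if "1 \<le> N" "N \<le> 10" for N :: nat using that by presburger
  ultimately have "length ks = 1 \<or> length ks = 2 \<or> length ks = 3 \<or> length ks = 4 \<or> length ks = 5 \<or> length ks = 6 \<or>
    length ks = 7 \<or> length ks = 8 \<or> length ks = 9 \<or> length ks = 10" using assms(2) by blast
  then have "words_ok (length ks)"
    by (elim disjE; simp only: words_ok_le7 words_ok_8 words_ok_9 words_ok_10)
  then have "search (last ks) (length ks) (last ks) 0 []"
    unfolding words_ok_def by (cases "last ks") simp_all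
  from search_sound[OF this assms(3)] show ?thesis using assms by simp
qed

text \<open>\<open>r i\<close> is the charge received at the transition from \<open>K i\<close> to
  \<open>K (Suc i)\<close>. The induction mirrors \<open>greedy\<close>, removing one transition or
  an excluded pair, of which at least one receives nothing.\<close>

lemma greedy_bound:
  assumes "\<And>i. r i \<le> share (K i) (K (Suc i))"
    and "\<And>i. excl (K i) (K (Suc i)) (K (Suc (Suc i))) \<Longrightarrow> r i = 0 \<or> r (Suc i) = 0"
  shows "(\<Sum>i<N. r (j + i)) \<le> greedy N (map K [j..<Suc (j + N)])"
proof (induction N arbitrary: j rule: less_induct)
  case (less N)
  consider "N = 0" | "N = 1" | m where "N = Suc (Suc m)" by (metis One_nat_def not0_implies_Suc)
  then show ?case
  proof cases
    case 1 then show ?thesis by simp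
  next
    case 2
    have "map K [j..<Suc (j + N)] = [K j, K (Suc j)]" using 2 by (simp add: upt_rec)
    then show ?thesis using 2 assms(1)[of j] by simp
  next
    case 3
    define zs where "zs = map K [Suc (Suc (Suc j))..<Suc (j + N)]"
    have e3: "map K [j..<Suc (j + N)] = K j # K (Suc j) # K (Suc (Suc j)) # zs"
      unfolding zs_def using 3 by (simp add: upt_conv_Cons del: upt_Suc)
    have e1: "map K [Suc j..<Suc (Suc j + Suc m)] = K (Suc j) # K (Suc (Suc j)) # zs"
      unfolding zs_def using 3 by (simp add: upt_conv_Cons del: upt_Suc)
    have e2: "map K [Suc (Suc j)..<Suc (Suc (Suc j) + m)] = K (Suc (Suc j)) # zs"
      unfolding zs_def using 3 by (simp add: upt_conv_Cons del: upt_Suc)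
    have gr: "greedy N (K j # K (Suc j) # K (Suc (Suc j)) # zs) =
      (if excl (K j) (K (Suc j)) (K (Suc (Suc j)))
       then max (share (K j) (K (Suc j))) (share (K (Suc j)) (K (Suc (Suc j)))) + greedy m (K (Suc (Suc j)) # zs)
       else share (K j) (K (Suc j)) + greedy (Suc m) (K (Suc j) # K (Suc (Suc j)) # zs))"
      unfolding 3 by simp
    have s1: "(\<Sum>i<N. r (j + i)) = r j + (\<Sum>i<Suc m. r (Suc j + i))"
      unfolding 3 by (subst sum.lessThan_Suc_shift) simp
    have s2: "(\<Sum>i<Suc m. r (Suc j + i)) = r (Suc j) + (\<Sum>i<m. r (Suc (Suc j) + i))"
      by (subst sum.lessThan_Suc_shift) simp
    show ?thesis
    proof (cases "excl (K j) (K (Suc j)) (K (Suc (Suc j)))")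
      case True
      have "r j + r (Suc j) \<le> max (share (K j) (K (Suc j))) (share (K (Suc j)) (K (Suc (Suc j))))"
        using assms(2)[OF True] assms(1)[of j] assms(1)[of "Suc j"] by auto
      moreover have "(\<Sum>i<m. r (Suc (Suc j) + i)) \<le> greedy m (K (Suc (Suc j)) # zs)"
        unfolding e2[symmetric] by (rule less) (simp add: 3)
      ultimately show ?thesis unfolding s1 s2 e3 gr if_P[OF True] by linarith
    next
      case False
      have "(\<Sum>i<Suc m. r (Suc j + i)) \<le> greedy (Suc m) (K (Suc j) # K (Suc (Suc j)) # zs)"
        unfolding e1[symmetric] by (rule less) (simp add: 3)
      then show ?thesis unfolding s1 e3 gr if_not_P[OF False] using assms(1)[of j] by linarith
    qed
  qed
qed

lemma share_le: "share a b \<le> 9"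
  by (cases a; cases b) simp_all

lemma chain_map: "(\<And>i. K (Suc i) \<in> set (succs (K i))) \<Longrightarrow> chain (K j) (map K [Suc j..<Suc (j + N)])"
proof (induction N arbitrary: j)
  case (Suc N)
  have "map K [Suc j..<Suc (j + Suc N)] = K (Suc j) # map K [Suc (Suc j)..<Suc (Suc j + N)]"
    by (simp add: upt_conv_Cons del: upt_Suc)
  then show ?case using Suc.prems Suc.IH[of "Suc j"] by (simp del: upt_Suc)
qed simp

section \<open>Curvature of reduced diagrams\<close>

text \<open>The link vertex with coordinate \<open>m\<close> at the end of an edge of kind \<open>k\<close>.\<close>

definition ltr :: "nat \<Rightarrow> kind \<Rightarrow> int \<Rightarrow> nat letter" where
  "ltr n k m = (if outward k then (nat (m mod int n), False) else (nat ((m - 3) mod int n), True))"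

text \<open>The change of coordinate from a dart of a triangle to the next one. For the relator with
  letters \<open>x_i\<close>, \<open>x_(i+3)\<close> and the inverse of \<open>x_(i+1)\<close> the
  coordinates are \<open>i\<close>, \<open>i + 3\<close> and \<open>i + 4\<close>.\<close>

fun shift :: "kind \<Rightarrow> int" where
  "shift Om = 3" | "shift IO = 1" | "shift Im = -4" | "shift Op = 5" | "shift Ip = -3" | "shift OI = -2"

definition face :: "nat \<Rightarrow> kind \<Rightarrow> int \<Rightarrow> nat word" where
  "face n k m = [ltr n k m, ltr n (nk k) (m + shift k), ltr n (nk (nk k)) (m + shift k + shift (nk k))]"

text \<open>The relators, their rotations and their inverses, sorted by the kind of the first
  dart.\<close>

definition H3_faces :: "nat \<Rightarrow> nat word set" where
  "H3_faces n = {face n k m |k m. True}"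

lemma ltr_eq_iff:
  assumes "n > 0"
  shows "ltr n k m = ltr n k' m' \<longleftrightarrow> outward k = outward k' \<and> int n dvd m - m'"
proof -
  have *: "nat (x mod int n) = nat (y mod int n) \<longleftrightarrow> int n dvd x - y" for x y
    using assms by (simp add: eq_nat_nat_iff mod_eq_dvd_iff)
  show ?thesis unfolding ltr_def by (auto simp: *)
qed

lemma inv_ltr: "outward k' \<noteq> outward k \<Longrightarrow> inv_letter (ltr n k m) = ltr n k' (if outward k then m + 3 else m - 3)"
  by (auto simp: ltr_def inv_letter_def)

lemma nk3 [simp]: "nk (nk (nk k)) = k"
  by (cases k) simp_all

lemma rotate_face: "rotate1 (face n k m) = face n (nk k) (m + shift k)"
proof -
  have "shift k + shift (nk k) + shift (nk (nk k)) = 0" by (cases k) simp_all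
  then have e: "m + shift k + shift (nk k) + shift (nk (nk k)) = m" by simp
  show ?thesis unfolding face_def nk3 e by simp
qed

text \<open>The inverse word starts with the inverse of the third letter, hence the mirror image of
  the third kind.\<close>

lemma inv_face: "\<exists>k' m'. inv_word (face n k m) = face n k' m'"
proof -
  let ?k = "mir (nk (nk k))" and ?m = "m + shift k + shift (nk k)"
  have "inv_word (face n k m) = face n ?k (if outward (nk (nk k)) then ?m + 3 else ?m - 3)"
    unfolding face_def inv_word_def
    by (cases k) (simp_all add: ltr_def inv_letter_def algebra_simps)
  then show ?thesis by blast
qed

lemma pres_eq_rotate1:
  assumes "pres_eq R w []"
  shows "pres_eq R (rotate1 w) []"
proof (cases w)
  case (Cons a v)
  have "pres_eq R ([inv_letter a, a] @ v @ [a]) ([] @ v @ [a])"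
    using pres_cancel[of R "[]" "inv_letter a" "v @ [a]"] by simp
  moreover have "pres_eq R ([inv_letter a] @ w @ [a]) ([inv_letter a] @ [] @ [a])"
    by (rule pres_eq_context[OF assms])
  moreover have "pres_eq R [inv_letter a, a] []"
    using pres_cancel[of R "[]" "inv_letter a" "[]"] by simp
  ultimately show ?thesis using Cons by (auto intro: pres_trans pres_sym)
qed (simp add: pres_refl)

lemma pres_eq_inv_word:
  assumes "pres_eq R w []"
  shows "pres_eq R (inv_word w) []"
proof -
  have "pres_eq R (inv_word w @ w) (inv_word w @ [])" by (rule pres_eq_append[OF pres_refl assms])
  then show ?thesis using pres_eq_inv_left[of R w] by (auto intro: pres_trans pres_sym)
qed

lemma pres_eq_face:
  assumes "n > 0"
  shows "pres_eq (H3_relators n) (face n k m) []"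
proof -
  let ?R = "H3_relators n"
  have Om: "pres_eq ?R (face n Om m) []" for m
  proof -
    define i where "i = nat (m mod int n)"
    have i: "i < n" "int i = m mod int n" using assms by (auto simp: i_def nat_less_iff)
    have "int ((i + 3) mod n) = (m + 3) mod int n" "int ((i + 1) mod n) = (m + 1) mod int n"
      unfolding zmod_int of_nat_add i(2) by (simp_all add: mod_simps)
    then have 1: "nat ((m + 3) mod int n) = (i + 3) mod n" "nat ((m + 1) mod int n) = (i + 1) mod n"
      by (metis nat_int)+
    have "face n Om m = [(i, False), ((i + 3) mod n, False), ((i + 1) mod n, True)]"
      unfolding face_def ltr_def using 1 by (simp add: i_def add.commute)
    then have "face n Om m \<in> set ?R" using i(1) by (auto simp: H3_relators_def)
    then show ?thesis using pres_rel[of "face n Om m" ?R "[]" "[]"] by simp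
  qed
  have rot: "pres_eq ?R (face n (nk k) m) []" if "\<And>m. pres_eq ?R (face n k m) []" for k m
    using pres_eq_rotate1[OF that[of "m - shift k"]] by (simp add: rotate_face)
  have IO: "pres_eq ?R (face n IO m) []" for m using rot[OF Om, of m] by simp
  have Im: "pres_eq ?R (face n Im m) []" for m using rot[OF IO, of m] by simp
  have Op: "pres_eq ?R (face n Op m) []" for m
  proof -
    have "inv_word (face n Om (m - 1)) = face n Op m"
      by (simp add: face_def inv_word_def ltr_def inv_letter_def)
    then show ?thesis using pres_eq_inv_word[OF Om[of "m - 1"]] by simp
  qed
  have Ip: "pres_eq ?R (face n Ip m) []" for m using rot[OF Op, of m] by simp
  have OI: "pres_eq ?R (face n OI m) []" for m using rot[OF Ip, of m] by simp
  show ?thesis using Om IO Im Op Ip OI by (cases k) auto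
qed

lemma triangular_H3:
  assumes "n > 0"
  shows "triangular {0..<n} (H3_relators n) (H3_faces n)"
  unfolding triangular_def
proof (intro conjI ballI)
  show "set (H3_relators n) \<subseteq> H3_faces n"
  proof
    fix r assume "r \<in> set (H3_relators n)"
    then obtain i where i: "i < n" "r = [(i, False), ((i + 3) mod n, False), ((i + 1) mod n, True)]"
      by (auto simp: H3_relators_def)
    have "nat ((int i + 3) mod int n) = (i + 3) mod n" "nat ((int i + 1) mod int n) = (i + 1) mod n" "nat (int i mod int n) = i"
      using i(1) by (simp_all add: nat_eq_iff zmod_int add.commute)
    then have "r = face n Om (int i)" unfolding i(2) face_def ltr_def by (simp add: add.commute)
    then show "r \<in> H3_faces n" unfolding H3_faces_def by blast
  qed
next
  fix t assume "t \<in> H3_faces n"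
  then obtain k m where t: "t = face n k m" unfolding H3_faces_def by blast
  show "length t = 3" by (simp add: t face_def)
  have "fst (ltr n k m) < n" for k m using assms by (simp add: ltr_def nat_less_iff)
  then show "t \<in> words_over {0..<n}" unfolding t face_def words_over_def by simp
  show "pres_eq (H3_relators n) t []" unfolding t by (rule pres_eq_face[OF assms])
  show "rotate1 t \<in> H3_faces n" unfolding t rotate_face H3_faces_def by blast
  show "inv_word t \<in> H3_faces n" unfolding t H3_faces_def using inv_face[of n k m] by blast
qed

text \<open>Comparing two letters amounts to divisibility by \<open>n\<close> of a nonzero
  difference of coordinates that is smaller than 11.\<close>

lemma face_letters_distinct:
  assumes "n \<ge> 11" "[x, y, z] \<in> H3_faces n"
  shows "y \<noteq> x \<and> y \<noteq> inv_letter x"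
proof -
  obtain k m where xy: "x = ltr n k m" "y = ltr n (nk k) (m + shift k)"
    using assms(2) unfolding H3_faces_def face_def by auto
  have n: "n > 0" using assms(1) by simp
  have nd: "\<not> int n dvd s" if "s \<noteq> 0" "\<bar>s\<bar> < 11" for s
    using that assms(1) zdvd_imp_le[of "int n" "\<bar>s\<bar>"] by auto
  have "y \<noteq> x" unfolding xy ltr_eq_iff[OF n] by (cases k) (auto simp: nd)
  moreover have "y \<noteq> inv_letter x"
  proof (cases "outward (nk k) = outward k")
    case True
    then show ?thesis unfolding xy by (auto simp: ltr_def inv_letter_def)
  next
    case False
    show ?thesis unfolding xy inv_ltr[OF False] ltr_eq_iff[OF n] using False assms(1) by (cases k) (auto simp: nd)
  qed
  ultimately show ?thesis by simp
qed

text \<open>The signs of the three letters of a triangle, read from a given dart, determine its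
  kind: the six nonconstant patterns belong to the six kinds.\<close>

definition kof :: "bool \<Rightarrow> bool \<Rightarrow> bool \<Rightarrow> kind" where
  "kof a b c = (if a then if b then Ip else if c then OI else Im else if b then if c then Op else IO else Om)"

lemma kof_outward: "kof (\<not> outward k) (\<not> outward (nk k)) (\<not> outward (nk (nk k))) = k"
  by (cases k) (simp_all add: kof_def)

lemma snd_ltr [simp]: "snd (ltr n k m) = (\<not> outward k)"
  by (simp add: ltr_def)

text \<open>The possible kinds of three consecutive link edges at a vertex of degree five.\<close>

definition F5 :: "kind \<Rightarrow> kind \<Rightarrow> kind \<Rightarrow> bool" where
  "F5 a b c \<longleftrightarrow> (a, b, c) \<in> (\<lambda>ks. (ks ! 0, ks ! 1, ks ! 2)) ` set five_words"

lemma F5_code: "F5 a b c \<longleftrightarrow> (a, b, c) \<in> {(Op, Op, OI), (Op, OI, Im), (OI, Im, IO), (Im, IO, Op), (IO, Op, Op),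
    (Om, Om, OI), (Om, OI, Ip), (OI, Ip, IO), (Ip, IO, Om), (IO, Om, Om)}"
  unfolding F5_def five_words_def by simp

text \<open>Here \<open>i\<close> and \<open>j\<close> are the kinds of two consecutive edges at a
  vertex, seen from their far ends, and \<open>y\<close> is the kind of the third edge of the
  triangle between them, seen from outside. The two \<open>F5\<close> facts are what
  \<open>adjacent_fives\<close> supplies if both far ends have degree five.\<close>

lemma excl_F5: "excl k (nk i) (nk j) \<Longrightarrow> F5 y i (nk k) \<Longrightarrow> F5 j (nk (nk i)) (nk y) \<Longrightarrow> False"
  unfolding F5_code by (cases k; cases i; cases j; simp)

lemma sum_list_upt: "sum_list (map f [1..<Suc N]) = (\<Sum>j<N. f (Suc j))"
  by (induction N) simp_all

lemma five_words_rotate: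
  assumes "[a, b, c, d, e] \<in> set five_words"
  defines "W \<equiv> {[Op, Op, OI, Im, IO], [Om, Om, OI, Ip, IO]}"
  shows "[a, b, c, d, e] \<in> W \<or> [b, c, d, e, a] \<in> W \<or> [c, d, e, a, b] \<in> W \<or> [d, e, a, b, c] \<in> W \<or> [e, a, b, c, d] \<in> W"
  using assms(1) unfolding W_def five_words_def by (simp only: list.set insert_iff empty_iff list.inject) (elim disjE conjE; simp)

section \<open>Links of the interior vertices of a reduced diagram\<close>

locale h3_diagram =
  fixes n :: nat and D :: "nat set" and p al :: "nat \<Rightarrow> nat" and lab :: "nat \<Rightarrow> nat letter" and src :: "nat \<Rightarrow> nat word"
    and bs :: "nat list" and w :: "nat word"
  assumes n: "n \<ge> 11" "n \<noteq> 12" "n \<noteq> 14"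
    and dg: "diagram {0..<n} (H3_relators n) (H3_faces n) D p al lab src bs w"
    and red: "\<And>d. d \<in> D \<Longrightarrow> d \<notin> set bs \<Longrightarrow> al d \<notin> set bs \<Longrightarrow> \<not> mirrored p al lab d"
begin

lemmas dgD = diagramD[OF dg]
lemmas L = dgD(1)
lemmas P = planar_mapD[OF lmapD(1)[OF L]]

definition inner :: "nat \<Rightarrow> bool" where "inner d \<longleftrightarrow> d \<in> D \<and> d \<notin> set bs"

definition rot :: "nat \<Rightarrow> nat" where "rot = p \<circ> al"

definition kd :: "nat \<Rightarrow> kind" where "kd d = kof (snd (lab d)) (snd (lab (p d))) (snd (lab (p (p d))))"

definition orb :: "nat \<Rightarrow> nat set" where "orb x = conn (gr D rot) `` {x}"

definition interior :: "nat \<Rightarrow> bool" where "interior x \<longleftrightarrow> x \<in> D \<and> orb x \<inter> set bs = {}"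

definition five :: "nat \<Rightarrow> bool" where "five x \<longleftrightarrow> interior x \<and> card (orb x) = 5"

lemma n0: "n > 0" using n by simp

lemma rot_bij: "bij_betw rot D D" unfolding rot_def by (rule P(8))

lemma inner_p: "inner d \<Longrightarrow> inner (p d)"
  unfolding inner_def using diagram_face[OF dg] by blast

lemma inner_p3: "inner d \<Longrightarrow> p (p (p d)) = d"
  unfolding inner_def using dgD(7) by blast

lemma p_inner: "d \<in> D \<Longrightarrow> inner (p d) \<Longrightarrow> inner d"
  unfolding inner_def using cyc_in[OF dgD(4)] by blast

lemma face_ex:
  assumes "inner d"
  shows "\<exists>m. lab d = ltr n (kd d) m \<and> lab (p d) = ltr n (nk (kd d)) (m + shift (kd d)) \<and>
    lab (p (p d)) = ltr n (nk (nk (kd d))) (m + shift (kd d) + shift (nk (kd d)))"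
proof -
  have "[lab d, lab (p d), lab (p (p d))] \<in> H3_faces n" using dgD(8) assms unfolding inner_def by blast
  then obtain k m where e: "lab d = ltr n k m" "lab (p d) = ltr n (nk k) (m + shift k)"
    "lab (p (p d)) = ltr n (nk (nk k)) (m + shift k + shift (nk k))"
    unfolding H3_faces_def face_def by auto
  have "kd d = k" unfolding kd_def e snd_ltr by (rule kof_outward)
  then show ?thesis using e by blast
qed

lemma snd_lab: "inner d \<Longrightarrow> snd (lab d) = (\<not> outward (kd d))"
  using face_ex[of d] by auto

lemma kd_p: "inner d \<Longrightarrow> kd (p d) = nk (kd d)"
  using face_ex[of d] inner_p3[of d] kof_outward[of "nk (kd d)"] unfolding kd_def[of "p d"] by auto

lemma lab_p: "inner d \<Longrightarrow> lab d = ltr n (kd d) m \<Longrightarrow> lab (p d) = ltr n (nk (kd d)) (m + shift (kd d))"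
proof -
  assume "inner d" and m: "lab d = ltr n (kd d) m"
  then obtain m' where m': "lab d = ltr n (kd d) m'" "lab (p d) = ltr n (nk (kd d)) (m' + shift (kd d))" using face_ex by blast
  then have "int n dvd m' - m" using m ltr_eq_iff[OF n0] by metis
  then show ?thesis unfolding m'(2) ltr_eq_iff[OF n0] by simp
qed

text \<open>The labels of \<open>d\<close> and \<open>al d\<close> are inverse, which forces
  opposite orientations and fixes the coordinate; the offset 3 comes from the coordinate
  \<open>j + 3\<close> of \<open>I_j\<close>. If the kinds were mirror images, this coordinate would
  make all labels of the two triangles match, contrary to reducedness.\<close>

lemma edge:
  assumes "inner d" "inner (al d)"
  shows "outward (kd (al d)) \<noteq> outward (kd d)" "kd (al d) \<noteq> mir (kd d)"
    "lab d = ltr n (kd d) m \<Longrightarrow> lab (al d) = ltr n (kd (al d)) (if outward (kd d) then m + 3 else m - 3)"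
proof -
  have dD: "d \<in> D" "d \<notin> set bs" "al d \<notin> set bs" using assms unfolding inner_def by auto
  have inv: "lab (al d) = inv_letter (lab d)" using lmapD(4)[OF L dD(1)] .
  show o: "outward (kd (al d)) \<noteq> outward (kd d)"
    using snd_lab[OF assms(1)] snd_lab[OF assms(2)] inv by (simp add: inv_letter_def)
  show lab: "lab d = ltr n (kd d) m \<Longrightarrow> lab (al d) = ltr n (kd (al d)) (if outward (kd d) then m + 3 else m - 3)" for m
    unfolding inv using inv_ltr[OF o] by simp
  show "kd (al d) \<noteq> mir (kd d)"
  proof
    assume k: "kd (al d) = mir (kd d)"
    obtain m where m: "lab d = ltr n (kd d) m" using face_ex[OF assms(1)] by blast
    note m' = lab[OF m]
    have a1: "lab (p d) = ltr n (nk (kd d)) (m + shift (kd d))" by (rule lab_p[OF assms(1) m])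
    have a2: "lab (p (p d)) = ltr n (nk (nk (kd d))) (m + shift (kd d) + shift (nk (kd d)))"
      using lab_p[OF inner_p[OF assms(1)]] a1 kd_p[OF assms(1)] by simp
    let ?m = "if outward (kd d) then m + 3 else m - 3"
    have b1: "lab (p (al d)) = ltr n (nk (mir (kd d))) (?m + shift (mir (kd d)))"
      using lab_p[OF assms(2) m'] k by simp
    have b2: "lab (p (p (al d))) = ltr n (nk (nk (mir (kd d)))) (?m + shift (mir (kd d)) + shift (nk (mir (kd d))))"
      using lab_p[OF inner_p[OF assms(2)]] b1 kd_p[OF assms(2)] k by simp
    have "mirrored p al lab d" unfolding mirrored_def a1 a2 b1 b2
      by (cases "kd d") (simp_all add: ltr_def inv_letter_def add.commute)
    then show False using red[OF dD] by blast
  qed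
qed

text \<open>The corner between \<open>d\<close> and \<open>rot d\<close> lies in the triangle of
  \<open>al d\<close>, so \<open>kd (rot d)\<close> is the kind of the link edge from
  \<open>d\<close> to \<open>rot d\<close>. The mirror kind excluded by \<open>edge\<close> is the
  step straight back.\<close>

lemma step:
  assumes "inner d" "inner (al d)"
  shows "kd (rot d) = nk (kd (al d))" "kd (rot d) \<in> set (succs (kd d))"
    "lab d = ltr n (kd d) m \<Longrightarrow> lab (rot d) = ltr n (kd (rot d)) (m + disp (kd (rot d)))"
proof -
  show a: "kd (rot d) = nk (kd (al d))" unfolding rot_def using kd_p[OF assms(2)] by simp
  show "kd (rot d) \<in> set (succs (kd d))" unfolding a using edge(1,2)[OF assms] by (cases "kd d"; cases "kd (al d)") simp_all
  assume m: "lab d = ltr n (kd d) m"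
  have "lab (rot d) = ltr n (nk (kd (al d))) ((if outward (kd d) then m + 3 else m - 3) + shift (kd (al d)))"
    unfolding rot_def using lab_p[OF assms(2) edge(3)[OF assms m]] by simp
  also have "\<dots> = ltr n (kd (rot d)) (m + disp (kd (rot d)))"
    unfolding a using edge(1)[OF assms] by (cases "kd d"; cases "kd (al d)") (simp_all add: add.commute)
  finally show "lab (rot d) = ltr n (kd (rot d)) (m + disp (kd (rot d)))" .
qed

lemma orb_self: "x \<in> orb x" unfolding orb_def by simp

lemma orb_eq: "y \<in> orb x \<Longrightarrow> orb y = orb x"
  unfolding orb_def using conn_class_eq[of "gr D rot" x y] by simp

lemma orb_subset: "x \<in> D \<Longrightarrow> orb x \<subseteq> D"
  unfolding orb_def by (rule class_subset[OF rot_bij])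

lemma rot_orb: "x \<in> D \<Longrightarrow> rot x \<in> orb x"
  unfolding orb_def by (auto intro: conn_base simp: gr_iff)

lemma funpow_orb: "x \<in> D \<Longrightarrow> (rot ^^ i) x \<in> orb x"
  unfolding orb_def using funpow_conn[OF rot_bij] by blast

lemma interior_orb: "interior x \<Longrightarrow> y \<in> orb x \<Longrightarrow> interior y"
  unfolding interior_def using orb_eq orb_subset by blast

lemma five_orb: "five x \<Longrightarrow> y \<in> orb x \<Longrightarrow> five y"
  unfolding five_def using interior_orb orb_eq by metis

lemma interior_inner: "interior x \<Longrightarrow> inner x"
  unfolding interior_def inner_def using orb_self by blast

lemma interior_D: "interior x \<Longrightarrow> x \<in> D"
  by (simp add: interior_def)

lemma interior_rot: "interior x \<Longrightarrow> interior (rot x)"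
  using interior_orb rot_orb interior_D by blast

lemma interior_funpow: "interior x \<Longrightarrow> interior ((rot ^^ i) x)"
  using interior_orb funpow_orb interior_D by blast

lemma five_rot: "five x \<Longrightarrow> five (rot x)"
  using five_orb rot_orb unfolding five_def interior_def by blast

lemma interior_al: "interior x \<Longrightarrow> inner (al x)"
  using interior_inner[OF interior_rot, of x] p_inner[of "al x"] P(3) interior_D[of x] unfolding rot_def by simp

lemma al_al: "x \<in> D \<Longrightarrow> al (al x) = x" by (rule P(4))

lemma rot_al: "x \<in> D \<Longrightarrow> rot (al x) = p x" unfolding rot_def using al_al by simp

lemma periodic: "x \<in> D \<Longrightarrow> (rot ^^ (i + card (orb x))) x = (rot ^^ i) x"
  using orbit_enum(2)[OF P(1) rot_bij, of x] unfolding orb_def by (simp add: funpow_add)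

lemma walk:
  assumes "interior x" "lab x = ltr n (kd x) m"
  shows "lab ((rot ^^ i) x) = ltr n (kd ((rot ^^ i) x)) (m + (\<Sum>j<i. disp (kd ((rot ^^ Suc j) x))))"
proof (induction i)
  case 0 then show ?case using assms by simp
next
  case (Suc i)
  have "interior ((rot ^^ i) x)" using interior_funpow[OF assms(1)] .
  from step(3)[OF interior_inner[OF this] interior_al[OF this] Suc]
  show ?case by (simp add: add.assoc)
qed

text \<open>One turn around the vertex leads back to the same link vertex, so the displacement is a
  multiple of \<open>n\<close>. In ten steps it is at most 20 in absolute value, hence 0 or
  \<open>n\<close> up to sign.\<close>

lemma interior_good_word:
  assumes "interior x" "card (orb x) \<le> 10"
  shows "good_word (map (\<lambda>i. kd ((rot ^^ i) x)) [1..<Suc (card (orb x))])"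
proof -
  let ?K = "\<lambda>i. kd ((rot ^^ i) x)" and ?N = "card (orb x)"
  let ?ks = "map ?K [1..<Suc ?N]"
  have xD: "x \<in> D" using assms(1) interior_D by simp
  have N0: "?N > 0" using orbit_enum(3)[OF P(1) rot_bij xD] unfolding orb_def .
  have per: "(rot ^^ ?N) x = x" using periodic[OF xD, of 0] by simp
  obtain m where m: "lab x = ltr n (kd x) m" using face_ex[OF interior_inner[OF assms(1)]] by blast
  have s: "sum_list (map disp ?ks) = (\<Sum>j<?N. disp (?K (Suc j)))"
    using sum_list_upt[of "\<lambda>i. disp (?K i)" ?N] by (simp add: comp_def del: upt_Suc)
  have dvd: "int n dvd (\<Sum>j<?N. disp (?K (Suc j)))"
  proof -
    have "ltr n (kd x) m = ltr n (kd x) (m + (\<Sum>j<?N. disp (?K (Suc j))))"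
      using walk[OF assms(1) m, of ?N] m per by simp
    then have "int n dvd m - (m + (\<Sum>j<?N. disp (?K (Suc j))))" using ltr_eq_iff[OF n0] by blast
    then show ?thesis by simp
  qed
  have ab: "\<bar>\<Sum>j<?N. disp (?K (Suc j))\<bar> \<le> 20"
  proof -
    have "\<bar>disp k\<bar> \<le> 2" for k by (cases k) simp_all
    then have "\<bar>\<Sum>j<?N. disp (?K (Suc j))\<bar> \<le> (\<Sum>j<?N. 2)"
      by (intro order_trans[OF sum_abs] sum_mono)
    then show ?thesis using assms(2) by simp
  qed
  have gd: "good_disp (sum_list (map disp ?ks))"
  proof -
    obtain q where q: "(\<Sum>j<?N. disp (?K (Suc j))) = int n * q" using dvd by blast
    have "\<bar>q\<bar> < 2"
    proof (rule ccontr)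
      assume "\<not> \<bar>q\<bar> < 2"
      then have "int n * 2 \<le> int n * \<bar>q\<bar>" by (intro mult_left_mono) auto
      moreover have "int n * \<bar>q\<bar> \<le> 20" using ab unfolding q abs_mult by simp
      ultimately show False using n(1) by linarith
    qed
    then consider "q = 0" | "q = 1" | "q = -1" by fastforce
    then show ?thesis unfolding s q good_disp_def using n by cases auto
  qed
  have "chain (?K 0) (map ?K [Suc 0..<Suc (0 + ?N)])"
  proof (rule chain_map)
    fix i
    have "interior ((rot ^^ i) x)" using interior_funpow[OF assms(1)] .
    from step(2)[OF interior_inner[OF this] interior_al[OF this]]
    show "?K (Suc i) \<in> set (succs (?K i))" by simp
  qed
  moreover have "last ?ks = ?K 0" using N0 per by (simp add: last_map)
  ultimately have "chain (last ?ks) ?ks" by simp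
  then show ?thesis using good_word_closed[of ?ks] gd assms(2) N0 by simp
qed

lemma interior_small:
  assumes "interior x" "card (orb x) < 8"
  shows "card (orb x) = 5"
proof -
  have "good_word (map (\<lambda>i. kd ((rot ^^ i) x)) [1..<Suc (card (orb x))])"
    using interior_good_word assms by simp
  then have "map (\<lambda>i. kd ((rot ^^ i) x)) [1..<Suc (card (orb x))] \<in> set five_words"
    unfolding good_word_def Let_def length_map using assms(2) by (simp del: upt_Suc)
  moreover have "\<forall>ks\<in>set five_words. length ks = 5" unfolding five_words_def by simp
  ultimately have "length (map (\<lambda>i. kd ((rot ^^ i) x)) [1..<Suc (card (orb x))]) = 5" by blast
  then show ?thesis by (simp del: upt_Suc)
qed

lemma five_word:
  assumes "five x"
  shows "[kd x, kd (rot x), kd (rot (rot x)), kd (rot (rot (rot x))), kd (rot (rot (rot (rot x))))] \<in> set five_words"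
    and "rot (rot (rot (rot (rot x)))) = x"
proof -
  have 1: "map (\<lambda>i. kd ((rot ^^ i) y)) [1..<6] \<in> set five_words" if "five y" for y
    using interior_good_word[of y] that unfolding five_def good_word_def by (simp add: Let_def)
  have e: "[1..<6] = [Suc 0, Suc (Suc 0), Suc (Suc (Suc 0)), Suc (Suc (Suc (Suc 0))), Suc (Suc (Suc (Suc (Suc 0))))]"
    by (simp add: upt_rec)
  have 2: "rot (rot (rot (rot (rot y)))) = y" if "five y" for y
    using periodic[of y 0] that unfolding five_def interior_def by (simp add: numeral_eq_Suc)
  show "rot (rot (rot (rot (rot x)))) = x" using 2[OF assms] .
  \<comment> \<open>The words are read from the first step onwards, so the one that begins with
    \<open>kd x\<close> belongs to the dart before \<open>x\<close>.\<close>
  let ?y = "rot (rot (rot (rot x)))"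
  have "five ?y" using assms five_rot by blast
  from 1[OF this] show "[kd x, kd (rot x), kd (rot (rot x)), kd (rot (rot (rot x))), kd (rot (rot (rot (rot x))))] \<in> set five_words"
    unfolding e using 2[OF assms] by simp
qed

lemma five_triple: "five x \<Longrightarrow> F5 (kd x) (kd (rot x)) (kd (rot (rot x)))"
  unfolding F5_def using five_word(1)[of x] by force

text \<open>The triangle at the corner \<open>rot e\<close> joins the vertex of \<open>e\<close> to the far ends of the edges \<open>e\<close> and \<open>rot e\<close>;
  its third edge \<open>p (rot e)\<close> is seen by both of these ends.\<close>

lemma adjacent_fives:
  assumes e: "e \<in> D" and f: "five (al e)" "five (al (rot e))"
  shows "\<exists>y. F5 y (kd (al e)) (nk (kd e)) \<and> F5 (kd (al (rot e))) (nk (kd (rot e))) (nk y)"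
proof -
  have sgD: "rot y \<in> D" if "y \<in> D" for y using that rot_bij by (auto simp: bij_betw_def)
  have ae: "inner (al e)" using f(1) interior_inner unfolding five_def by blast
  have "inner (p e)" using interior_inner[OF interior_rot, of "al e"] f(1) rot_al[OF e] unfolding five_def by simp
  then have ie: "inner e" using p_inner e by blast
  have sge: "rot e = p (al e)" by (simp add: rot_def)
  have ise: "inner (rot e)" unfolding sge by (rule inner_p[OF ae])
  let ?h = "p (rot e)"
  have ih: "inner ?h" by (rule inner_p[OF ise])
  have hD: "?h \<in> D" using ih by (simp add: inner_def)
  have ph: "p ?h = al e" unfolding sge using inner_p3[OF ae] .
  have sah: "rot (al ?h) = al e" using rot_al[OF hD] ph by simp
  have ahD: "al ?h \<in> D" using P(3) hD by simp
  have fah: "five (al ?h)"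
  proof -
    have "al e \<in> orb (al ?h)" using rot_orb[OF ahD] sah by simp
    then have "al ?h \<in> orb (al e)" using orb_eq orb_self by metis
    then show ?thesis using five_orb[OF f(1)] by blast
  qed
  have iah: "inner (al ?h)" using fah interior_inner unfolding five_def by blast
  have "F5 (kd (al ?h)) (kd (al e)) (kd (p e))" using five_triple[OF fah] sah rot_al[OF e] by simp
  then have 1: "F5 (kd (al ?h)) (kd (al e)) (nk (kd e))" using kd_p[OF ie] by simp
  have "rot (al (rot e)) = ?h" using rot_al[OF sgD[OF e]] .
  moreover have "rot ?h = p (al ?h)" by (simp add: rot_def)
  ultimately have "F5 (kd (al (rot e))) (kd ?h) (kd (p (al ?h)))" using five_triple[OF f(2)] by simp
  then have 2: "F5 (kd (al (rot e))) (nk (kd (rot e))) (nk (kd (al ?h)))" using kd_p[OF ise] kd_p[OF iah] by simp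
  show ?thesis using 1 2 by blast
qed

section \<open>Charge received and given at interior vertices\<close>

definition received :: "nat \<Rightarrow> nat" where
  "received e = (if five (al e) \<and> \<not> five e \<and> e \<notin> set bs then share (kd e) (kd (rot e)) else 0)"

lemma sum_orb: "x \<in> D \<Longrightarrow> sum h (orb x) = (\<Sum>i<card (orb x). h ((rot ^^ i) x))"
  using sum.reindex_bij_betw[OF orbit_enum(1)[OF P(1) rot_bij], of x h] unfolding orb_def by simp

lemma sum_shift:
  fixes r :: "nat \<Rightarrow> nat"
  assumes "\<And>i. r (i + N) = r i"
  shows "(\<Sum>i<N. r (j + i)) = (\<Sum>i<N. r i)"
proof (induction j)
  case (Suc j)
  have "(\<Sum>i<N. r (Suc j + i)) + r j = (\<Sum>i<Suc N. r (j + i))" by (subst sum.lessThan_Suc_shift) simp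
  also have "\<dots> = (\<Sum>i<N. r (j + i)) + r j" using assms[of j] by simp
  finally show ?case using Suc by simp
qed simp

lemma receive_bound:
  assumes x: "x \<in> D" "orb x \<inter> set bs = {}" "card (orb x) \<noteq> 5"
  shows "card (orb x) + 11 * sum received (orb x) + 1320 \<le> 220 * card (orb x)"
proof (cases "card (orb x) \<le> 10")
  \<comment> \<open>With \<open>N\<close> darts the crude bound leaves \<open>11 * N - 120\<close>,
    which is at least one eleventh of \<open>N\<close> exactly from \<open>N = 11\<close>
    on.\<close>
  case False
  have "sum received (orb x) \<le> (\<Sum>y\<in>orb x. 9)"
    by (rule sum_mono) (simp add: received_def share_le)
  then show ?thesis using False by simp
next
  case True
  have int: "interior x" using x by (simp add: interior_def)
  let ?K = "\<lambda>i. kd ((rot ^^ i) x)" and ?N = "card (orb x)" and ?r = "\<lambda>i. received ((rot ^^ i) x)"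
  have N: "\<not> ?N < 8" using interior_small[OF int] x(3) by blast
  have per: "(rot ^^ (i + ?N)) x = (rot ^^ i) x" for i by (rule periodic[OF x(1)])
  have r1: "?r i \<le> share (?K i) (?K (Suc i))" for i by (simp add: received_def)
  have r2: "?r i = 0 \<or> ?r (Suc i) = 0" if ex: "excl (?K i) (?K (Suc i)) (?K (Suc (Suc i)))" for i
  proof (rule ccontr)
    assume "\<not> (?r i = 0 \<or> ?r (Suc i) = 0)"
    then have f: "five (al ((rot ^^ i) x))" "five (al (rot ((rot ^^ i) x)))" by (auto simp: received_def split: if_splits)
    let ?e = "(rot ^^ i) x"
    have ie: "interior ?e" "interior (rot ?e)" using interior_funpow[OF int, of i] interior_funpow[OF int, of "Suc i"] by simp_all
    have k: "kd (rot ?e) = nk (kd (al ?e))" "kd (rot (rot ?e)) = nk (kd (al (rot ?e)))"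
      using step(1)[OF interior_inner interior_al] ie by blast+
    obtain y where y: "F5 y (kd (al ?e)) (nk (kd ?e))" "F5 (kd (al (rot ?e))) (nk (kd (rot ?e))) (nk y)"
      using adjacent_fives[OF interior_D[OF ie(1)] f] by blast
    show False using excl_F5[of "kd ?e" "kd (al ?e)" "kd (al (rot ?e))" y] ex y k by simp
  qed
  have g: "(\<Sum>i<?N. ?r (j + i)) \<le> greedy ?N (map ?K [j..<Suc (j + ?N)])" for j
    by (rule greedy_bound[of ?r ?K]) (use r1 r2 in auto)
  have s: "(\<Sum>i<?N. ?r (j + i)) = sum received (orb x)" for j
    using sum_shift[of ?r ?N j] per sum_orb[OF x(1), of received] by simp
  let ?ks = "map ?K [1..<Suc ?N]"
  \<comment> \<open>The cyclic word unrolled from its first and from its second letter, the two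
    starting points compared in \<open>good_word\<close>.\<close>
  have w1: "map ?K [1..<Suc (1 + ?N)] = ?ks @ [hd ?ks]"
    using per[of 1] N by (simp add: hd_map upt_rec[of 1])
  have ks2: "?ks = ?K 1 # ?K 2 # map ?K [3..<Suc ?N]" using N by (simp add: upt_conv_Cons numeral_eq_Suc)
  have w2: "map ?K [2..<Suc (2 + ?N)] = tl ?ks @ [hd ?ks, hd (tl ?ks)]"
  proof -
    have "[2..<Suc (2 + ?N)] = [2..<Suc ?N] @ [?N + 1, ?N + 2]" using N by simp
    moreover have "map ?K [2..<Suc ?N] = tl ?ks" by (simp add: map_tl[symmetric] numeral_eq_Suc)
    moreover have "?K (?N + 1) = hd ?ks" "?K (?N + 2) = hd (tl ?ks)"
      unfolding ks2 using per[of 1] per[of 2] by (simp_all add: add.commute)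
    ultimately show ?thesis by simp
  qed
  have "good_word ?ks" by (rule interior_good_word[OF int True])
  then have "min (greedy ?N (?ks @ [hd ?ks])) (greedy ?N (tl ?ks @ [hd ?ks, hd (tl ?ks)])) + 121 \<le> 20 * ?N"
    unfolding good_word_def Let_def using N by (simp del: upt_Suc)
  then have "sum received (orb x) + 121 \<le> 20 * ?N"
    using g[of 1] g[of 2] unfolding s w1 w2 by linarith
  \<comment> \<open>The surplus of \<open>121\<close> over \<open>120\<close> is one unit, enough
    for one eleventh per dart as there are at most ten.\<close>
  then show ?thesis using True by linarith
qed

text \<open>One neighbour cannot have degree five, since its link would contain a triple outside
  \<open>F5\<close>; it takes 9. Of the other four, consecutive ones in two pairs cannot both have
  degree five, so one of each pair takes its share, 8 and 3. In total this is
  \<open>9 + 8 + 3 = 20\<close>, the curvature of a vertex of degree five.\<close>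

lemma give_bound:
  assumes x: "five x"
  shows "20 \<le> (\<Sum>y\<in>orb x. received (al y))"
proof -
  have "\<exists>z\<in>orb x. [kd z, kd (rot z), kd (rot (rot z)), kd (rot (rot (rot z))), kd (rot (rot (rot (rot z))))]
      \<in> {[Op, Op, OI, Im, IO], [Om, Om, OI, Ip, IO]}"
  proof -
    have xD: "x \<in> D" using x interior_D unfolding five_def by blast
    have o: "x \<in> orb x" "rot x \<in> orb x" "rot (rot x) \<in> orb x" "rot (rot (rot x)) \<in> orb x" "rot (rot (rot (rot x))) \<in> orb x"
      using funpow_orb[OF xD, of 0] funpow_orb[OF xD, of 1] funpow_orb[OF xD, of 2] funpow_orb[OF xD, of 3] funpow_orb[OF xD, of 4]
      by (simp_all add: numeral_eq_Suc)
    have 5: "rot (rot (rot (rot (rot x)))) = x" by (rule five_word(2)[OF x])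
    define Q where "Q z \<longleftrightarrow> [kd z, kd (rot z), kd (rot (rot z)), kd (rot (rot (rot z))), kd (rot (rot (rot (rot z))))]
      \<in> {[Op, Op, OI, Im, IO], [Om, Om, OI, Ip, IO]}" for z
    have "Q x \<or> Q (rot x) \<or> Q (rot (rot x)) \<or> Q (rot (rot (rot x))) \<or> Q (rot (rot (rot (rot x))))"
      unfolding Q_def 5 by (rule five_words_rotate[OF five_word(1)[OF x]])
    then have "\<exists>z\<in>orb x. Q z" using o by blast
    then show ?thesis unfolding Q_def .
  qed
  then obtain z where z: "z \<in> orb x" and
    kz: "[kd z, kd (rot z), kd (rot (rot z)), kd (rot (rot (rot z))), kd (rot (rot (rot (rot z))))]
      \<in> {[Op, Op, OI, Im, IO], [Om, Om, OI, Ip, IO]}" by blast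
  have fz: "five z" by (rule five_orb[OF x z])
  have zD: "z \<in> D" using fz interior_D unfolding five_def by blast
  define z1 z2 z3 z4 where zs: "z1 = rot z" "z2 = rot z1" "z3 = rot z2" "z4 = rot z3"
  have f: "five z1" "five z2" "five z3" "five z4" using fz five_rot zs by auto
  have z5: "rot z4 = z" using five_word(2)[OF fz] zs by simp
  have "(\<Sum>y\<in>orb x. received (al y)) = (\<Sum>i<5. received (al ((rot ^^ i) z)))"
    using sum_orb[OF zD, of "\<lambda>y. received (al y)"] orb_eq[OF z] fz unfolding five_def by simp
  also have "\<dots> = received (al z) + received (al z1) + received (al z2) + received (al z3) + received (al z4)"
    by (simp add: zs numeral_eq_Suc)
  finally have sum: "(\<Sum>y\<in>orb x. received (al y)) = received (al z) + received (al z1) + received (al z2) + received (al z3) + received (al z4)" .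
  have give: "received (al y) = (if five (al y) then 0 else share (kd (al y)) (nk (kd y)))" if "five y" for y
  proof -
    have y: "interior y" using that by (simp add: five_def)
    then show ?thesis using that interior_al[OF y] al_al[OF interior_D[OF y]] rot_al[OF interior_D[OF y]] kd_p[OF interior_inner[OF y]]
      unfolding received_def inner_def by simp
  qed
  have kal: "kd (al y) = nk (nk (kd (rot y)))" if "five y" for y
    using step(1)[OF interior_inner interior_al, of y] that unfolding five_def by simp
  note kals = kal[OF fz, folded zs(1)] kal[OF f(1), folded zs(2)] kal[OF f(2), folded zs(3)] kal[OF f(3), folded zs(4)]
    kal[OF f(4), unfolded z5]
  have fal: "F5 (kd (al y)) (nk (kd y)) (kd (rot (p y)))" if "five y" "five (al y)" for y
  proof -
    have y: "interior y" using that(1) by (simp add: five_def)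
    show ?thesis using five_triple[OF that(2)] rot_al[OF interior_D[OF y]] kd_p[OF interior_inner[OF y]] by simp
  qed
  have adj: "\<exists>y. F5 y (kd (al e)) (nk (kd e)) \<and> F5 (kd (al (rot e))) (nk (kd (rot e))) (nk y)"
    if "five e" "five (al e)" "five (al (rot e))" for e
    using adjacent_fives[OF _ that(2,3)] that(1) interior_D unfolding five_def by blast
  note sums = give[OF fz] give[OF f(1)] give[OF f(2)] give[OF f(3)] give[OF f(4)]
  from kz consider "kd z = Op" "kd z1 = Op" "kd z2 = OI" "kd z3 = Im" "kd z4 = IO"
    | "kd z = Om" "kd z1 = Om" "kd z2 = OI" "kd z3 = Ip" "kd z4 = IO" unfolding zs by auto
  then show ?thesis
  proof cases
    case 1
    have k: "kd (al z) = OI" "kd (al z1) = Ip" "kd (al z2) = IO" "kd (al z3) = Om" "kd (al z4) = OI"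
      unfolding kals 1 by simp_all
    have "\<not> five (al z1)" using fal[OF f(1)] k 1 unfolding F5_code by auto
    moreover have "\<not> (five (al z2) \<and> five (al z3))"
      using adj[OF f(2)] k 1 unfolding F5_code zs(3)[symmetric] by auto
    moreover have "\<not> (five (al z4) \<and> five (al z))"
      using adj[OF f(4)] k 1 unfolding F5_code z5 by auto
    ultimately show ?thesis unfolding sum sums using k 1 by auto
  next
    case 2
    have k: "kd (al z) = Im" "kd (al z1) = Ip" "kd (al z2) = Op" "kd (al z3) = Om" "kd (al z4) = Im"
      unfolding kals 2 by simp_all
    have "\<not> five (al z4)" using fal[OF f(4)] k 2 unfolding F5_code by auto
    moreover have "\<not> (five (al z2) \<and> five (al z3))"
      using adj[OF f(2)] k 2 unfolding F5_code zs(3)[symmetric] by auto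
    moreover have "\<not> (five (al z) \<and> five (al z1))"
      using adj[OF fz] k 2 unfolding F5_code zs(1)[symmetric] by auto
    ultimately show ?thesis unfolding sum sums using k 2 by auto
  qed
qed

end

text \<open>The trapezoidal rule for \<open>f dg\<close> on one edge. The mean of the two values of
  \<open>f\<close> makes it change sign when the edge is reversed.\<close>

definition step_area :: "('g word \<Rightarrow> real) \<Rightarrow> ('g word \<Rightarrow> real) \<Rightarrow> 'g word \<Rightarrow> 'g letter \<Rightarrow> real" where
  "step_area f g u a = (f u + f (u @ [a])) / 2 * (g (u @ [a]) - g u)"

fun word_area :: "('g word \<Rightarrow> real) \<Rightarrow> ('g word \<Rightarrow> real) \<Rightarrow> 'g word \<Rightarrow> 'g word \<Rightarrow> real" where
  "word_area f g u [] = 0" |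
  "word_area f g u (a # w) = step_area f g u a + word_area f g (u @ [a]) w"

text \<open>Real functions on the group that are 1-Lipschitz along the edges of the Cayley graph,
  represented on words.\<close>

definition lip_word :: "'g set \<Rightarrow> 'g word list \<Rightarrow> ('g word \<Rightarrow> real) \<Rightarrow> bool" where
  "lip_word S R f \<longleftrightarrow> (\<forall>u v. pres_eq R u v \<longrightarrow> f u = f v) \<and>
    (\<forall>u a. u \<in> words_over S \<longrightarrow> fst a \<in> S \<longrightarrow> \<bar>f (u @ [a]) - f u\<bar> \<le> 1)"

text \<open>Around a closed triangle a constant may be subtracted from \<open>f\<close>. After
  subtracting \<open>a\<close> every trapezoid is a product of two factors of absolute value at most
  1.\<close>

lemma triangle_area:
  fixes a b c x y z :: real
  assumes "\<bar>b - a\<bar> \<le> 1" "\<bar>c - b\<bar> \<le> 1" "\<bar>a - c\<bar> \<le> 1" "\<bar>y - x\<bar> \<le> 1" "\<bar>z - y\<bar> \<le> 1" "\<bar>x - z\<bar> \<le> 1"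
  shows "\<bar>(a + b) / 2 * (y - x) + (b + c) / 2 * (z - y) + (c + a) / 2 * (x - z)\<bar> \<le> 3"
proof -
  have m: "\<bar>s * t\<bar> \<le> 1" if "\<bar>s\<bar> \<le> 1" "\<bar>t\<bar> \<le> 1" for s t :: real
    using mult_mono[of "\<bar>s\<bar>" 1 "\<bar>t\<bar>" 1] that by (simp add: abs_mult)
  have "\<bar>(b - a) / 2\<bar> \<le> 1" using assms unfolding abs_le_iff by (auto simp: field_simps)
  moreover have "\<bar>(b + c) / 2 - a\<bar> \<le> 1" using assms unfolding abs_le_iff by (auto simp: field_simps)
  moreover have "\<bar>(c - a) / 2\<bar> \<le> 1" using assms unfolding abs_le_iff by (auto simp: field_simps)
  ultimately have "\<bar>(b - a) / 2 * (y - x)\<bar> \<le> 1" "\<bar>((b + c) / 2 - a) * (z - y)\<bar> \<le> 1" "\<bar>(c - a) / 2 * (x - z)\<bar> \<le> 1"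
    using m assms by blast+
  moreover have "(a + b) / 2 * (y - x) + (b + c) / 2 * (z - y) + (c + a) / 2 * (x - z) =
      (b - a) / 2 * (y - x) + ((b + c) / 2 - a) * (z - y) + (c - a) / 2 * (x - z)" by (simp add: field_simps)
  ultimately show ?thesis by linarith
qed

context h3_diagram begin

text \<open>The boundary list is a single cycle. Every other face has three different darts:
  \<open>p (p (p d)) = d\<close> would also allow a fixed point, but neighbouring letters of a
  triangle differ.\<close>

lemma faces_bound: "3 * ncc D (gr D p) \<le> card (D - set bs) + 3"
proof -
  let ?o = "\<lambda>x. conn (gr D p) `` {x}"
  define Kf where "Kf = ?o ` D"
  define Kb where "Kb = {C \<in> Kf. C \<inter> set bs \<noteq> {}}"
  have fin: "finite Kf" unfolding Kf_def using P(1) by simp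
  have sub: "?o x \<subseteq> D" if "x \<in> D" for x by (rule class_subset[OF P(2) that])
  have "Kb \<subseteq> {?o (hd bs)}"
  proof
    fix C assume "C \<in> Kb"
    then obtain x y where xy: "C = ?o x" "y \<in> set bs" "(x, y) \<in> conn (gr D p)" unfolding Kb_def Kf_def by auto
    have "hd bs \<in> set bs" using xy(2) by (cases bs) auto
    then have "(y, hd bs) \<in> conn (gr D p)" using cyc_conn[OF dgD(4,3)] xy(2) by blast
    then have "(x, hd bs) \<in> conn (gr D p)" using xy(3) conn_trans by metis
    then show "C \<in> {?o (hd bs)}" unfolding xy(1) using conn_class_eq[of "gr D p" x "hd bs"] by simp
  qed
  then have b: "card Kb \<le> 1" using card_mono[of "{?o (hd bs)}" Kb] by simp
  have three: "3 \<le> card (C - set bs)" if C: "C \<in> Kf - Kb" for C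
  proof -
    obtain x where x: "x \<in> D" "C = ?o x" using C unfolding Kf_def by auto
    have disj: "C \<inter> set bs = {}" using C unfolding Kb_def by auto
    have xC: "x \<in> C" using x(2) by simp
    then have i0: "inner x" using x(1) disj unfolding inner_def by blast
    note i1 = inner_p[OF i0] note i2 = inner_p[OF i1]
    have xD: "x \<in> D" "p x \<in> D" using i0 i1 unfolding inner_def by auto
    have e: "(x, p x) \<in> conn (gr D p)" "(p x, p (p x)) \<in> conn (gr D p)"
      using xD by (auto intro!: conn_base simp: gr_iff)
    have e2: "(x, p (p x)) \<in> conn (gr D p)" using e conn_trans by metis
    have 1: "{x, p x, p (p x)} \<subseteq> C - set bs"
      using xC e(1) e2 x(2) disj by auto
    have "[lab x, lab (p x), lab (p (p x))] \<in> H3_faces n" "[lab (p x), lab (p (p x)), lab x] \<in> H3_faces n"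
      "[lab (p (p x)), lab x, lab (p x)] \<in> H3_faces n"
      using dgD(8)[of x] dgD(8)[of "p x"] dgD(8)[of "p (p x)"] i0 i1 i2 inner_p3[OF i0] unfolding inner_def by auto
    then have "lab (p x) \<noteq> lab x" "lab (p (p x)) \<noteq> lab (p x)" "lab x \<noteq> lab (p (p x))"
      using face_letters_distinct[OF n(1)] by blast+
    then have "p x \<noteq> x" "p (p x) \<noteq> p x" "x \<noteq> p (p x)" by metis+
    then have 2: "card {x, p x, p (p x)} = 3" by simp
    have "finite (C - set bs)" using sub[OF x(1)] x(2) finite_subset[OF _ P(1)] by auto
    from card_mono[OF this 1] show ?thesis unfolding 2 .
  qed
  have "card (D - set bs) = (\<Sum>C\<in>Kf. card (C - set bs))"
  proof -
    have h: "(\<Sum>x\<in>C. of_bool (x \<notin> set bs)) = card (C - set bs)" if "C \<subseteq> D" for C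
    proof -
      have "finite C" using that P(1) finite_subset by blast
      then have "(\<Sum>x\<in>C. of_bool (x \<notin> set bs)) = card (C \<inter> {x. x \<notin> set bs})" by (subst sum_of_bool_eq) auto
      also have "C \<inter> {x. x \<notin> set bs} = C - set bs" by auto
      finally show ?thesis .
    qed
    have "card (D - set bs) = (\<Sum>C\<in>Kf. \<Sum>x\<in>C. of_bool (x \<notin> set bs))"
      using sum_classes[OF P(1,2), of "\<lambda>x. of_bool (x \<notin> set bs) :: nat"] h[OF order_refl] unfolding Kf_def by simp
    also have "\<dots> = (\<Sum>C\<in>Kf. card (C - set bs))"
      by (rule sum.cong[OF refl], rule h) (use sub in \<open>auto simp: Kf_def\<close>)
    finally show ?thesis .
  qed
  moreover have "(\<Sum>C\<in>Kf - Kb. card (C - set bs)) \<le> (\<Sum>C\<in>Kf. card (C - set bs))"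
    by (rule sum_mono2) (use fin in auto)
  moreover have "(\<Sum>C\<in>Kf - Kb. 3) \<le> (\<Sum>C\<in>Kf - Kb. card (C - set bs))" by (rule sum_mono) (use three in auto)
  ultimately have "3 * card (Kf - Kb) \<le> card (D - set bs)" by simp
  moreover have "card (Kf - Kb) = card Kf - card Kb" using fin by (intro card_Diff_subset) (auto simp: Kb_def)
  moreover have "ncc D (gr D p) = card Kf" unfolding ncc_def Kf_def ..
  ultimately show ?thesis using b by linarith
qed

lemma card_bound: "card (D - set bs) \<le> 3960 * length bs + 7920"
proof -
  have cb: "card (set bs) = length bs" using dgD(2) by (rule distinct_card)
  have "card D = card (D - set bs) + card (set bs)"
    using card_Diff_subset[of "set bs" D] card_mono[OF P(1) dgD(3)] dgD(3) by simp
  moreover have "card D + 4 * ncc D (gr D p \<union> gr D al) \<le> 2 * (ncc D (gr D rot) + ncc D (gr D p))"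
    using lmapD(1)[OF L] unfolding planar_map_def rot_def by blast
  \<comment> \<open>\<open>t\<close> and \<open>l\<close> count the darts off and on the boundary,
    \<open>v\<close>, \<open>f\<close> and \<open>c\<close> the vertices, faces and components; the
    faces are eliminated by \<open>faces_bound\<close>.\<close>
  moreover have "t + 3 * l \<le> 6 * v + 6" if "m = t + l" "m + 4 * c \<le> 2 * (v + f)" "3 * f \<le> t + 3" for t l v f c m :: nat
  proof -
    have "t + l \<le> 2 * v + 2 * f" using add_leD1[OF that(2)] that(1) by simp
    then have "3 * t + 3 * l \<le> 6 * v + 6 * f" by linarith
    moreover have "6 * f \<le> 2 * t + 6" using that(3) by linarith
    ultimately show ?thesis by linarith
  qed
  ultimately have euler: "card (D - set bs) + 3 * card (set bs) \<le> 6 * ncc D (gr D rot) + 6"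
    using faces_bound by blast
  have five: "five x \<longleftrightarrow> card (orb x) = 5 \<and> orb x \<inter> set bs = {}" if "x \<in> D" for x
    using that unfolding five_def interior_def by blast
  have "card (D - set bs) \<le> 3960 * card (set bs) + 7920"
  proof (rule discharge[OF P(1) rot_bij P(7) dgD(3) euler, of received, folded orb_def])
    fix x assume x: "x \<in> D" "received x \<noteq> 0"
    then have "five (al x)" "\<not> five x" "x \<notin> set bs" unfolding received_def by (auto split: if_splits)
    then show "card (orb (al x)) = 5 \<and> orb (al x) \<inter> set bs = {} \<and> \<not> (card (orb x) = 5 \<and> orb x \<inter> set bs = {}) \<and> x \<notin> set bs"
      using five[OF x(1)] five[OF P(3)[OF x(1)]] by blast
  next
    fix x show "received x \<le> 9" unfolding received_def by (simp add: share_le)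
  next
    fix x assume "x \<in> D" "orb x \<inter> set bs = {}" "card (orb x) \<noteq> 5"
    then show "card (orb x) + 11 * sum received (orb x) + 1320 \<le> 220 * card (orb x)" by (rule receive_bound)
  next
    fix x assume "x \<in> D" "orb x \<inter> set bs = {}" "card (orb x) = 5"
    then show "20 \<le> (\<Sum>y\<in>orb x. received (al y))" using give_bound five by blast
  qed
  then show ?thesis unfolding cb .
qed

text \<open>The edge terms cancel in pairs over all darts, so the area of the boundary is the
  negative of the sum over the triangles. A triangle contributes at most 3, that is 1 per dart, and
  \<open>card_bound\<close> counts these darts.\<close>

lemma word_area_bound:
  assumes f: "lip_word {0..<n} (H3_relators n) f" and g: "lip_word {0..<n} (H3_relators n) g"
  shows "\<bar>word_area f g [] w\<bar> \<le> 3960 * real (length w) + 7920"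
proof -
  let ?R = "H3_relators n"
  define om where "om d = step_area f g (src d) (lab d)" for d
  have eq: "h u = h v" if "pres_eq ?R u v" "h = f \<or> h = g" for h u v
    using that f g unfolding lip_word_def by blast
  have st: "\<bar>h (src d @ [lab d]) - h (src d)\<bar> \<le> 1" if "d \<in> D" "h = f \<or> h = g" for h d
    using that f g lmapD(2,3)[OF L that(1)] unfolding lip_word_def by blast
  have ome: "om d = (f (src d) + f v) / 2 * (g v - g (src d))" if "pres_eq ?R v (src d @ [lab d])" for d v
    using eq[OF that, of f] eq[OF that, of g] unfolding om_def step_area_def by simp
  have anti: "om (al d) = - om d" if d: "d \<in> D" for d
  proof -
    have 1: "pres_eq ?R (src (al d)) (src d @ [lab d])" by (rule lmapD(5)[OF L d])
    have 2: "pres_eq ?R (src d) (src (al d) @ [lab (al d)])" using lmapD(5)[OF L P(3)[OF d]] P(4)[OF d] by simp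
    show ?thesis using ome[OF 1] ome[OF 2] by (simp add: field_simps)
  qed
  have "sum om D = (\<Sum>d\<in>D. om (al d))" by (rule sum.reindex_bij_betw[OF P(7), symmetric])
  also have "\<dots> = - sum om D" using anti by (simp add: sum_negf)
  finally have zero: "sum om D = 0" by simp
  have split: "sum om D = sum om (set bs) + sum om (D - set bs)"
    using sum.subset_diff[OF dgD(3) P(1), of om] by simp
  have bd: "sum_list (map om vs) = word_area f g (map lab us) (map lab vs)" if "bs = us @ vs" for us vs
    using that
  proof (induction vs arbitrary: us)
    case (Cons d vs)
    have ne: "bs \<noteq> []" using Cons.prems by simp
    have "pres_eq ?R (src d) (map lab us)"
    proof (cases "us = []")
      case True then show ?thesis using dgD(6)[OF ne] Cons.prems by simp
    next
      case False
      have "p (last us) = d" using dgD(4) False Cons.prems cyc_append[of us "d # vs" p] by simp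
      moreover have "last us \<in> D" using False Cons.prems dgD(3) last_in_set[of us] by auto
      ultimately have "pres_eq ?R (src d) (src (last us) @ [lab (last us)])" using lmapD(6)[OF L] by metis
      then show ?thesis using diagram_pos[OF L dgD(3,4) dgD(6)[OF ne] Cons.prems False] pres_trans by metis
    qed
    then have "om d = step_area f g (map lab us) (lab d)"
      unfolding om_def step_area_def using eq pres_eq_appendR by metis
    moreover have "sum_list (map om vs) = word_area f g (map lab (us @ [d])) (map lab vs)"
      using Cons.IH[of "us @ [d]"] Cons.prems by simp
    ultimately show ?case by simp
  qed simp
  have bdry: "sum om (set bs) = word_area f g [] w"
    using bd[of "[]" bs] sum_list_distinct_conv_sum_set[OF dgD(2), of om] dgD(5) by simp
  have tri: "\<bar>om d + om (p d) + om (p (p d))\<bar> \<le> 3" if d: "inner d" for d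
  proof -
    note i1 = inner_p[OF d] note i2 = inner_p[OF i1]
    have D: "d \<in> D" "p d \<in> D" "p (p d) \<in> D" using d i1 i2 by (auto simp: inner_def)
    have e: "pres_eq ?R (src (p d)) (src d @ [lab d])" "pres_eq ?R (src (p (p d))) (src (p d) @ [lab (p d)])"
      "pres_eq ?R (src d) (src (p (p d)) @ [lab (p (p d))])"
      using lmapD(6)[OF L D(1)] lmapD(6)[OF L D(2)] lmapD(6)[OF L D(3)] inner_p3[OF d] by auto
    have l: "\<bar>h (src (p d)) - h (src d)\<bar> \<le> 1" "\<bar>h (src (p (p d))) - h (src (p d))\<bar> \<le> 1"
      "\<bar>h (src d) - h (src (p (p d)))\<bar> \<le> 1" if h: "h = f \<or> h = g" for h
      using st[OF D(1) h] st[OF D(2) h] st[OF D(3) h] eq[OF e(1) h] eq[OF e(2) h] eq[OF e(3) h] by simp_all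
    show ?thesis unfolding ome[OF e(1)] ome[OF e(2)] ome[OF e(3)]
      by (rule triangle_area) (use l in auto)
  qed
  let ?I = "D - set bs"
  have bijI: "bij_betw p ?I ?I"
  proof (rule bij_betw_byWitness[where f' = "p \<circ> p"])
    show "\<forall>a\<in>?I. (p \<circ> p) (p a) = a" "\<forall>a\<in>?I. p ((p \<circ> p) a) = a"
      using inner_p3 unfolding inner_def by auto
    show "p ` ?I \<subseteq> ?I" "(p \<circ> p) ` ?I \<subseteq> ?I" using inner_p unfolding inner_def by auto
  qed
  have s1: "(\<Sum>d\<in>?I. om (p d)) = sum om ?I" by (rule sum.reindex_bij_betw[OF bijI])
  have s2: "(\<Sum>d\<in>?I. om (p (p d))) = sum om ?I"
    using sum.reindex_bij_betw[OF bijI, of "\<lambda>d. om (p d)"] s1 by simp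
  \<comment> \<open>Summing the triangle sums over all darts counts every triangle three
    times.\<close>
  have "3 * sum om ?I = (\<Sum>d\<in>?I. om d + om (p d) + om (p (p d)))"
    unfolding sum.distrib s1 s2 by simp
  then have "\<bar>3 * sum om ?I\<bar> \<le> (\<Sum>d\<in>?I. \<bar>om d + om (p d) + om (p (p d))\<bar>)" using sum_abs by metis
  also have "\<dots> \<le> (\<Sum>d\<in>?I. 3)" by (rule sum_mono) (use tri in \<open>auto simp: inner_def\<close>)
  finally have "\<bar>sum om ?I\<bar> \<le> real (card ?I)" by simp
  also have "\<dots> \<le> real (3960 * length bs + 7920)" using card_bound of_nat_le_iff by blast
  also have "length bs = length w" using dgD(5) by auto
  finally show ?thesis using zero split bdry by simp
qed

end

theorem H3_word_area_bound:
  assumes n: "n \<ge> 11" "n \<noteq> 12" "n \<noteq> 14"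
    and w: "w \<in> words_over {0..<n}" "pres_eq (H3_relators n) w []"
    and f: "lip_word {0..<n} (H3_relators n) f" and g: "lip_word {0..<n} (H3_relators n) g"
  shows "\<bar>word_area f g [] w\<bar> \<le> 3960 * real (length w) + 7920"
proof -
  have "n > 0" using n by simp
  have "bounds {0..<n} (H3_relators n) (H3_faces n) w"
    by (rule bounds_trivial_word[OF triangular_H3[OF \<open>n > 0\<close>] w])
  then have "\<exists>(D :: nat set) p al lab src bs. diagram {0..<n} (H3_relators n) (H3_faces n) D p al lab src bs w \<and>
    (\<forall>d\<in>D - set bs. al d \<notin> set bs \<longrightarrow> \<not> mirrored p al lab d)"
    by (rule bounds_reduced) (rule face_letters_distinct[OF n(1)])
  then obtain D p al lab src bs where *: "diagram {0..<n} (H3_relators n) (H3_faces n) (D :: nat set) p al lab src bs w"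
    "\<And>d. d \<in> D - set bs \<Longrightarrow> al d \<notin> set bs \<Longrightarrow> \<not> mirrored p al lab d" by blast
  interpret h3_diagram n D p al lab src bs w
    by unfold_locales (use n * in auto)
  show ?thesis by (rule word_area_bound[OF f g])
qed

section \<open>Linear area bounds and slim triangles\<close>

fun chain_area :: "('v \<Rightarrow> real) \<Rightarrow> ('v \<Rightarrow> real) \<Rightarrow> 'v list \<Rightarrow> real" where
  "chain_area f g (x # y # xs) = (f x + f y) / 2 * (g y - g x) + chain_area f g (y # xs)" |
  "chain_area f g _ = 0"

lemma chain_area_append:
  "xs \<noteq> [] \<Longrightarrow> ys \<noteq> [] \<Longrightarrow> last xs = hd ys \<Longrightarrow> chain_area f g (xs @ ys) = chain_area f g xs + chain_area f g ys"
proof (induction xs rule: induct_list012)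
  case (2 x)
  then show ?case by (cases ys) auto
qed auto

lemma chain_area_const:
  "xs \<noteq> [] \<Longrightarrow> (\<And>x. x \<in> set xs \<Longrightarrow> f x = c) \<Longrightarrow> chain_area f g xs = c * (g (last xs) - g (hd xs))"
proof (induction xs rule: induct_list012)
  case (3 x y zs)
  then show ?case by (auto simp: algebra_simps)
qed auto

text \<open>All that is kept of the presentation: an integer metric with geodesics, and a linear
  area bound for arbitrary 1-Lipschitz \<open>f\<close> and \<open>g\<close>.\<close>

locale area_space =
  fixes V :: "'v set" and d :: "'v \<Rightarrow> 'v \<Rightarrow> nat" and K :: nat
  assumes d_self [simp]: "x \<in> V \<Longrightarrow> d x x = 0"
    and d_zero: "x \<in> V \<Longrightarrow> y \<in> V \<Longrightarrow> d x y = 0 \<Longrightarrow> x = y"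
    and d_sym: "x \<in> V \<Longrightarrow> y \<in> V \<Longrightarrow> d x y = d y x"
    and d_tri: "x \<in> V \<Longrightarrow> y \<in> V \<Longrightarrow> z \<in> V \<Longrightarrow> d x z \<le> d x y + d y z"
    and d_step: "x \<in> V \<Longrightarrow> y \<in> V \<Longrightarrow> d x y = Suc k \<Longrightarrow> \<exists>z\<in>V. d x z = k \<and> d z y = 1"
    and K1: "1 \<le> K"
    and area: "xs \<noteq> [] \<Longrightarrow> set xs \<subseteq> V \<Longrightarrow> successively (\<lambda>x y. d x y \<le> 1) xs \<Longrightarrow> last xs = hd xs \<Longrightarrow>
      (\<And>x y. x \<in> V \<Longrightarrow> y \<in> V \<Longrightarrow> \<bar>f x - f y\<bar> \<le> real (d x y)) \<Longrightarrow>
      (\<And>x y. x \<in> V \<Longrightarrow> y \<in> V \<Longrightarrow> \<bar>g x - g y\<bar> \<le> real (d x y)) \<Longrightarrow>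
      \<bar>chain_area f g xs\<bar> \<le> real K * real (length xs)"
begin

definition path :: "'v list \<Rightarrow> bool" where
  "path xs \<longleftrightarrow> xs \<noteq> [] \<and> set xs \<subseteq> V \<and> successively (\<lambda>x y. d x y \<le> 1) xs"

text \<open>Geodesics as lists of vertices, to be concatenated to loops; the parametrised form
  \<open>geo\<close> serves to select points and segments.\<close>

definition glist :: "'v list \<Rightarrow> bool" where
  "glist xs \<longleftrightarrow> path xs \<and> length xs = Suc (d (hd xs) (last xs))"

definition geo :: "(nat \<Rightarrow> 'v) \<Rightarrow> nat \<Rightarrow> bool" where
  "geo c l \<longleftrightarrow> (\<forall>i\<le>l. c i \<in> V) \<and> (\<forall>i j. i \<le> j \<longrightarrow> j \<le> l \<longrightarrow> d (c i) (c j) = j - i)"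

lemma pathD: "path xs \<Longrightarrow> xs \<noteq> []" "path xs \<Longrightarrow> x \<in> set xs \<Longrightarrow> x \<in> V"
  "path xs \<Longrightarrow> hd xs \<in> V" "path xs \<Longrightarrow> last xs \<in> V" "path xs \<Longrightarrow> set xs \<subseteq> V"
  unfolding path_def by auto

lemma path_append: "path xs \<Longrightarrow> path ys \<Longrightarrow> last xs = hd ys \<Longrightarrow> path (xs @ ys)"
  using pathD(3)[of ys] unfolding path_def by (auto simp: successively_append_iff)

lemma path_rev: "path xs \<Longrightarrow> path (rev xs)"
proof -
  assume p: "path xs"
  have "successively (\<lambda>x y. d y x \<le> 1) xs"
    unfolding successively_conv_nth
  proof (intro allI impI)
    fix i assume i: "Suc i < length xs"
    then have "xs ! i \<in> V" "xs ! Suc i \<in> V" using p unfolding path_def by auto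
    moreover have "d (xs ! i) (xs ! Suc i) \<le> 1" using p i unfolding path_def successively_conv_nth by blast
    ultimately show "d (xs ! Suc i) (xs ! i) \<le> 1" using d_sym by simp
  qed
  then show ?thesis using p unfolding path_def by simp
qed

lemma glist_rev: "glist xs \<Longrightarrow> glist (rev xs)"
  unfolding glist_def using path_rev pathD(3,4) d_sym by (auto simp: hd_rev last_rev pathD(1))

lemma geoD: "geo c l \<Longrightarrow> i \<le> l \<Longrightarrow> c i \<in> V" "geo c l \<Longrightarrow> i \<le> j \<Longrightarrow> j \<le> l \<Longrightarrow> d (c i) (c j) = j - i"
  unfolding geo_def by auto

lemma geo_exists: "x \<in> V \<Longrightarrow> y \<in> V \<Longrightarrow> \<exists>c. geo c (d x y) \<and> c 0 = x \<and> c (d x y) = y"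
proof (induction "d x y" arbitrary: y)
  case 0
  then show ?case using d_zero[of x y] by (intro exI[of _ "\<lambda>_. x"]) (auto simp: geo_def)
next
  case (Suc k)
  obtain z where z: "z \<in> V" "d x z = k" "d z y = 1" using d_step Suc.prems Suc.hyps(2) by metis
  obtain c where c: "geo c k" "c 0 = x" "c k = z" using Suc.hyps(1)[OF z(2)[symmetric] Suc.prems(1) z(1)] z(2) by auto
  let ?c = "c(Suc k := y)"
  have y: "d (c i) y = Suc k - i" if "i \<le> k" for i
  proof -
    have ci: "c i \<in> V" using geoD(1)[OF c(1) that] .
    have "d (c i) y \<le> d (c i) z + d z y" by (rule d_tri[OF ci z(1) Suc.prems(2)])
    moreover have "d (c i) z = k - i" using geoD(2)[OF c(1) that order_refl] c(3) by simp
    moreover have "d x y \<le> d x (c i) + d (c i) y" by (rule d_tri[OF Suc.prems(1) ci Suc.prems(2)])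
    moreover have "d x (c i) = i" using geoD(2)[OF c(1) _ that, of 0] c(2) by simp
    ultimately show ?thesis using z(3) Suc.hyps(2) that by linarith
  qed
  have "geo ?c (Suc k)"
    unfolding geo_def using geoD[OF c(1)] Suc.prems(2) y by (auto simp: le_Suc_eq)
  then show ?case using c(2) Suc.hyps(2)[symmetric] by (intro exI[of _ ?c]) auto
qed

lemma geo_segment:
  assumes "geo c l" "i \<le> l" "j \<le> l"
  obtains xs where "glist xs" "hd xs = c i" "last xs = c j"
    "\<And>x. x \<in> set xs \<Longrightarrow> \<exists>k. min i j \<le> k \<and> k \<le> max i j \<and> x = c k"
proof -
  have main: "\<exists>xs. glist xs \<and> hd xs = c i \<and> last xs = c j \<and> (\<forall>x\<in>set xs. \<exists>k. i \<le> k \<and> k \<le> j \<and> x = c k)"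
    if "i \<le> j" "j \<le> l" for i j
  proof -
    let ?xs = "map c [i..<Suc j]"
    have ne: "[i..<Suc j] \<noteq> []" using that by simp
    have "successively (\<lambda>x y. d x y \<le> 1) ?xs"
      unfolding successively_conv_nth
    proof (intro allI impI)
      fix k assume kl: "Suc k < length ?xs"
      then have "i + Suc k \<le> j" using that(1) by (simp del: upt_Suc)
      then show "d (?xs ! k) (?xs ! Suc k) \<le> 1"
        using geoD(2)[OF assms(1), of "i + k" "i + Suc k"] that(2) kl by (simp del: upt_Suc)
    qed
    moreover have "set ?xs \<subseteq> V" using geoD(1)[OF assms(1)] that by auto
    moreover have h: "hd ?xs = c i" "last ?xs = c j" using that by (simp_all add: hd_map last_map del: upt_Suc)
    ultimately have "glist ?xs" unfolding glist_def path_def h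
      using that geoD(2)[OF assms(1) that] by auto
    then show ?thesis using h by (intro exI[of _ ?xs]) auto
  qed
  show ?thesis
  proof (cases "i \<le> j")
    case True
    then show ?thesis using main[OF True assms(3)] that by auto
  next
    case False
    then have "j \<le> i" by simp
    from main[OF this assms(2)] obtain xs where xs: "glist xs" "hd xs = c j" "last xs = c i"
      "\<And>x. x \<in> set xs \<Longrightarrow> \<exists>k. j \<le> k \<and> k \<le> i \<and> x = c k" by blast
    have "xs \<noteq> []" using xs(1) pathD(1) unfolding glist_def by blast
    then show ?thesis using that[OF glist_rev[OF xs(1)]] xs \<open>j \<le> i\<close> by (auto simp: hd_rev last_rev)
  qed
qed

lemma glist_exists:
  assumes "x \<in> V" "y \<in> V"
  obtains xs where "glist xs" "hd xs = x" "last xs = y"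
proof -
  obtain c where c: "geo c (d x y)" "c 0 = x" "c (d x y) = y" using geo_exists[OF assms] by blast
  from geo_segment[OF c(1), of 0 "d x y"] c show ?thesis using that by (metis le0 order_refl)
qed

definition ds :: "'v \<Rightarrow> 'v set \<Rightarrow> nat" where
  "ds x Y = (LEAST m. \<exists>y\<in>Y. d x y = m)"

lemma ds_attained: "Y \<noteq> {} \<Longrightarrow> \<exists>y\<in>Y. d x y = ds x Y"
  unfolding ds_def by (rule LeastI_ex) blast

lemma ds_le: "y \<in> Y \<Longrightarrow> ds x Y \<le> d x y"
  unfolding ds_def by (rule Least_le) blast

lemma ds_ge: "Y \<noteq> {} \<Longrightarrow> (\<And>y. y \<in> Y \<Longrightarrow> m \<le> d x y) \<Longrightarrow> m \<le> ds x Y"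
  using ds_attained by metis

lemma ds_tri: "Y \<noteq> {} \<Longrightarrow> Y \<subseteq> V \<Longrightarrow> x \<in> V \<Longrightarrow> z \<in> V \<Longrightarrow> ds x Y \<le> d x z + ds z Y"
proof -
  assume Y: "Y \<noteq> {}" "Y \<subseteq> V" and x: "x \<in> V" "z \<in> V"
  obtain y where y: "y \<in> Y" "d z y = ds z Y" using ds_attained[OF Y(1)] by blast
  have "ds x Y \<le> d x y" by (rule ds_le[OF y(1)])
  also have "\<dots> \<le> d x z + d z y" using d_tri x y Y by blast
  finally show ?thesis using y by simp
qed

lemma ds_in: "y \<in> Y \<Longrightarrow> y \<in> V \<Longrightarrow> ds y Y = 0"
  using ds_le[of y Y y] by simp

lemma ds_lipschitz:
  assumes Y: "Y \<noteq> {}" "Y \<subseteq> V" and x: "x \<in> V" "y \<in> V"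
  shows "\<bar>real (min (ds x Y) t) - real (min (ds y Y) t)\<bar> \<le> real (d x y)"
  using ds_tri[OF Y x] ds_tri[OF Y x(2,1)] d_sym[OF x] by (simp add: abs_le_iff min_def)

lemma d_lipschitz:
  assumes "z \<in> V" "x \<in> V" "y \<in> V"
  shows "\<bar>real (d z x) - real (d z y)\<bar> \<le> real (d x y)"
  using d_tri[OF assms] d_tri[OF assms(1,3,2)] d_sym[OF assms(2,3)] by (simp add: abs_le_iff)

lemma chain_area_bound:
  assumes g: "\<And>x y. x \<in> V \<Longrightarrow> y \<in> V \<Longrightarrow> \<bar>g x - g y\<bar> \<le> real (d x y)"
  shows "path xs \<Longrightarrow> (\<And>x. x \<in> set xs \<Longrightarrow> \<bar>f x\<bar> \<le> t) \<Longrightarrow> \<bar>chain_area f g xs\<bar> \<le> t * real (length xs - 1)"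
proof (induction xs rule: induct_list012)
  case (3 x y zs)
  have t0: "0 \<le> t" using 3(4)[of x] by simp
  have xy: "x \<in> V" "y \<in> V" "d x y \<le> 1" and p: "path (y # zs)" using 3(3) unfolding path_def by auto
  have "\<bar>g y - g x\<bar> \<le> 1" using g[OF xy(2,1)] xy(3) d_sym[OF xy(1,2)] by simp
  moreover have "\<bar>(f x + f y) / 2\<bar> \<le> t" using 3(4)[of x] 3(4)[of y] by (auto simp: abs_le_iff)
  ultimately have "\<bar>(f x + f y) / 2 * (g y - g x)\<bar> \<le> t * 1" unfolding abs_mult using t0 by (intro mult_mono) auto
  moreover have "\<bar>chain_area f g (y # zs)\<bar> \<le> t * real (length (y # zs) - 1)" using 3(2)[OF p] 3(4) by auto
  ultimately have "\<bar>(f x + f y) / 2 * (g y - g x) + chain_area f g (y # zs)\<bar> \<le> t * 1 + t * real (length (y # zs) - 1)"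
    by linarith
  moreover have "real (length (x # y # zs) - 1) = 1 + real (length (y # zs) - 1)" by simp
  ultimately show ?case unfolding chain_area.simps by (simp only: distrib_left)
qed (auto simp: path_def)

text \<open>With \<open>f\<close> the distance to \<open>Y\<close> truncated at \<open>t\<close> and \<open>g\<close> the distance from the start of the geodesic \<open>C\<close>, the area
  of the loop is \<open>t\<close> times the length of \<open>C\<close>, up to the contribution of the rest.\<close>

lemma side_bound:
  assumes C: "glist C" and rest: "path rest" "hd rest = last C" "last rest = hd C"
    and Y: "Y \<noteq> {}" "Y \<subseteq> V" and far: "\<And>x y. x \<in> set C \<Longrightarrow> y \<in> Y \<Longrightarrow> t \<le> d x y"
    and M: "\<bar>chain_area (\<lambda>x. real (min (ds x Y) t)) (d (hd C)) rest\<bar> \<le> M"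
  shows "real t * real (length C - 1) \<le> real K * real (length C + length rest) + M"
proof -
  let ?f = "\<lambda>x. real (min (ds x Y) t)" and ?g = "\<lambda>x. real (d (hd C) x)"
  have p: "path C" and len: "length C = Suc (d (hd C) (last C))" using C unfolding glist_def by auto
  have hV: "hd C \<in> V" using pathD(3)[OF p] .
  have "?f x = real t" if "x \<in> set C" for x using ds_ge[OF Y(1) far[OF that]] by simp
  then have "chain_area ?f ?g C = real t * (?g (last C) - ?g (hd C))"
    using pathD(1)[OF p] by (intro chain_area_const) auto
  then have 1: "chain_area ?f ?g C = real t * real (length C - 1)" using len hV by simp
  have pt: "path (C @ rest)" using path_append[OF p rest(1)] rest(2) by simp
  have ne: "C \<noteq> []" "rest \<noteq> []" using pathD(1) p rest by auto
  have "\<bar>chain_area ?f ?g (C @ rest)\<bar> \<le> real K * real (length (C @ rest))"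
  proof (rule area)
    show "C @ rest \<noteq> []" "set (C @ rest) \<subseteq> V" "successively (\<lambda>x y. d x y \<le> 1) (C @ rest)"
      using pt unfolding path_def by auto
    show "last (C @ rest) = hd (C @ rest)" using ne rest by simp
    show "\<bar>?f x - ?f y\<bar> \<le> real (d x y)" if "x \<in> V" "y \<in> V" for x y using ds_lipschitz[OF Y that] .
    show "\<bar>?g x - ?g y\<bar> \<le> real (d x y)" if "x \<in> V" "y \<in> V" for x y using d_lipschitz[OF hV that] .
  qed
  moreover have "chain_area ?f ?g (C @ rest) = chain_area ?f ?g C + chain_area ?f ?g rest"
    using chain_area_append[OF ne] rest(2) by simp
  ultimately show ?thesis using 1 M by (simp add: abs_le_iff)
qed

lemma connector_bound:
  assumes "glist c" "z \<in> V" "d (hd c) (last c) \<le> s"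
  shows "\<bar>chain_area (\<lambda>x. real (min (ds x Y) t)) (d z) c\<bar> \<le> real t * real s"
proof -
  have p: "path c" "length c - 1 \<le> s" using assms unfolding glist_def by auto
  have "\<bar>chain_area (\<lambda>x. real (min (ds x Y) t)) (\<lambda>x. real (d z x)) c\<bar> \<le> real t * real (length c - 1)"
    by (rule chain_area_bound[OF d_lipschitz[OF assms(2)] p(1)]) auto
  also have "\<dots> \<le> real t * real s" using p(2) by (intro mult_left_mono) auto
  finally show ?thesis .
qed

lemma flat_side:
  assumes "path A" "set A \<subseteq> Y"
  shows "chain_area (\<lambda>x. real (min (ds x Y) t)) g A = 0"
proof -
  have "ds x Y = 0" if "x \<in> set A" for x using ds_in[of x Y] that assms pathD(2) by blast
  then show ?thesis using chain_area_const[of A "\<lambda>x. real (min (ds x Y) t)" 0 g] pathD(1)[OF assms(1)] by simp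
qed

text \<open>For \<open>Y\<close> the union of \<open>A\<close> and \<open>B\<close>, the truncated
  distance vanishes on \<open>A\<close> and \<open>B\<close>. It is at most \<open>t\<close> on the
  connectors, which have length at most \<open>t\<close>; so the rest of the loop contributes at
  most \<open>3 * t * t\<close>.\<close>

lemma hexagon_side:
  assumes gl: "glist C" "glist c1" "glist A" "glist c2" "glist B" "glist c3"
    and ends: "last C = hd c1" "last c1 = hd A" "last A = hd c2" "last c2 = hd B" "last B = hd c3" "last c3 = hd C"
    and short: "d (hd c1) (last c1) \<le> t" "d (hd c2) (last c2) \<le> t" "d (hd c3) (last c3) \<le> t"
    and far: "\<And>x y. x \<in> set C \<Longrightarrow> y \<in> set A \<union> set B \<Longrightarrow> t \<le> d x y"
  shows "real t * real (length C - 1) \<le> real K * real (length C + length A + length B + 3 * t + 3) + 3 * real t * real t"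
proof -
  let ?Y = "set A \<union> set B"
  let ?rest = "c1 @ (A @ (c2 @ (B @ c3)))"
  have p: "path C" "path c1" "path A" "path c2" "path B" "path c3" using gl unfolding glist_def by auto
  note ne = pathD(1)[OF p(1)] pathD(1)[OF p(2)] pathD(1)[OF p(3)] pathD(1)[OF p(4)] pathD(1)[OF p(5)] pathD(1)[OF p(6)]
  have q: "path (B @ c3)" "path (c2 @ (B @ c3))" "path (A @ (c2 @ (B @ c3)))" "path ?rest"
  proof -
    show 1: "path (B @ c3)" by (rule path_append[OF p(5,6) ends(5)])
    show 2: "path (c2 @ (B @ c3))" by (rule path_append[OF p(4) 1]) (use ends ne in simp)
    show 3: "path (A @ (c2 @ (B @ c3)))" by (rule path_append[OF p(3) 2]) (use ends ne in simp)
    show "path ?rest" by (rule path_append[OF p(2) 3]) (use ends ne in simp)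
  qed
  let ?ca = "chain_area (\<lambda>x. real (min (ds x ?Y) t)) (d (hd C))"
  have hV: "hd C \<in> V" using pathD(3)[OF p(1)] .
  have "?ca ?rest = ?ca c1 + (?ca A + (?ca c2 + (?ca B + ?ca c3)))"
    using ne ends by (simp add: chain_area_append)
  moreover have "?ca A = 0" "?ca B = 0" using flat_side p by auto
  moreover have "\<bar>?ca c1\<bar> \<le> real t * real t" "\<bar>?ca c2\<bar> \<le> real t * real t" "\<bar>?ca c3\<bar> \<le> real t * real t"
    using connector_bound gl hV short by blast+
  ultimately have M: "\<bar>?ca ?rest\<bar> \<le> 3 * real t * real t" by (simp add: abs_le_iff)
  have Y: "?Y \<noteq> {}" "?Y \<subseteq> V" using ne pathD(5) p by auto
  have "real t * real (length C - 1) \<le> real K * real (length C + length ?rest) + 3 * real t * real t"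
    by (rule side_bound[OF gl(1) q(4) _ _ Y far M]) (use ends ne in auto)
  moreover have "length C + length ?rest \<le> length C + length A + length B + 3 * t + 3"
    using gl short unfolding glist_def by auto
  then have "real K * real (length C + length ?rest) \<le> real K * real (length C + length A + length B + 3 * t + 3)"
    by (intro mult_left_mono) (simp_all only: of_nat_le_iff of_nat_0_le_iff)
  ultimately show ?thesis by linarith
qed

text \<open>Each side satisfies a bound with \<open>K\<close> times the perimeter. Adding the three
  bounds costs \<open>3 * K\<close> times the sum of the sides, which \<open>t = 4 * K\<close>
  exceeds by \<open>K\<close>; what remains bounds the sum by \<open>180 * K + 18\<close>.\<close>

lemma hexagon:
  assumes gl: "glist C" "glist c1" "glist A" "glist c2" "glist B" "glist c3"
    and ends: "last C = hd c1" "last c1 = hd A" "last A = hd c2" "last c2 = hd B" "last B = hd c3" "last c3 = hd C"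
    and short: "d (hd c1) (last c1) \<le> t" "d (hd c2) (last c2) \<le> t" "d (hd c3) (last c3) \<le> t"
    and far: "\<And>x y. x \<in> set C \<Longrightarrow> y \<in> set A \<union> set B \<Longrightarrow> t \<le> d x y" "\<And>x y. x \<in> set A \<Longrightarrow> y \<in> set B \<Longrightarrow> t \<le> d x y"
    and t: "t = 4 * K"
  shows "length C - 1 \<le> 200 * K"
proof -
  have p: "path C" "path A" "path B" using gl unfolding glist_def by auto
  have V: "x \<in> V" if "x \<in> set A \<or> x \<in> set B \<or> x \<in> set C" for x using that pathD(2) p by blast
  have 1: "real t * real (length C - 1) \<le> real K * real (length C + length A + length B + 3 * t + 3) + 3 * real t * real t"
    by (rule hexagon_side[OF gl ends short far(1)])
  have 2: "real t * real (length A - 1) \<le> real K * real (length A + length B + length C + 3 * t + 3) + 3 * real t * real t"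
    by (rule hexagon_side[OF gl(3-6,1-2) ends(3-6,1-2) short(2,3,1)])
      (use far V d_sym in \<open>metis Un_iff\<close>)
  have 3: "real t * real (length B - 1) \<le> real K * real (length B + length C + length A + 3 * t + 3) + 3 * real t * real t"
    by (rule hexagon_side[OF gl(5-6,1-4) ends(5-6,1-4) short(3,1,2)])
      (use far V d_sym in \<open>metis Un_iff\<close>)
  obtain a b c where abc: "length A = Suc a" "length B = Suc b" "length C = Suc c"
    using pathD(1)[OF p(1)] pathD(1)[OF p(2)] pathD(1)[OF p(3)] by (metis length_0_conv not0_implies_Suc)
  have "real t * real (a + b + c) \<le> 3 * (real K * real (a + b + c + 3 * t + 6)) + 9 * real t * real t"
    using 1 2 3 unfolding abc by (simp add: algebra_simps)
  then have "real K * real (a + b + c) \<le> real K * (180 * real K + 18)"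
    unfolding t by (simp add: algebra_simps)
  then have "real (a + b + c) \<le> 180 * real K + 18" using K1 by (simp add: mult_le_cancel_left)
  then have "a + b + c \<le> 180 * K + 18" by linarith
  then show ?thesis using K1 abc by simp
qed

text \<open>The opposite side is longer than \<open>C\<close> by at most the connectors, so the
  perimeter is about twice \<open>C\<close>, and \<open>4 * K\<close> exceeds \<open>2 * K\<close>.
  Connectors of length \<open>2 * t\<close> are allowed because \<open>corner\<close> may reach
  \<open>b\<close> through a point of \<open>a\<close>.\<close>

lemma quadrilateral:
  assumes gl: "glist C" "geo b l" and im: "i \<le> l" "m \<le> l" "d (hd C) (b i) \<le> 2 * t" "d (last C) (b m) \<le> 2 * t"
    and far: "\<And>x k. x \<in> set C \<Longrightarrow> k \<le> l \<Longrightarrow> t \<le> d x (b k)"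
    and t: "t = 4 * K"
  shows "length C - 1 \<le> 200 * K"
proof -
  obtain B where B: "glist B" "hd B = b m" "last B = b i" "\<And>x. x \<in> set B \<Longrightarrow> \<exists>k. min m i \<le> k \<and> k \<le> max m i \<and> x = b k"
    using geo_segment[OF gl(2) im(2,1)] by blast
  have p: "path C" "path B" using gl B unfolding glist_def by auto
  note ne = pathD(1)[OF p(1)] pathD(1)[OF p(2)]
  have hl: "hd C \<in> V" "last C \<in> V" "b i \<in> V" "b m \<in> V" using pathD(3,4)[OF p(1)] geoD(1)[OF gl(2)] im by auto
  obtain c1 where c1: "glist c1" "hd c1 = last C" "last c1 = b m" using glist_exists[OF hl(2,4)] .
  obtain c2 where c2: "glist c2" "hd c2 = b i" "last c2 = hd C" using glist_exists[OF hl(3,1)] .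
  have pc: "path c1" "path c2" using c1 c2 unfolding glist_def by auto
  note nec = pathD(1)[OF pc(1)] pathD(1)[OF pc(2)]
  let ?rest = "c1 @ (B @ c2)"
  have q1: "path (B @ c2)" by (rule path_append[OF p(2) pc(2)]) (use B c2 in simp)
  have q: "path ?rest" by (rule path_append[OF pc(1) q1]) (use B c1 ne in simp)
  let ?ca = "chain_area (\<lambda>x. real (min (ds x (set B)) t)) (d (hd C))"
  have "?ca ?rest = ?ca c1 + (?ca B + ?ca c2)" using ne nec B c1 c2 by (simp add: chain_area_append)
  moreover have "?ca B = 0" using flat_side p by auto
  moreover have "\<bar>?ca c1\<bar> \<le> real t * real (2 * t)" "\<bar>?ca c2\<bar> \<le> real t * real (2 * t)"
    using connector_bound[OF c1(1) hl(1), of "2 * t"] connector_bound[OF c2(1) hl(1), of "2 * t"] c1 c2 im d_sym[OF hl(1,3)]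
    by auto
  ultimately have M: "\<bar>?ca ?rest\<bar> \<le> 4 * real t * real t" by (simp add: abs_le_iff)
  have Y: "set B \<noteq> {}" "set B \<subseteq> V" using ne pathD(5) p by auto
  have fb: "t \<le> d x y" if "x \<in> set C" "y \<in> set B" for x y
    using B(4)[OF that(2)] far[OF that(1)] im(1,2) by auto
  have 1: "real t * real (length C - 1) \<le> real K * real (length C + length ?rest) + 4 * real t * real t"
    by (rule side_bound[OF gl(1) q _ _ Y fb M]) (use B c1 c2 ne nec in auto)
  have lc: "length C = Suc (d (hd C) (last C))" using gl unfolding glist_def by simp
  have "d (b m) (b i) \<le> d (b m) (last C) + d (last C) (b i)" by (rule d_tri[OF hl(4,2,3)])
  moreover have "d (last C) (b i) \<le> d (last C) (hd C) + d (hd C) (b i)" by (rule d_tri[OF hl(2,1,3)])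
  ultimately have "length B \<le> 4 * t + length C"
    using B(1) im lc d_sym[OF hl(4,2)] d_sym[OF hl(1,2)] unfolding glist_def B(2,3) by simp
  moreover have "length c1 \<le> 2 * t + 1" "length c2 \<le> 2 * t + 1"
    using c1 c2 im d_sym[OF hl(1,3)] unfolding glist_def by auto
  ultimately have "length C + length ?rest \<le> 2 * length C + 8 * t + 2" by simp
  then have "real K * real (length C + length ?rest) \<le> real K * real (2 * length C + 8 * t + 2)"
    by (intro mult_left_mono) (simp_all only: of_nat_le_iff of_nat_0_le_iff)
  then have 2: "real t * real (d (hd C) (last C)) \<le> real K * real (2 * d (hd C) (last C) + 8 * t + 4) + 4 * real t * real t"
    using 1 unfolding lc by (simp add: algebra_simps)
  then have "real K * real (d (hd C) (last C)) \<le> real K * (48 * real K + 2)"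
    unfolding t by (simp add: algebra_simps)
  then have "real (d (hd C) (last C)) \<le> 48 * real K + 2" using K1 by (simp add: mult_le_cancel_left)
  then have "d (hd C) (last C) \<le> 48 * K + 2" by linarith
  then show ?thesis using K1 lc by simp
qed

text \<open>\<open>C\<close> starts near \<open>a\<close> and ends near \<open>b\<close>. Follow
  \<open>a\<close> from the start of \<open>C\<close> towards its common point with
  \<open>b\<close>, up to the first vertex within \<open>t\<close> of \<open>b\<close>. If this is
  the first vertex already, a quadrilateral with \<open>b\<close> arises; otherwise the part
  traversed stays at distance at least \<open>t\<close> from \<open>b\<close> and is a side of a
  hexagon.\<close>

lemma corner:
  assumes C: "glist C" and al: "geo a la" and be: "geo b lb" and r: "m0 \<le> lb" "a la = b m0"
    and i: "i \<le> la" "d (hd C) (a i) \<le> t" and m: "m \<le> lb" "d (last C) (b m) \<le> t"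
    and fa: "\<And>x k. x \<in> set C \<Longrightarrow> k \<le> la \<Longrightarrow> t \<le> d x (a k)"
    and fb: "\<And>x k. x \<in> set C \<Longrightarrow> k \<le> lb \<Longrightarrow> t \<le> d x (b k)"
    and t: "t = 4 * K"
  shows "length C - 1 \<le> 200 * K"
proof -
  let ?B = "b ` {..lb}"
  have BV: "?B \<noteq> {}" "?B \<subseteq> V" using geoD(1)[OF be] by auto
  have p: "path C" using C unfolding glist_def by simp
  have hl: "hd C \<in> V" "last C \<in> V" "a i \<in> V" "b m \<in> V"
    using pathD(3,4)[OF p] geoD(1)[OF al i(1)] geoD(1)[OF be m(1)] by auto
  define i' where "i' = (LEAST j. i \<le> j \<and> ds (a j) ?B \<le> t)"
  have "ds (a la) ?B = 0" using r BV(2) by (intro ds_in) auto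
  then have ex: "i \<le> la \<and> ds (a la) ?B \<le> t" using i by simp
  have i': "i \<le> i'" "ds (a i') ?B \<le> t" using LeastI[of "\<lambda>j. i \<le> j \<and> ds (a j) ?B \<le> t", OF ex] unfolding i'_def by auto
  have i'la: "i' \<le> la" unfolding i'_def by (rule Least_le) (rule ex)
  have before: "t < ds (a j) ?B" if "i \<le> j" "j < i'" for j
    using not_less_Least[of j "\<lambda>j. i \<le> j \<and> ds (a j) ?B \<le> t"] that unfolding i'_def by auto
  have aV: "a i' \<in> V" using geoD(1)[OF al i'la] .
  obtain m' where m': "m' \<le> lb" "d (a i') (b m') = ds (a i') ?B" using ds_attained[OF BV(1), of "a i'"] by auto
  have mV: "b m' \<in> V" using geoD(1)[OF be m'(1)] .
  show ?thesis
  proof (cases "i' = i")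
    case True
    have "d (hd C) (b m') \<le> d (hd C) (a i) + d (a i) (b m')" by (rule d_tri[OF hl(1,3) mV])
    then have "d (hd C) (b m') \<le> 2 * t" using i(2) m' i'(2) True by simp
    moreover have "d (last C) (b m) \<le> 2 * t" using m(2) by simp
    ultimately show ?thesis by (rule quadrilateral[OF C be m'(1) m(1) _ _ fb t])
  next
    case False
    then have ltr: "i < i'" using i'(1) by simp
    \<comment> \<open>The preceding vertex is farther than \<open>t\<close> from \<open>b\<close>
      and only one step away.\<close>
    have tb: "t \<le> ds (a i') ?B"
    proof -
      have e: "i \<le> i' - 1" "i' - 1 < i'" "i' - 1 \<le> la" using ltr i'la by auto
      have "ds (a (i' - 1)) ?B \<le> d (a (i' - 1)) (a i') + ds (a i') ?B"
        by (rule ds_tri[OF BV geoD(1)[OF al e(3)] aV])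
      moreover have "d (a (i' - 1)) (a i') = 1" using geoD(2)[OF al _ i'la, of "i' - 1"] ltr by simp
      ultimately show ?thesis using before[OF e(1,2)] by simp
    qed
    have far: "t \<le> d (a j) (b k)" if "i \<le> j" "j \<le> i'" "k \<le> lb" for j k
    proof -
      have "t \<le> ds (a j) ?B" using before[of j] tb that by (cases "j = i'") auto
      also have "\<dots> \<le> d (a j) (b k)" using that by (intro ds_le) auto
      finally show ?thesis .
    qed
    obtain A where A: "glist A" "hd A = a i'" "last A = a i"
      "\<And>x. x \<in> set A \<Longrightarrow> \<exists>k. min i' i \<le> k \<and> k \<le> max i' i \<and> x = a k"
      using geo_segment[OF al i'la i(1)] by blast
    obtain B where B: "glist B" "hd B = b m" "last B = b m'"
      "\<And>x. x \<in> set B \<Longrightarrow> \<exists>k. min m m' \<le> k \<and> k \<le> max m m' \<and> x = b k"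
      using geo_segment[OF be m(1) m'(1)] by blast
    obtain c1 where c1: "glist c1" "hd c1 = last C" "last c1 = b m" using glist_exists[OF hl(2,4)] .
    obtain c2 where c2: "glist c2" "hd c2 = b m'" "last c2 = a i'" using glist_exists[OF mV aV] .
    obtain c3 where c3: "glist c3" "hd c3 = a i" "last c3 = hd C" using glist_exists[OF hl(3,1)] .
    have Ak: "\<exists>k. i \<le> k \<and> k \<le> i' \<and> x = a k" if "x \<in> set A" for x using A(4)[OF that] ltr by auto
    have Bk: "\<exists>k\<le>lb. x = b k" if "x \<in> set B" for x using B(4)[OF that] m m' by (metis le_max_iff_disj le_trans max_def)
    show ?thesis
    proof (rule hexagon[OF C c1(1) B(1) c2(1) A(1) c3(1) _ _ _ _ _ _ _ _ _ _ _ t])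
      show "last C = hd c1" "last c1 = hd B" "last B = hd c2" "last c2 = hd A" "last A = hd c3" "last c3 = hd C"
        using A B c1 c2 c3 by simp_all
      show "d (hd c1) (last c1) \<le> t" using c1 m by simp
      show "d (hd c2) (last c2) \<le> t" using c2 m' i'(2) d_sym[OF aV mV] by simp
      show "d (hd c3) (last c3) \<le> t" using c3 i d_sym[OF hl(1,3)] by simp
      fix x y
      show "t \<le> d x y" if "x \<in> set C" "y \<in> set B \<union> set A"
        using that fa[OF that(1)] fb[OF that(1)] Ak[of y] Bk[of y] i'la by auto
      show "t \<le> d x y" if xy: "x \<in> set B" "y \<in> set A"
      proof -
        obtain k j where kj: "k \<le> lb" "x = b k" "i \<le> j" "j \<le> i'" "y = a j" using Ak[OF xy(2)] Bk[OF xy(1)] by blast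
        have "a j \<in> V" "b k \<in> V" using geoD(1)[OF al, of j] geoD(1)[OF be kj(1)] kj i'la by auto
        then show ?thesis using far[OF kj(3,4,1)] d_sym kj by metis
      qed
    qed
  qed
qed

text \<open>A far segment has length at most \<open>200 * K\<close> and ends at distance
  \<open>4 * K\<close>; the value is rounded up.\<close>

definition slimness :: nat where "slimness = 300 * K"

text \<open>From a far point follow \<open>c\<close> both ways until the distance to the other two
  sides has dropped to \<open>4 * K\<close>. Nearest points of the two ends lie on one side or on
  both; accordingly \<open>quadrilateral\<close> or \<open>corner\<close> bounds the length of the
  segment.\<close>

lemma slim:
  assumes c: "geo c lc" and al: "geo a la" and be: "geo b lb"
    and r: "m0 \<le> lb" "a la = b m0" and p: "i0 \<le> la" "c 0 = a i0" and q: "m1 \<le> lb" "c lc = b m1"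
    and k: "k \<le> lc"
  shows "ds (c k) (a ` {..la} \<union> b ` {..lb}) \<le> slimness"
proof (rule ccontr)
  let ?Y = "a ` {..la} \<union> b ` {..lb}" and ?t = "4 * K"
  let ?h = "\<lambda>i. ds (c i) ?Y"
  assume "\<not> ?h k \<le> slimness"
  then have big: "slimness < ?h k" by simp
  have Y: "?Y \<noteq> {}" "?Y \<subseteq> V" using geoD(1)[OF al] geoD(1)[OF be] by auto
  have tM: "?t \<le> slimness" unfolding slimness_def by simp
  have h0: "?h 0 = 0" unfolding p(2) using p(1) Y(2) by (intro ds_in) auto
  have hl: "?h lc = 0" unfolding q(2) using q(1) Y(2) by (intro ds_in) auto
  have cV: "c i \<in> V" if "i \<le> lc" for i using geoD(1)[OF c that] .
  have h1: "?h i \<le> Suc (?h j)" if "j = Suc i \<and> j \<le> lc \<or> i = Suc j \<and> i \<le> lc" for i j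
  proof -
    have V: "c i \<in> V" "c j \<in> V" using cV that by auto
    have "d (c i) (c j) = 1" using that geoD(2)[OF c, of i j] geoD(2)[OF c, of j i] d_sym[OF V] by auto
    then show ?thesis using ds_tri[OF Y V] by simp
  qed
  define s where "s = (GREATEST i. i \<le> k \<and> ?h i \<le> ?t)"
  have s: "s \<le> k" "?h s \<le> ?t"
    using GreatestI_nat[of "\<lambda>i. i \<le> k \<and> ?h i \<le> ?t" 0 k] h0 unfolding s_def by auto
  have s': "?t < ?h i" if "s < i" "i \<le> k" for i
    using Greatest_le_nat[of "\<lambda>i. i \<le> k \<and> ?h i \<le> ?t" i k] that unfolding s_def by force
  define e where "e = (LEAST i. k \<le> i \<and> ?h i \<le> ?t)"
  have e: "k \<le> e" "?h e \<le> ?t" "e \<le> lc"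
    using LeastI[of "\<lambda>i. k \<le> i \<and> ?h i \<le> ?t" lc] Least_le[of "\<lambda>i. k \<le> i \<and> ?h i \<le> ?t" lc] hl k unfolding e_def by auto
  have e': "?t < ?h i" if "k \<le> i" "i < e" for i
    using not_less_Least[of i "\<lambda>i. k \<le> i \<and> ?h i \<le> ?t"] that unfolding e_def by auto
  have sk: "s < k" using s big tM by (metis le_less_trans linorder_not_less nat_less_le order.trans)
  have ke: "k < e" using e big tM by (metis le_less_trans linorder_not_less nat_less_le order.trans)
  have hs: "?h s = ?t"
  proof -
    have "?h (Suc s) \<le> Suc (?h s)" by (rule h1) (use sk k in auto)
    moreover have "?t < ?h (Suc s)" by (rule s') (use sk in auto)
    ultimately show ?thesis using s(2) by linarith
  qed
  have he: "?h e = ?t"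
  proof -
    have "?h (e - 1) \<le> Suc (?h e)" by (rule h1) (use ke e(3) in auto)
    moreover have "?t < ?h (e - 1)" by (rule e') (use ke in auto)
    ultimately show ?thesis using e(2) by linarith
  qed
  have ge: "?t \<le> ?h i" if "s \<le> i" "i \<le> e" for i
    using that s'[of i] e'[of i] hs he by (metis le_less_linear less_imp_le nat_less_le order_refl)
  have sl: "s \<le> lc" using sk k by simp
  obtain C where C: "glist C" "hd C = c s" "last C = c e" "\<And>x. x \<in> set C \<Longrightarrow> \<exists>k. min s e \<le> k \<and> k \<le> max s e \<and> x = c k"
    using geo_segment[OF c sl e(3)] by blast
  have far: "?t \<le> d x y" if xC: "x \<in> set C" and yY: "y \<in> ?Y" for x y
  proof -
    obtain j where j: "s \<le> j" "j \<le> e" "x = c j" using C(4)[OF xC] sk ke by auto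
    have "?t \<le> ?h j" by (rule ge[OF j(1,2)])
    also have "\<dots> \<le> d x y" unfolding j(3) by (rule ds_le[OF yY])
    finally show ?thesis .
  qed
  have fa: "?t \<le> d x (a j)" if "x \<in> set C" "j \<le> la" for x j using far[OF that(1)] that(2) by blast
  have fb: "?t \<le> d x (b j)" if "x \<in> set C" "j \<le> lb" for x j using far[OF that(1)] that(2) by blast
  have ne: "C \<noteq> []" using C(1) pathD(1) unfolding glist_def by blast
  obtain u where u: "u \<in> ?Y" "d (c s) u = ?t" using ds_attained[OF Y(1), of "c s"] hs by auto
  obtain v where v: "v \<in> ?Y" "d (c e) v = ?t" using ds_attained[OF Y(1), of "c e"] he by auto
  have len: "length C - 1 \<le> 200 * K"
  proof -
    consider i m where "i \<le> la" "m \<le> la" "u = a i" "v = a m" | i m where "i \<le> lb" "m \<le> lb" "u = b i" "v = b m"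
      | i m where "i \<le> la" "m \<le> lb" "u = a i" "v = b m" | i m where "i \<le> la" "m \<le> lb" "v = a i" "u = b m"
      using u(1) v(1) by auto
    then show ?thesis
    proof cases
      case 1
      show ?thesis by (rule quadrilateral[OF C(1) al 1(1,2) _ _ fa refl]) (use 1 u v C in auto)
    next
      case 2
      show ?thesis by (rule quadrilateral[OF C(1) be 2(1,2) _ _ fb refl]) (use 2 u v C in auto)
    next
      case 3
      show ?thesis by (rule corner[OF C(1) al be r 3(1) _ 3(2) _ fa fb refl]) (use 3 u v C in auto)
    next
      case 4
      \<comment> \<open>\<open>corner\<close> wants the start near \<open>a\<close>, so the segment
        is traversed backwards.\<close>
      have "length (rev C) - 1 \<le> 200 * K"
        by (rule corner[OF glist_rev[OF C(1)] al be r 4(1) _ 4(2) _ _ _ refl])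
          (use 4 u v C fa fb ne in \<open>auto simp: hd_rev last_rev\<close>)
      then show ?thesis by simp
    qed
  qed
  have "length C = Suc (e - s)" using C(1) geoD(2)[OF c _ e(3), of s] sk ke unfolding glist_def C(2,3) by simp
  then have "k - s \<le> 200 * K" using len ke by simp
  moreover have "?h k \<le> d (c k) (c s) + ?h s" by (rule ds_tri[OF Y cV[OF k] cV[OF sl]])
  moreover have "d (c k) (c s) = k - s" using geoD(2)[OF c _ k, of s] s(1) d_sym[OF cV[OF k] cV[OF sl]] by simp
  ultimately have "?h k \<le> slimness" using hs unfolding slimness_def by simp
  then show False using big by simp
qed

section \<open>From slim triangles to the four-point inequality\<close>

definition gp :: "'v \<Rightarrow> 'v \<Rightarrow> 'v \<Rightarrow> real" where
  "gp w x y = (real (d w x) + real (d w y) - real (d x y)) / 2"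

lemma gp_le_side:
  assumes "geo c l" "w \<in> V" "k \<le> l"
  shows "gp w (c 0) (c l) \<le> real (d w (c k))"
proof -
  have V: "c 0 \<in> V" "c k \<in> V" "c l \<in> V" using geoD(1)[OF assms(1)] assms(3) by auto
  have "d w (c 0) \<le> d w (c k) + d (c k) (c 0)" "d w (c l) \<le> d w (c k) + d (c k) (c l)"
    using d_tri assms(2) V by blast+
  moreover have "d (c k) (c 0) = k" "d (c k) (c l) = l - k" "d (c 0) (c l) = l"
    using geoD(2)[OF assms(1), of 0 k] geoD(2)[OF assms(1), of k l] geoD(2)[OF assms(1), of 0 l] assms(3) d_sym[OF V(2,1)] by auto
  ultimately show ?thesis unfolding gp_def using assms(3) by (simp add: of_nat_diff field_simps)
qed

text \<open>Each point of the side is near one of the geodesics from \<open>w\<close> to its ends.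
  The last point near the first of them is one step from a point near the second, or is the end
  point itself, so it is near both. Since distances add up along these geodesics, it is about as far
  from \<open>w\<close> as the Gromov product says.\<close>

lemma side_near:
  assumes c: "geo c l" and w: "w \<in> V"
  shows "\<exists>k\<le>l. real (d w (c k)) \<le> gp w (c 0) (c l) + 2 * real slimness + 1"
proof -
  let ?x = "c 0" and ?z = "c l"
  have V: "?x \<in> V" "?z \<in> V" using geoD(1)[OF c] by auto
  obtain a where a: "geo a (d ?x w)" "a 0 = ?x" "a (d ?x w) = w" using geo_exists[OF V(1) w] by blast
  obtain b where b: "geo b (d w ?z)" "b 0 = w" "b (d w ?z) = ?z" using geo_exists[OF w V(2)] by blast
  let ?la = "d ?x w" and ?lb = "d w ?z"
  let ?A = "a ` {..?la}" and ?B = "b ` {..?lb}"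
  have AV: "?A \<noteq> {}" "?A \<subseteq> V" and BV: "?B \<noteq> {}" "?B \<subseteq> V" using geoD(1)[OF a(1)] geoD(1)[OF b(1)] by auto
  have near: "ds (c k) ?A \<le> slimness \<or> ds (c k) ?B \<le> slimness" if k: "k \<le> l" for k
  proof -
    have "ds (c k) (?A \<union> ?B) \<le> slimness"
      by (rule slim[OF c a(1) b(1), of 0 0 ?lb]) (use a b k in auto)
    moreover obtain y where "y \<in> ?A \<union> ?B" "d (c k) y = ds (c k) (?A \<union> ?B)" using ds_attained[of "?A \<union> ?B" "c k"] AV(1) by blast
    ultimately show ?thesis using ds_le[of y ?A "c k"] ds_le[of y ?B "c k"] by auto
  qed
  have "\<exists>k\<le>l. ds (c k) ?A \<le> slimness \<and> ds (c k) ?B \<le> Suc slimness"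
  proof -
    define k where "k = (GREATEST k. k \<le> l \<and> ds (c k) ?A \<le> slimness)"
    have "?x \<in> ?A" using a(2) by (metis atMost_iff image_eqI le0)
    then have "ds (c 0) ?A = 0" using V by (intro ds_in)
    then have k: "k \<le> l" "ds (c k) ?A \<le> slimness"
      using GreatestI_nat[of "\<lambda>k. k \<le> l \<and> ds (c k) ?A \<le> slimness" 0 l] unfolding k_def by auto
    have k': "\<not> ds (c j) ?A \<le> slimness" if "k < j" "j \<le> l" for j
      using Greatest_le_nat[of "\<lambda>k. k \<le> l \<and> ds (c k) ?A \<le> slimness" j l] that unfolding k_def by force
    have "ds (c k) ?B \<le> Suc slimness"
    proof (cases "k = l")
      case True
      have "?z \<in> ?B" using b(3) by (metis atMost_iff image_eqI order_refl)
      then have "ds (c l) ?B = 0" using V by (intro ds_in)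
      then show ?thesis using True by simp
    next
      case False
      then have kl: "Suc k \<le> l" using k by simp
      then have "ds (c (Suc k)) ?B \<le> slimness" using near[OF kl] k'[of "Suc k"] by simp
      moreover have "d (c k) (c (Suc k)) = 1" using geoD(2)[OF c _ kl, of k] by simp
      moreover have "ds (c k) ?B \<le> d (c k) (c (Suc k)) + ds (c (Suc k)) ?B"
        by (rule ds_tri[OF BV geoD(1)[OF c k(1)] geoD(1)[OF c kl]])
      ultimately show ?thesis by simp
    qed
    then show ?thesis using k by blast
  qed
  then obtain k where k: "k \<le> l" "ds (c k) ?A \<le> slimness" "ds (c k) ?B \<le> Suc slimness" by blast
  have cV: "c k \<in> V" using geoD(1)[OF c k(1)] .
  obtain i where i: "i \<le> ?la" "d (c k) (a i) \<le> slimness" using ds_attained[OF AV(1), of "c k"] k(2) by auto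
  obtain j where j: "j \<le> ?lb" "d (c k) (b j) \<le> Suc slimness" using ds_attained[OF BV(1), of "c k"] k(3) by auto
  have ij: "a i \<in> V" "b j \<in> V" using geoD(1)[OF a(1) i(1)] geoD(1)[OF b(1) j(1)] by auto
  have "d ?x w = d ?x (a i) + d (a i) w"
    using geoD(2)[OF a(1), of 0 i] geoD(2)[OF a(1), of i ?la] a(2,3) i(1) by simp
  moreover have "d w ?z = d w (b j) + d (b j) ?z"
    using geoD(2)[OF b(1), of 0 j] geoD(2)[OF b(1), of j ?lb] b(2,3) j(1) by simp
  moreover have "d ?x (c k) \<le> d ?x (a i) + d (a i) (c k)" "d w (c k) \<le> d w (a i) + d (a i) (c k)"
    "d w (c k) \<le> d w (b j) + d (b j) (c k)" "d (c k) ?z \<le> d (c k) (b j) + d (b j) ?z"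
    using d_tri V w ij cV by blast+
  moreover have "d ?x ?z = d ?x (c k) + d (c k) ?z"
    using geoD(2)[OF c, of 0 k] geoD(2)[OF c, of k l] geoD(2)[OF c, of 0 l] k(1) by simp
  moreover note d_sym[OF cV ij(1)] d_sym[OF cV ij(2)] d_sym[OF V(1) w] d_sym[OF ij(1) w]
  ultimately have "2 * d w (c k) + d ?x ?z \<le> d w ?x + d w ?z + 4 * slimness + 2" using i(2) j(2) by linarith
  then have "2 * real (d w (c k)) + real (d ?x ?z) \<le> real (d w ?x) + real (d w ?z) + 4 * real slimness + 2" by linarith
  then have "real (d w (c k)) \<le> gp w ?x ?z + 2 * real slimness + 1" unfolding gp_def by (simp add: field_simps)
  then show ?thesis using k(1) by blast
qed

text \<open>The point of the side from \<open>x\<close> to \<open>z\<close> given by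
  \<open>side_near\<close> is within \<open>slimness\<close> of another side, and all points of that
  side are at least its Gromov product away from \<open>w\<close>.\<close>

theorem four_point:
  assumes "w \<in> V" "x \<in> V" "y \<in> V" "z \<in> V"
  shows "gp w x z \<ge> min (gp w x y) (gp w y z) - (3 * real slimness + 1)"
proof -
  obtain c where c: "geo c (d x z)" "c 0 = x" "c (d x z) = z" using geo_exists[OF assms(2,4)] by blast
  obtain a where a: "geo a (d x y)" "a 0 = x" "a (d x y) = y" using geo_exists[OF assms(2,3)] by blast
  obtain b where b: "geo b (d y z)" "b 0 = y" "b (d y z) = z" using geo_exists[OF assms(3,4)] by blast
  obtain k where k: "k \<le> d x z" "real (d w (c k)) \<le> gp w x z + 2 * real slimness + 1"
    using side_near[OF c(1) assms(1)] c by auto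
  let ?A = "a ` {..d x y}" and ?B = "b ` {..d y z}"
  have "ds (c k) (?A \<union> ?B) \<le> slimness"
    by (rule slim[OF c(1) a(1) b(1), of 0 0 "d y z"]) (use a b c k in auto)
  moreover obtain u where u: "u \<in> ?A \<union> ?B" "d (c k) u = ds (c k) (?A \<union> ?B)"
    using ds_attained[of "?A \<union> ?B" "c k"] by blast
  ultimately have du: "d (c k) u \<le> slimness" by simp
  have V: "c k \<in> V" "u \<in> V" using geoD(1)[OF c(1) k(1)] u(1) geoD(1)[OF a(1)] geoD(1)[OF b(1)] by auto
  have "min (gp w x y) (gp w y z) \<le> real (d w u)"
    using u(1) gp_le_side[OF a(1) assms(1)] gp_le_side[OF b(1) assms(1)] a b by (auto simp: min_le_iff_disj)
  moreover have "d w u \<le> d w (c k) + d (c k) u" by (rule d_tri[OF assms(1) V])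
  ultimately show ?thesis using k(2) du by linarith
qed

end

section \<open>Cayley graphs\<close>

lemma words_over_append [simp]: "u @ v \<in> words_over S \<longleftrightarrow> u \<in> words_over S \<and> v \<in> words_over S"
  by (auto simp: words_over_def)

lemma words_over_inv [simp]: "inv_word u \<in> words_over S \<longleftrightarrow> u \<in> words_over S"
  by (auto simp: words_over_def inv_word_def)

lemma word_dist_le: "w \<in> words_over S \<Longrightarrow> pres_eq R (u @ w) v \<Longrightarrow> word_dist S R u v \<le> length w"
  unfolding word_dist_def by (rule Least_le) blast

lemma word_dist_attained:
  assumes "u \<in> words_over S" "v \<in> words_over S"
  shows "\<exists>w\<in>words_over S. length w = word_dist S R u v \<and> pres_eq R (u @ w) v"
proof -
  have "pres_eq R ((u @ inv_word u) @ v) ([] @ v)" by (rule pres_eq_appendR[OF pres_eq_inv_right])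
  then have "\<exists>k. \<exists>w\<in>words_over S. length w = k \<and> pres_eq R (u @ w) v"
    using assms by (intro exI[of _ "length (inv_word u @ v)"] bexI[of _ "inv_word u @ v"]) auto
  then show ?thesis unfolding word_dist_def by (rule LeastI_ex)
qed

lemma word_dist_cong:
  assumes "pres_eq R u u'" "pres_eq R v v'"
  shows "word_dist S R u v = word_dist S R u' v'"
proof -
  have "pres_eq R (u @ w) v \<longleftrightarrow> pres_eq R (u' @ w) v'" for w
    using pres_eq_appendR[OF assms(1), of w] assms(2) pres_trans pres_sym by metis
  then show ?thesis unfolding word_dist_def by simp
qed

lemma word_dist_self: "word_dist S R u u = 0"
  using word_dist_le[of "[]" S R u u] by (simp add: words_over_def pres_refl)

lemma word_dist_zero:
  assumes "u \<in> words_over S" "v \<in> words_over S" "word_dist S R u v = 0"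
  shows "pres_eq R u v"
  using word_dist_attained[OF assms(1,2), of R] assms(3) by auto

lemma word_dist_sym_le:
  assumes "u \<in> words_over S" "v \<in> words_over S"
  shows "word_dist S R v u \<le> word_dist S R u v"
proof -
  obtain w where w: "w \<in> words_over S" "length w = word_dist S R u v" "pres_eq R (u @ w) v"
    using word_dist_attained[OF assms] by blast
  have "pres_eq R (v @ inv_word w) ((u @ w) @ inv_word w)" by (rule pres_eq_appendR[OF pres_sym[OF w(3)]])
  moreover have "pres_eq R (u @ (w @ inv_word w)) (u @ [])" by (rule pres_eq_append[OF pres_refl pres_eq_inv_right])
  ultimately have "pres_eq R (v @ inv_word w) u" using pres_trans by fastforce
  then have "word_dist S R v u \<le> length (inv_word w)" using w(1) by (intro word_dist_le) simp_all
  then show ?thesis using w(2) by (simp add: inv_word_def)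
qed

lemma word_dist_triangle:
  assumes "u \<in> words_over S" "v \<in> words_over S" "t \<in> words_over S"
  shows "word_dist S R u t \<le> word_dist S R u v + word_dist S R v t"
proof -
  obtain w where w: "w \<in> words_over S" "length w = word_dist S R u v" "pres_eq R (u @ w) v"
    using word_dist_attained[OF assms(1,2)] by blast
  obtain w' where w': "w' \<in> words_over S" "length w' = word_dist S R v t" "pres_eq R (v @ w') t"
    using word_dist_attained[OF assms(2,3)] by blast
  have "pres_eq R ((u @ w) @ w') t" using pres_trans[OF pres_eq_appendR[OF w(3)] w'(3)] .
  then have "word_dist S R u t \<le> length (w @ w')" using w(1) w'(1) by (intro word_dist_le) simp_all
  then show ?thesis using w(2) w'(2) by simp
qed

lemma word_area_cong:
  assumes "\<And>u v. pres_eq R u v \<Longrightarrow> f u = f v" "\<And>u v. pres_eq R u v \<Longrightarrow> g u = g v"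
  shows "pres_eq R u v \<Longrightarrow> word_area f g u w = word_area f g v w"
proof (induction w arbitrary: u v)
  case (Cons a w)
  have "pres_eq R (u @ [a]) (v @ [a])" by (rule pres_eq_appendR[OF Cons.prems])
  then show ?case using Cons assms(1)[OF Cons.prems] assms(2)[OF Cons.prems] assms(1)[of "u @ [a]" "v @ [a]"]
      assms(2)[of "u @ [a]" "v @ [a]"] by (simp add: step_area_def)
qed simp

lemma word_area_translate: "word_area (\<lambda>u. f (x @ u)) (\<lambda>u. g (x @ u)) v w = word_area f g (x @ v) w"
  by (induction w arbitrary: v) (simp_all add: step_area_def)

text \<open>The summand 1 absorbs the constant term of the area bound and turns the number of
  letters into the number of vertices of a loop, by which \<open>area_space\<close> measures
  it.\<close>

locale area_presentation =
  fixes S :: "'g set" and R :: "'g word list" and K :: nat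
  assumes K1: "1 \<le> K"
    and area_bound: "w \<in> words_over S \<Longrightarrow> pres_eq R w [] \<Longrightarrow> lip_word S R f \<Longrightarrow> lip_word S R g \<Longrightarrow>
      \<bar>word_area f g [] w\<bar> \<le> real K * real (length w + 1)"
begin

text \<open>Vertices of the Cayley graph are chosen words, one for each group element, so that
  distance zero means equality.\<close>

definition rep :: "'g word \<Rightarrow> 'g word" where
  "rep u = (SOME v. v \<in> words_over S \<and> pres_eq R u v)"

lemma rep:
  assumes "u \<in> words_over S"
  shows "rep u \<in> words_over S" "pres_eq R u (rep u)"
  using someI[of "\<lambda>v. v \<in> words_over S \<and> pres_eq R u v" u] assms pres_refl unfolding rep_def by blast+

lemma rep_cong: "pres_eq R u v \<Longrightarrow> rep u = rep v"
proof -
  assume "pres_eq R u v"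
  then have "(\<lambda>t. t \<in> words_over S \<and> pres_eq R u t) = (\<lambda>t. t \<in> words_over S \<and> pres_eq R v t)"
    using pres_trans pres_sym by blast
  then show ?thesis unfolding rep_def by simp
qed

definition V :: "'g word set" where "V = rep ` words_over S"

lemma V_words: "x \<in> V \<Longrightarrow> x \<in> words_over S"
  unfolding V_def using rep(1) by blast

lemma rep_V: "x \<in> V \<Longrightarrow> rep x = x"
  unfolding V_def using rep(2) rep_cong by (metis imageE)

lemma rep_in_V: "u \<in> words_over S \<Longrightarrow> rep u \<in> V"
  unfolding V_def by blast

lemma dist_rep: "u \<in> words_over S \<Longrightarrow> v \<in> words_over S \<Longrightarrow> word_dist S R (rep u) (rep v) = word_dist S R u v"
  by (rule word_dist_cong[symmetric]) (rule rep(2); assumption)+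

lemma V_eq:
  assumes "x \<in> V" "y \<in> V" "pres_eq R x y"
  shows "x = y"
  using rep_cong[OF assms(3)] rep_V assms by metis

text \<open>A step of length zero repeats a vertex and contributes no letter; every other step
  contributes one.\<close>

lemma chain_word:
  assumes f: "\<And>u v. pres_eq R u v \<Longrightarrow> f u = f v" and g: "\<And>u v. pres_eq R u v \<Longrightarrow> g u = g v"
  shows "xs \<noteq> [] \<Longrightarrow> set xs \<subseteq> V \<Longrightarrow> successively (\<lambda>x y. word_dist S R x y \<le> 1) xs \<Longrightarrow>
    \<exists>w\<in>words_over S. length w < length xs \<and> pres_eq R (hd xs @ w) (last xs) \<and> chain_area f g xs = word_area f g (hd xs) w"
proof (induction xs rule: induct_list012)
  case (2 x)
  show ?case by (rule bexI[of _ "[]"]) (auto simp: pres_refl words_over_def)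
next
  case (3 x y zs)
  have xy: "x \<in> V" "y \<in> V" "word_dist S R x y \<le> 1" using 3(4,5) by auto
  obtain w where w: "w \<in> words_over S" "length w < length (y # zs)" "pres_eq R (y @ w) (last (y # zs))"
    "chain_area f g (y # zs) = word_area f g y w" using 3(2) 3(4,5) by auto
  obtain w1 where w1: "w1 \<in> words_over S" "length w1 = word_dist S R x y" "pres_eq R (x @ w1) y"
    using word_dist_attained[OF V_words[OF xy(1)] V_words[OF xy(2)], of R] by blast
  show ?case
  proof (cases w1)
    case Nil
    then have "x = y" using V_eq xy w1(3) by simp
    then show ?thesis using w by (intro bexI[of _ w]) auto
  next
    case (Cons a t)
    then have a: "w1 = [a]" using w1(2) xy(3) by (cases t) auto
    have e: "pres_eq R (x @ [a]) y" using w1(3) a by simp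
    have wc: "word_area f g (x @ [a]) w = word_area f g y w"
      by (rule word_area_cong[OF _ _ e]) (erule f, erule g)
    have 1: "chain_area f g (x # y # zs) = word_area f g x (a # w)"
      using w(4) wc f[OF e] g[OF e] by (simp add: step_area_def)
    have 2: "pres_eq R ((x @ [a]) @ w) (last (y # zs))"
      by (rule pres_trans[OF pres_eq_appendR[OF e] w(3)])
    show ?thesis
      by (rule bexI[of _ "a # w"]) (use 1 2 w w1(1) a in \<open>auto simp: words_over_def\<close>)
  qed
qed simp

text \<open>Loops start anywhere, whereas the area bound speaks of words read from the identity;
  hence the translation by \<open>x\<close>.\<close>

lemma rep_lip_word:
  assumes f: "\<And>x y. x \<in> V \<Longrightarrow> y \<in> V \<Longrightarrow> \<bar>f x - f y\<bar> \<le> real (word_dist S R x y)" and x: "x \<in> words_over S"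
  shows "lip_word S R (\<lambda>u. f (rep (x @ u)))"
  unfolding lip_word_def
proof (intro conjI allI impI)
  show "f (rep (x @ u)) = f (rep (x @ v))" if "pres_eq R u v" for u v
    using rep_cong[OF pres_eq_append[OF pres_refl that]] by simp
  fix u :: "'g word" and a :: "'g letter" assume u: "u \<in> words_over S" "fst a \<in> S"
  have xu: "x @ u \<in> words_over S" "x @ u @ [a] \<in> words_over S" using u x by (auto simp: words_over_def)
  have "word_dist S R (rep (x @ u @ [a])) (rep (x @ u)) = word_dist S R (x @ u @ [a]) (x @ u)" by (rule dist_rep[OF xu(2,1)])
  also have "\<dots> \<le> word_dist S R (x @ u) (x @ u @ [a])" by (rule word_dist_sym_le[OF xu])
  also have "\<dots> \<le> length [a]" by (rule word_dist_le) (use u in \<open>auto simp: words_over_def pres_refl\<close>)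
  finally have "real (word_dist S R (rep (x @ u @ [a])) (rep (x @ u))) \<le> 1" by simp
  then show "\<bar>f (rep (x @ u @ [a])) - f (rep (x @ u))\<bar> \<le> 1"
    using f[OF rep_in_V[OF xu(2)] rep_in_V[OF xu(1)]] by linarith
qed

sublocale area_space V "word_dist S R" K
proof
  fix x y z assume x: "x \<in> V" and y: "y \<in> V"
  show "word_dist S R x x = 0" by (rule word_dist_self)
  show "word_dist S R x y = 0 \<Longrightarrow> x = y" using word_dist_zero V_words V_eq x y by blast
  show "word_dist S R x y = word_dist S R y x"
    using word_dist_sym_le[OF V_words[OF x] V_words[OF y], of R] word_dist_sym_le[OF V_words[OF y] V_words[OF x], of R] by simp
  show "z \<in> V \<Longrightarrow> word_dist S R x z \<le> word_dist S R x y + word_dist S R y z"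
    using word_dist_triangle V_words x y by blast
  fix k assume k: "word_dist S R x y = Suc k"
  have xw: "x \<in> words_over S" "y \<in> words_over S" using V_words x y by auto
  obtain w where w: "w \<in> words_over S" "length w = Suc k" "pres_eq R (x @ w) y"
    using word_dist_attained[OF xw, of R] k by metis
  obtain v a where va: "w = v @ [a]" using w(2) by (metis length_0_conv nat.distinct(1) rev_exhaust)
  have vw: "v \<in> words_over S" "[a] \<in> words_over S" using w(1) va by auto
  have z: "x @ v \<in> words_over S" using xw vw by simp
  have 1: "word_dist S R x (x @ v) \<le> k"
    using word_dist_le[OF vw(1), of R x "x @ v"] w(2) va by (simp add: pres_refl)
  have 2: "word_dist S R (x @ v) y \<le> 1" using word_dist_le[OF vw(2), of R "x @ v" y] w(3) va by simp
  have "word_dist S R x y \<le> word_dist S R x (x @ v) + word_dist S R (x @ v) y"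
    by (rule word_dist_triangle[OF xw(1) z xw(2)])
  then have "word_dist S R x (x @ v) = k \<and> word_dist S R (x @ v) y = 1" using 1 2 k by linarith
  moreover have "word_dist S R x (rep (x @ v)) = word_dist S R x (x @ v)"
    by (rule word_dist_cong[OF pres_refl pres_sym[OF rep(2)[OF z]]])
  moreover have "word_dist S R (rep (x @ v)) y = word_dist S R (x @ v) y"
    by (rule word_dist_cong[OF pres_sym[OF rep(2)[OF z]] pres_refl])
  ultimately show "\<exists>z\<in>V. word_dist S R x z = k \<and> word_dist S R z y = 1" using rep_in_V[OF z] by auto
next
  show "1 \<le> K" by (rule K1)
next
  fix xs and f g :: "'g word \<Rightarrow> real"
  assume xs: "xs \<noteq> []" "set xs \<subseteq> V" "successively (\<lambda>x y. word_dist S R x y \<le> 1) xs" "last xs = hd xs"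
    and f: "\<And>x y. x \<in> V \<Longrightarrow> y \<in> V \<Longrightarrow> \<bar>f x - f y\<bar> \<le> real (word_dist S R x y)"
    and g: "\<And>x y. x \<in> V \<Longrightarrow> y \<in> V \<Longrightarrow> \<bar>g x - g y\<bar> \<le> real (word_dist S R x y)"
  let ?F = "\<lambda>u. f (rep u)" and ?G = "\<lambda>u. g (rep u)"
  have cong: "?F u = ?F v" "?G u = ?G v" if "pres_eq R u v" for u v using rep_cong[OF that] by simp_all
  have "\<exists>w\<in>words_over S. length w < length xs \<and> pres_eq R (hd xs @ w) (last xs) \<and>
      chain_area ?F ?G xs = word_area ?F ?G (hd xs) w"
    by (rule chain_word[OF _ _ xs(1-3)]) (rule cong; assumption)+
  then obtain w where w: "w \<in> words_over S" "length w < length xs" "pres_eq R (hd xs @ w) (hd xs)"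
    "chain_area ?F ?G xs = word_area ?F ?G (hd xs) w" using xs(4) by auto
  let ?x = "hd xs"
  have x: "?x \<in> words_over S" by (rule V_words[OF subsetD[OF xs(2) hd_in_set[OF xs(1)]]])
  have "chain_area f g ys = chain_area ?F ?G ys" if "set ys \<subseteq> V" for ys
    using that by (induction ys rule: induct_list012) (auto simp: rep_V)
  then have e: "chain_area f g xs = word_area (\<lambda>u. ?F (?x @ u)) (\<lambda>u. ?G (?x @ u)) [] w"
    using xs(2) w(4) word_area_translate[where f = ?F and g = ?G and x = ?x and v = "[]" and w = w] by simp
  have "pres_eq R (inv_word ?x @ (?x @ w)) (inv_word ?x @ ?x)" by (rule pres_eq_append[OF pres_refl w(3)])
  moreover have "pres_eq R ((inv_word ?x @ ?x) @ w) ([] @ w)" by (rule pres_eq_appendR[OF pres_eq_inv_left])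
  ultimately have "pres_eq R w []" using pres_eq_inv_left[of R ?x] pres_trans pres_sym by (metis append_Nil append_assoc)
  then have "\<bar>chain_area f g xs\<bar> \<le> real K * real (length w + 1)"
    unfolding e using rep_lip_word[OF f x] rep_lip_word[OF g x] w(1) by (intro area_bound)
  also have "\<dots> \<le> real K * real (length xs)" using w(2) by (intro mult_left_mono) auto
  finally show "\<bar>chain_area f g xs\<bar> \<le> real K * real (length xs)" .
qed

lemma gromov_product_rep:
  assumes "w \<in> words_over S" "x \<in> words_over S" "y \<in> words_over S"
  shows "gromov_product S R w x y = gp (rep w) (rep x) (rep y)"
  unfolding gromov_product_def gp_def using dist_rep assms by simp

theorem hyperbolic:
  assumes "finite S" "\<And>r. r \<in> set R \<Longrightarrow> r \<in> words_over S"
  shows "hyperbolic_presentation S R"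
  unfolding hyperbolic_presentation_def
proof (intro conjI ballI exI[of _ "3 * real slimness + 1"])
  show "finite S" by fact
  show "r \<in> words_over S" if "r \<in> set R" for r using assms(2)[OF that] .
  fix w x y z assume w: "w \<in> words_over S" "x \<in> words_over S" "y \<in> words_over S" "z \<in> words_over S"
  show "min (gromov_product S R w x y) (gromov_product S R w y z) - (3 * real slimness + 1) \<le> gromov_product S R w x z"
    unfolding gromov_product_rep[OF w(1,2,3)] gromov_product_rep[OF w(1,3,4)] gromov_product_rep[OF w(1,2,4)]
    using w by (intro four_point rep_in_V)
qed

end

theorem theorem7p1:
  fixes n :: nat
  assumes "n \<ge> 11" and "n \<noteq> 12" and "n \<noteq> 14"
  shows "hyperbolic_presentation {0..<n} (H3_relators n)"
proof -
  have n: "n > 0" using assms(1) by simp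
  \<comment> \<open>The constant absorbs both terms of
    \<open>3960 * length w + 7920\<close>.\<close>
  interpret area_presentation "{0..<n}" "H3_relators n" 7920
  proof
    fix w f g
    assume "w \<in> words_over {0..<n}" "pres_eq (H3_relators n) w []"
      "lip_word {0..<n} (H3_relators n) f" "lip_word {0..<n} (H3_relators n) g"
    from H3_word_area_bound[OF assms this]
    show "\<bar>word_area f g [] w\<bar> \<le> real 7920 * real (length w + 1)" by simp
  qed simp
  show ?thesis
    by (rule hyperbolic) (use triangular_H3[OF n] in \<open>auto simp: triangular_def\<close>)
qed

end
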